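(* Let $R={\mathbb K}[x_1][x_2;\sigma_2,\delta_2]\cdots[x_N;\sigma_N,\delta_N]$ be a uniparameter QNA of rank $n$. Assume that (i) none of the generators $x_1,\ldots,x_N$ is central in $R$, and (ii) Hypothesis (H) holds. Then every derivation $D\in\operatorname{Der}(R)$ can be written uniquely as $D=\operatorname{ad}_x+\theta_\eta$, where $x\in R$ and $\theta_\eta$ is the derivation of $R$ associated to a group homomorphism $\eta:Q\to\operatorname{Z}(R)$, defined by $\theta_\eta(a)=\eta(\operatorname{wt}(a))\,a$ for every homogeneous $a\in R$. (Uniqueness: the pair $(\operatorname{ad}_x,\eta)$ is uniquely determined by $D$.)
   Context: ${\mathbb K}$ is a field of characteristic $0$; $\operatorname{Der}$ denotes ${\mathbb K}$-derivations, $\operatorname{ad}_x(b)=xb-bx$, $\operatorname{Z}$ the center. A quantum nilpotent algebra (QNA) is an iterated Ore extension $R={\mathbb K}[x_1][x_2;\sigma_2,\delta_2]\cdots[x_N;\sigma_N,\delta_N]$, where $R_k={\mathbb K}[x_1][x_2;\sigma_2,\delta_2]\cdots[x_k;\sigma_k,\delta_k]$ ($R_0={\mathbb K}$), $\sigma_k$ is a ${\mathbb K}$-automorphism and $\delta_k$ a $\sigma_k$-derivation of $R_{k-1}$, together with a torus $\mathcal H$ acting rationally by ${\mathbb K}$-automorphisms on $R$ with each $x_i$ an $\mathcal H$-eigenvector, such that: (i) $\sigma_k(x_j)=\lambda_{kj}x_j$ for $j<k$, with $\lambda_{kj}\in{\mathbb K}^*$; (ii) $\delta_k$ is locally nilpotent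 on $R_{k-1}$; (iii) for each $k$ there exist $h_k\in\mathcal H$ and $q_k\in{\mathbb K}^*$ not a root of unity such that $h_k$ acts on $R_{k-1}$ as $\sigma_k$ and $h_k\cdot x_k=q_kx_k$. It is uniparameter if there are $q\in{\mathbb K}^*$ not a root of unity and a skew-symmetric integer matrix $(a_{ij})$ with $\lambda_{kj}=q^{a_{kj}}$ for all $j<k$. The rank is $n=|\{k:\delta_k=0\}|$ and $\mathcal H=({\mathbb K}^* )^n$ is taken maximal. Its character group $Q=X(\mathcal H)\cong\mathbb Z^n$ grades $R$; homogeneous elements are the $\mathcal H$-eigenvectors and $\operatorname{wt}(a)\in Q$ is the weight of a homogeneous $a$. Goodearl–Yakimov elements: there is a surjective map $\mu:[1,N]\to[1,n]$ with predecessor $p(k)=\max\{j<k:\mu(j)=\mu(k)\}$ (or $-\infty$) and successor $s(k)=\min\{j>k:\mu(j)=\mu(k)\}$ (or $+\infty$), and homogeneous elements $y_1,\ldots,y_N\in R$, uniquely determined, with $y_k=x_k$ if $p(k)=-\infty$ and $y_k=y_{p(k)}x_k-c_k$ for some $c_k\in R_{k-1}$ otherwise, such that for every $k$ the set $\{y_j:j\le k,\ s(j)>k\}$ is, up to nonzero scalars, the set of homogeneous prime elements (nonzero normal elements $p$ with $pR$ completely prime) of $R_k$. They satisfy $y_jy_i=q_{ij}y_iy_j$ with $q_{ij}$ powers of $q$; $\mathcal A_{\mathbf q}\subseteq R$ is the quantum affine space they generate and $\mathcal T_{\mathbf q}=R[y_1^{-1},\ldots,y_N^{-1}]$ the associated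 quantum torus. Let $\mathfrak s_{+\infty}=\{k:s(k)=+\infty\}$. The center $\operatorname{Z}(\mathcal T_{\mathbf q})$ is a Laurent polynomial ring ${\mathbb K}[z_1^{\pm1},\ldots,z_\ell^{\pm1}]$ whose generators can be chosen to be Laurent monomials in the $y_j$, $j\in\mathfrak s_{+\infty}$; for such a monomial $z$, $\operatorname{supp}z$ is the set of $j\in\mathfrak s_{+\infty}$ whose exponent in $z$ is nonzero. Hypothesis (H): there exist such monomial generators $z_1,\ldots,z_\ell$ of $\operatorname{Z}(\mathcal T_{\mathbf q})$ and a subset $C=\{c_1,\ldots,c_\ell\}\subseteq\mathfrak s_{+\infty}$ with $|C|=\ell$ such that for all $i\in[1,\ell]$: (H1) $z_i\in\mathcal A_{\mathbf q}$; (H2) the exponent of $y_{c_j}$ in $z_i$ is $\delta_{ij}$ for all $j$; (H3) if $|\operatorname{supp}z_i|\ge2$ then $\operatorname{supp}z_i\setminus\{c_i\}\not\subseteq\bigcup_{j\neq i}\operatorname{supp}z_j$. *)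

theory Defs
  imports Main
begin

text \<open>The K-algebra structure of a ring 'r is given by a map emb : K -> 'r which is an
injective unital ring homomorphism with central image.\<close>

definition scalar_emb :: "('k::field \<Rightarrow> 'r::ring_1) \<Rightarrow> bool" where
  "scalar_emb emb \<longleftrightarrow> emb 1 = 1 \<and> (\<forall>a b. emb (a + b) = emb a + emb b)
     \<and> (\<forall>a b. emb (a * b) = emb a * emb b) \<and> inj emb \<and> (\<forall>c r. emb c * r = r * emb c)"

definition center :: "'r::ring_1 set" where
  "center = {z. \<forall>a. z * a = a * z}"

definition ad :: "'r::ring_1 \<Rightarrow> 'r \<Rightarrow> 'r" where
  "ad x b = x * b - b * x"

definition kspan :: "('k::field \<Rightarrow> 'r::ring_1) \<Rightarrow> 'r set \<Rightarrow> 'r set" where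
  "kspan emb S = {a. \<exists>F c. finite F \<and> F \<subseteq> S \<and> a = (\<Sum>s\<in>F. emb (c s) * s)}"

text \<open>K-linear independence of a family f indexed by I (this also forces f to be injective on I).\<close>
definition kindep :: "('k::field \<Rightarrow> 'r::ring_1) \<Rightarrow> ('i \<Rightarrow> 'r) \<Rightarrow> 'i set \<Rightarrow> bool" where
  "kindep emb f I \<longleftrightarrow> (\<forall>F c. finite F \<longrightarrow> F \<subseteq> I \<longrightarrow> (\<Sum>i\<in>F. emb (c i) * f i) = 0
       \<longrightarrow> (\<forall>i\<in>F. c i = 0))"

inductive_set subalg :: "('k::field \<Rightarrow> 'r::ring_1) \<Rightarrow> 'r set \<Rightarrow> 'r set"
  for emb :: "'k \<Rightarrow> 'r" and S :: "'r set" where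
  scal: "emb c \<in> subalg emb S"
| gen: "s \<in> S \<Longrightarrow> s \<in> subalg emb S"
| add: "a \<in> subalg emb S \<Longrightarrow> b \<in> subalg emb S \<Longrightarrow> a + b \<in> subalg emb S"
| mult: "a \<in> subalg emb S \<Longrightarrow> b \<in> subalg emb S \<Longrightarrow> a * b \<in> subalg emb S"
| neg: "a \<in> subalg emb S \<Longrightarrow> - a \<in> subalg emb S"

primrec oprod :: "nat \<Rightarrow> (nat \<Rightarrow> 'a::ring_1) \<Rightarrow> 'a" where
  "oprod 0 f = 1"
| "oprod (Suc k) f = oprod k f * f (Suc k)"

definition rinv :: "'a::ring_1 \<Rightarrow> 'a" where
  "rinv u = (THE v. v * u = 1 \<and> u * v = 1)"

definition ipow :: "'a::ring_1 \<Rightarrow> int \<Rightarrow> 'a" where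
  "ipow u k = (if 0 \<le> k then u ^ nat k else rinv u ^ nat (- k))"

definition is_unit :: "'a::ring_1 \<Rightarrow> bool" where
  "is_unit u \<longleftrightarrow> (\<exists>v. v * u = 1 \<and> u * v = 1)"

definition nexps :: "nat \<Rightarrow> (nat \<Rightarrow> nat) set" where
  "nexps m = {e. \<forall>j. e j \<noteq> 0 \<longrightarrow> j \<in> {1..m}}"

definition zexps :: "nat \<Rightarrow> (nat \<Rightarrow> int) set" where
  "zexps m = {e. \<forall>j. e j \<noteq> 0 \<longrightarrow> j \<in> {1..m}}"

definition Rsub :: "('k::field \<Rightarrow> 'r::ring_1) \<Rightarrow> (nat \<Rightarrow> 'r) \<Rightarrow> nat \<Rightarrow> 'r set" where
  "Rsub emb x k = subalg emb (x ` {1..k})"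

definition omon :: "(nat \<Rightarrow> 'r::ring_1) \<Rightarrow> nat \<Rightarrow> (nat \<Rightarrow> nat) \<Rightarrow> 'r" where
  "omon x N e = oprod N (\<lambda>j. x j ^ e j)"

text \<open>The ring 'r (with K-structure emb) is the iterated Ore extension
  K[x_1][x_2;sigma_2,delta_2]...[x_N;sigma_N,delta_N]: the ordered monomials form a K-basis of 'r,
  sigma_k is a K-algebra automorphism of R_{k-1}, delta_k is a (K-linear) sigma_k-derivation of
  R_{k-1}, and x_k a = sigma_k(a) x_k + delta_k(a) for a in R_{k-1}.  This is the standard
  intrinsic description of an iterated Ore extension.\<close>
definition iterated_ore ::
  "('k::field \<Rightarrow> 'r::ring_1) \<Rightarrow> nat \<Rightarrow> (nat \<Rightarrow> 'r) \<Rightarrow> (nat \<Rightarrow> 'r \<Rightarrow> 'r) \<Rightarrow> (nat \<Rightarrow> 'r \<Rightarrow> 'r) \<Rightarrow> bool"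
  where
  "iterated_ore emb N x \<sigma> \<delta> \<longleftrightarrow>
     scalar_emb emb \<and> 1 \<le> N \<and>
     kindep emb (omon x N) (nexps N) \<and>
     kspan emb (omon x N ` nexps N) = UNIV \<and>
     (\<forall>k\<in>{2..N}.
        bij_betw (\<sigma> k) (Rsub emb x (k - 1)) (Rsub emb x (k - 1)) \<and>
        (\<forall>a\<in>Rsub emb x (k - 1). \<forall>b\<in>Rsub emb x (k - 1).
            \<sigma> k (a + b) = \<sigma> k a + \<sigma> k b \<and> \<sigma> k (a * b) = \<sigma> k a * \<sigma> k b) \<and>
        (\<forall>c. \<sigma> k (emb c) = emb c) \<and>
        (\<forall>a\<in>Rsub emb x (k - 1). \<delta> k a \<in> Rsub emb x (k - 1)) \<and>
        (\<forall>a\<in>Rsub emb x (k - 1). \<forall>b\<in>Rsub emb x (k - 1).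
            \<delta> k (a + b) = \<delta> k a + \<delta> k b \<and> \<delta> k (a * b) = \<sigma> k a * \<delta> k b + \<delta> k a * b) \<and>
        (\<forall>c. \<forall>a\<in>Rsub emb x (k - 1). \<delta> k (emb c * a) = emb c * \<delta> k a) \<and>
        (\<forall>a\<in>Rsub emb x (k - 1). x k * a = \<sigma> k a * x k + \<delta> k a))"

text \<open>The torus H = (K^*)^n, elements represented as h : nat -> K with h i nonzero for i < n
  and h i = 1 for i >= n.  The character group Q = X(H) = Z^n is represented by integer vectors
  w : nat -> int with w i = 0 for i >= n; the character of w is h |-> prod_{i<n} h_i^{w_i}.\<close>
definition Htor :: "nat \<Rightarrow> (nat \<Rightarrow> 'k::field) set" where
  "Htor n = {h. (\<forall>i<n. h i \<noteq> 0) \<and> (\<forall>i\<ge>n. h i = 1)}"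

definition Qset :: "nat \<Rightarrow> (nat \<Rightarrow> int) set" where
  "Qset n = {w. \<forall>i\<ge>n. w i = 0}"

definition chi :: "nat \<Rightarrow> (nat \<Rightarrow> 'k::field) \<Rightarrow> (nat \<Rightarrow> int) \<Rightarrow> 'k" where
  "chi n h w = (\<Prod>i<n. h i powi w i)"

definition kalg_aut :: "('k::field \<Rightarrow> 'r::ring_1) \<Rightarrow> ('r \<Rightarrow> 'r) \<Rightarrow> bool" where
  "kalg_aut emb \<phi> \<longleftrightarrow> bij \<phi> \<and> (\<forall>a b. \<phi> (a + b) = \<phi> a + \<phi> b) \<and>
      (\<forall>a b. \<phi> (a * b) = \<phi> a * \<phi> b) \<and> (\<forall>c. \<phi> (emb c) = emb c)"

definition homog ::
  "('k::field \<Rightarrow> 'r::ring_1) \<Rightarrow> nat \<Rightarrow> ((nat \<Rightarrow> 'k) \<Rightarrow> 'r \<Rightarrow> 'r) \<Rightarrow> (nat \<Rightarrow> int) \<Rightarrow> 'r \<Rightarrow> bool" where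
  "homog emb n act w a \<longleftrightarrow> w \<in> Qset n \<and> (\<forall>h\<in>Htor n. act h a = emb (chi n h w) * a)"

definition is_homog ::
  "('k::field \<Rightarrow> 'r::ring_1) \<Rightarrow> nat \<Rightarrow> ((nat \<Rightarrow> 'k) \<Rightarrow> 'r \<Rightarrow> 'r) \<Rightarrow> 'r \<Rightarrow> bool" where
  "is_homog emb n act a \<longleftrightarrow> (\<exists>w. homog emb n act w a)"

definition rational_torus_action ::
  "('k::field \<Rightarrow> 'r::ring_1) \<Rightarrow> nat \<Rightarrow> ((nat \<Rightarrow> 'k) \<Rightarrow> 'r \<Rightarrow> 'r) \<Rightarrow> bool" where
  "rational_torus_action emb n act \<longleftrightarrow>
     (\<forall>h\<in>Htor n. kalg_aut emb (act h)) \<and>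
     act (\<lambda>i. 1) = id \<and>
     (\<forall>h\<in>Htor n. \<forall>h'\<in>Htor n. act (\<lambda>i. h i * h' i) = act h \<circ> act h') \<and>
     (\<forall>a. a \<in> kspan emb {b. is_homog emb n act b})"

definition maximal_torus_action ::
  "('k::field \<Rightarrow> 'r::ring_1) \<Rightarrow> nat \<Rightarrow> (nat \<Rightarrow> 'r) \<Rightarrow> nat \<Rightarrow> ((nat \<Rightarrow> 'k) \<Rightarrow> 'r \<Rightarrow> 'r) \<Rightarrow> bool" where
  "maximal_torus_action emb N x n act \<longleftrightarrow>
     (\<forall>h\<in>Htor n. act h = id \<longrightarrow> h = (\<lambda>i. 1)) \<and>
     (\<forall>\<phi>. kalg_aut emb \<phi> \<and> (\<forall>i\<in>{1..N}. \<exists>c. c \<noteq> 0 \<and> \<phi> (x i) = emb c * x i)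
          \<longrightarrow> (\<exists>h\<in>Htor n. act h = \<phi>))"

definition not_root_of_unity :: "'k::field \<Rightarrow> bool" where
  "not_root_of_unity q \<longleftrightarrow> (\<forall>m::nat. m > 0 \<longrightarrow> q ^ m \<noteq> 1)"

text \<open>rank = number of k in [1,N] with delta_k = 0 (delta_1 = 0 by convention).\<close>
definition ore_rank ::
  "('k::field \<Rightarrow> 'r::ring_1) \<Rightarrow> nat \<Rightarrow> (nat \<Rightarrow> 'r) \<Rightarrow> (nat \<Rightarrow> 'r \<Rightarrow> 'r) \<Rightarrow> nat" where
  "ore_rank emb N x \<delta> = card {k\<in>{1..N}. k = 1 \<or> (\<forall>a\<in>Rsub emb x (k - 1). \<delta> k a = 0)}"

definition uniparameter_QNA ::
  "('k::field_char_0 \<Rightarrow> 'r::ring_1) \<Rightarrow> nat \<Rightarrow> (nat \<Rightarrow> 'r) \<Rightarrow> (nat \<Rightarrow> 'r \<Rightarrow> 'r) \<Rightarrow>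
   (nat \<Rightarrow> 'r \<Rightarrow> 'r) \<Rightarrow> nat \<Rightarrow> ((nat \<Rightarrow> 'k) \<Rightarrow> 'r \<Rightarrow> 'r) \<Rightarrow> bool" where
  "uniparameter_QNA emb N x \<sigma> \<delta> n act \<longleftrightarrow>
     iterated_ore emb N x \<sigma> \<delta> \<and>
     n = ore_rank emb N x \<delta> \<and>
     rational_torus_action emb n act \<and>
     maximal_torus_action emb N x n act \<and>
     (\<forall>i\<in>{1..N}. is_homog emb n act (x i)) \<and>
     (\<exists>q (a::nat \<Rightarrow> nat \<Rightarrow> int). not_root_of_unity q \<and>
        (\<forall>i\<in>{1..N}. \<forall>j\<in>{1..N}. a i j = - a j i) \<and>
        (\<forall>k\<in>{2..N}. \<forall>j\<in>{1..<k}. \<sigma> k (x j) = emb (q powi a k j) * x j)) \<and>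
     (\<forall>k\<in>{2..N}. \<forall>a\<in>Rsub emb x (k - 1). \<exists>m. (\<delta> k ^^ m) a = 0) \<and>
     (\<forall>k\<in>{1..N}. \<exists>h\<in>Htor n. \<exists>qk. not_root_of_unity qk \<and>
        (\<forall>a\<in>Rsub emb x (k - 1). act h a = (if k = 1 then a else \<sigma> k a)) \<and>
        act h (x k) = emb qk * x k)"

definition pred_idx :: "(nat \<Rightarrow> nat) \<Rightarrow> nat \<Rightarrow> nat option" where
  "pred_idx \<mu> k = (if \<exists>j. 1 \<le> j \<and> j < k \<and> \<mu> j = \<mu> k
      then Some (Max {j. 1 \<le> j \<and> j < k \<and> \<mu> j = \<mu> k}) else None)"

definition succ_idx :: "nat \<Rightarrow> (nat \<Rightarrow> nat) \<Rightarrow> nat \<Rightarrow> nat option" where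
  "succ_idx N \<mu> k = (if \<exists>j. k < j \<and> j \<le> N \<and> \<mu> j = \<mu> k
      then Some (Min {j. k < j \<and> j \<le> N \<and> \<mu> j = \<mu> k}) else None)"

text \<open>s(j) > k, where s(j) = +infinity when there is no successor.\<close>
definition succ_gt :: "nat \<Rightarrow> (nat \<Rightarrow> nat) \<Rightarrow> nat \<Rightarrow> nat \<Rightarrow> bool" where
  "succ_gt N \<mu> j k \<longleftrightarrow> (case succ_idx N \<mu> j of None \<Rightarrow> True | Some s \<Rightarrow> k < s)"

definition s_infty :: "nat \<Rightarrow> (nat \<Rightarrow> nat) \<Rightarrow> nat set" where
  "s_infty N \<mu> = {k\<in>{1..N}. succ_idx N \<mu> k = None}"

definition homog_prime ::
  "('k::field \<Rightarrow> 'r::ring_1) \<Rightarrow> nat \<Rightarrow> ((nat \<Rightarrow> 'k) \<Rightarrow> 'r \<Rightarrow> 'r) \<Rightarrow> 'r set \<Rightarrow> 'r \<Rightarrow> bool" where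
  "homog_prime emb n act S p \<longleftrightarrow>
     p \<in> S \<and> p \<noteq> 0 \<and> is_homog emb n act p \<and>
     {p * a | a. a \<in> S} = {a * p | a. a \<in> S} \<and>
     1 \<notin> {p * a | a. a \<in> S} \<and>
     (\<forall>a\<in>S. \<forall>b\<in>S. a * b \<in> {p * c | c. c \<in> S} \<longrightarrow>
        a \<in> {p * c | c. c \<in> S} \<or> b \<in> {p * c | c. c \<in> S})"

definition GY_elements ::
  "('k::field \<Rightarrow> 'r::ring_1) \<Rightarrow> nat \<Rightarrow> (nat \<Rightarrow> 'r) \<Rightarrow> nat \<Rightarrow> ((nat \<Rightarrow> 'k) \<Rightarrow> 'r \<Rightarrow> 'r) \<Rightarrow>
   (nat \<Rightarrow> nat) \<Rightarrow> (nat \<Rightarrow> 'r) \<Rightarrow> bool" where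
  "GY_elements emb N x n act \<mu> y \<longleftrightarrow>
     \<mu> ` {1..N} = {1..n} \<and>
     (\<forall>k\<in>{1..N}.
        is_homog emb n act (y k) \<and>
        (pred_idx \<mu> k = None \<longrightarrow> y k = x k) \<and>
        (\<forall>p. pred_idx \<mu> k = Some p \<longrightarrow> (\<exists>c\<in>Rsub emb x (k - 1). y k = y p * x k - c)) \<and>
        (\<forall>j\<in>{1..k}. succ_gt N \<mu> j k \<longrightarrow> homog_prime emb n act (Rsub emb x k) (y j)) \<and>
        (\<forall>p. homog_prime emb n act (Rsub emb x k) p \<longrightarrow>
           (\<exists>j\<in>{1..k}. succ_gt N \<mu> j k \<and> (\<exists>c. c \<noteq> 0 \<and> p = emb c * y j))))"

text \<open>iota : R -> T exhibits T as the (right Ore) localization of R at the multiplicative set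
  generated by y_1..y_N: iota is an injective ring map, each iota(y_j) is a unit, and every
  element of T has the form iota(r) iota(s)^{-1} with s a monomial in the y_j.\<close>
definition quantum_torus_loc ::
  "nat \<Rightarrow> (nat \<Rightarrow> 'r::ring_1) \<Rightarrow> ('r \<Rightarrow> 't::ring_1) \<Rightarrow> bool" where
  "quantum_torus_loc N y \<iota> \<longleftrightarrow>
     inj \<iota> \<and> \<iota> 1 = 1 \<and> (\<forall>a b. \<iota> (a + b) = \<iota> a + \<iota> b) \<and> (\<forall>a b. \<iota> (a * b) = \<iota> a * \<iota> b) \<and>
     (\<forall>j\<in>{1..N}. is_unit (\<iota> (y j))) \<and>
     (\<forall>t. \<exists>r. \<exists>m\<in>nexps N. t * \<iota> (omon y N m) = \<iota> r)"

definition lmon :: "nat \<Rightarrow> (nat \<Rightarrow> 'r::ring_1) \<Rightarrow> ('r \<Rightarrow> 't::ring_1) \<Rightarrow> (nat \<Rightarrow> int) \<Rightarrow> 't" where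
  "lmon N y \<iota> m = oprod N (\<lambda>j. ipow (\<iota> (y j)) (m j))"

definition supp :: "(nat \<Rightarrow> int) \<Rightarrow> nat set" where
  "supp m = {j. m j \<noteq> 0}"

text \<open>Hypothesis (H).  The generator z_i is the Laurent monomial with exponent vector e i
  (i in [1,l]); c i is the element c_i of C.  The z_i generate Z(T_q) as a Laurent polynomial
  ring: Z(T_q) is the K-span of the monomials z^alpha (alpha in Z^l), which are K-linearly
  independent.\<close>
definition hypothesis_H ::
  "('k::field \<Rightarrow> 'r::ring_1) \<Rightarrow> nat \<Rightarrow> (nat \<Rightarrow> nat) \<Rightarrow> (nat \<Rightarrow> 'r) \<Rightarrow> ('r \<Rightarrow> 't::ring_1) \<Rightarrow> bool" where
  "hypothesis_H emb N \<mu> y \<iota> \<longleftrightarrow>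
     (\<exists>(l::nat) (e :: nat \<Rightarrow> nat \<Rightarrow> int) (c :: nat \<Rightarrow> nat).
        (\<forall>i\<in>{1..l}. e i \<in> zexps N \<and> supp (e i) \<subseteq> s_infty N \<mu>) \<and>
        center = kspan (\<iota> \<circ> emb)
            ((\<lambda>\<alpha>. oprod l (\<lambda>i. ipow (lmon N y \<iota> (e i)) (\<alpha> i))) ` zexps l) \<and>
        kindep (\<iota> \<circ> emb) (\<lambda>\<alpha>. oprod l (\<lambda>i. ipow (lmon N y \<iota> (e i)) (\<alpha> i))) (zexps l) \<and>
        inj_on c {1..l} \<and> c ` {1..l} \<subseteq> s_infty N \<mu> \<and>
        (\<forall>i\<in>{1..l}.
           lmon N y \<iota> (e i) \<in> \<iota> ` subalg emb (y ` {1..N}) \<and>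
           (\<forall>j\<in>{1..l}. e i (c j) = (if i = j then 1 else 0)) \<and>
           (2 \<le> card (supp (e i)) \<longrightarrow>
              \<not> (supp (e i) - {c i} \<subseteq> (\<Union>j\<in>{1..l} - {i}. supp (e j))))))"

definition kderiv :: "('k::field \<Rightarrow> 'r::ring_1) \<Rightarrow> ('r \<Rightarrow> 'r) \<Rightarrow> bool" where
  "kderiv emb D \<longleftrightarrow> (\<forall>a b. D (a + b) = D a + D b) \<and> (\<forall>c a. D (emb c * a) = emb c * D a) \<and>
     (\<forall>a b. D (a * b) = D a * b + a * D b)"

definition weight_hom :: "nat \<Rightarrow> ((nat \<Rightarrow> int) \<Rightarrow> 'r::ring_1) \<Rightarrow> bool" where
  "weight_hom n \<eta> \<longleftrightarrow> (\<forall>w\<in>Qset n. \<eta> w \<in> center) \<and>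
     (\<forall>w\<in>Qset n. \<forall>w'\<in>Qset n. \<eta> (\<lambda>i. w i + w' i) = \<eta> w + \<eta> w')"

text \<open>D = ad_x + theta_eta, where theta_eta(a) = eta(wt a) a on homogeneous a (this determines
  the K-linear map D since R is spanned by homogeneous elements).\<close>
definition ad_plus_theta ::
  "('k::field \<Rightarrow> 'r::ring_1) \<Rightarrow> nat \<Rightarrow> ((nat \<Rightarrow> 'k) \<Rightarrow> 'r \<Rightarrow> 'r) \<Rightarrow> ('r \<Rightarrow> 'r) \<Rightarrow> 'r \<Rightarrow>
   ((nat \<Rightarrow> int) \<Rightarrow> 'r) \<Rightarrow> bool" where
  "ad_plus_theta emb n act D x \<eta> \<longleftrightarrow>
     (\<forall>w a. homog emb n act w a \<longrightarrow> D a = ad x a + \<eta> w * a)"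

end

theory Submission
  imports Defs Complex_Main "HOL-Library.Function_Algebras"
begin

text \<open>On the quantum torus every derivation is inner plus central: \<open>D (y\<^sub>i) = [t, y\<^sub>i] + z\<^sub>i y\<^sub>i\<close> with
  \<open>z\<^sub>i\<close> central and no central monomial in \<open>t\<close>. Let \<open>L\<^sub>k\<close> be the elements of the torus that become
  regular after multiplication by a monomial in the \<open>y\<^sub>j\<close>, \<open>j \<noteq> k\<close>. Since \<open>y\<^sub>i w \<in> y\<^sub>k R\<close> forces
  \<open>w \<in> y\<^sub>k R\<close> for \<open>i \<noteq> k\<close>, the intersection of all \<open>L\<^sub>k\<close> is \<open>R\<close>. Splitting into eigenvectors of
  conjugation by the \<open>y\<^sub>i\<close>, \<open>i \<noteq> k\<close>, shows \<open>t \<in> L\<^sub>k\<close>: a monomial commuting with all these \<open>y\<^sub>i\<close> is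
  central or does not involve \<open>y\<^sub>k\<close>, because the commutation form is skew-symmetric. So \<open>t \<in> R\<close>.

  By Hypothesis (H), \<open>z\<^sub>i\<close> lies in \<open>R\<close> unless \<open>y\<^sub>i\<close> is central, which is impossible if \<open>y\<^sub>i = x\<^sub>i\<close>. The
  weights of the \<open>x\<^sub>i\<close> without predecessor form a basis of the weight space, which determines a
  homomorphism \<open>\<eta>\<close>. That \<open>D - ad\<^sub>t\<close> agrees with \<open>\<theta>\<^sub>\<eta>\<close> on the other generators follows inductively from
  the fact that a nonzero central element is never divisible by a \<open>y\<^sub>p\<close> having a successor; this uses
  that \<open>q\<^sub>k\<close> is not a root of unity.\<close>

section \<open>The iterated Ore extension and degrees\<close>

text \<open>The obstacle is that \<open>y k\<close> is known to be normal and prime only in those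
  \<open>R j\<close> with \<open>k \<le> j\<close> that lie below the successor of \<open>k\<close>.
  Divisibility is therefore one-sided throughout: an equation \<open>g * w = h * v\<close> is
  settled by primality in a small ring of the tower and then lifted to \<open>R\<close> coefficient
  by coefficient, because left factors from \<open>R (l - 1)\<close> do not disturb the powers of
  \<open>x l\<close> on the right. The scalars \<open>q\<^sub>k\<close> enter through the remainder
  in \<open>y i = y p * x i - c i\<close>: moving \<open>x i\<close> across
  \<open>y p ^ (m + 1)\<close> leaves a nonzero multiple of \<open>y p ^ m * c i\<close> modulo
  \<open>y p ^ (m + 1)\<close>. As \<open>c i\<close> is not divisible by \<open>y p\<close>, a
  central element divisible by \<open>y p\<close> would be divisible by all its powers. If
  \<open>y i\<close> is central, then \<open>z\<^sub>i\<close> may have a pole along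
  \<open>y i\<close>; in that case the defect of \<open>\<theta>\<close> at \<open>y i\<close> is
  itself central and divisible by \<open>y p\<close>. Since \<open>\<eta>\<close> takes values in a
  vector space over K, it suffices that the weights form a K-basis. This comes from faithfulness: a
  nonzero functional killing all weights yields a nontrivial torus element, with powers of 2 as
  coordinates, that acts trivially.\<close>

locale central_scalars =
  fixes emb :: "'k::field_char_0 \<Rightarrow> 'r::ring_1"
  assumes scalar_emb: "scalar_emb emb"
begin

definition sc :: "'k \<Rightarrow> 'r \<Rightarrow> 'r" where "sc c r = emb c * r"

lemma emb_1: "emb 1 = 1" and emb_add: "emb (a + b) = emb a + emb b"
  and emb_mult: "emb (a * b) = emb a * emb b" and emb_comm: "emb a * r = r * emb a"
  using scalar_emb unfolding scalar_emb_def by metis+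

lemma emb_0: "emb 0 = 0"
  using emb_add[of 0 0] by simp

lemma emb_eq_0_iff: "emb a = 0 \<longleftrightarrow> a = 0"
  using scalar_emb emb_0 unfolding scalar_emb_def inj_def by metis

sublocale V: vector_space sc
  by unfold_locales (auto simp: sc_def emb_1 emb_add emb_mult algebra_simps)

lemma sc_mult_left [simp]: "sc c r * s = sc c (r * s)"
  by (simp add: sc_def mult.assoc)

lemma sc_mult_right [simp]: "r * sc c s = sc c (r * s)"
  by (metis emb_comm mult.assoc sc_def)

lemma emb_eq_sc: "emb c = sc c 1"
  by (simp add: sc_def)

lemma subalg_0: "0 \<in> subalg emb S"
  using subalg.scal[of emb 0] by (simp add: emb_0)

lemma subalg_1: "1 \<in> subalg emb S"
  using subalg.scal[of emb 1] by (simp add: emb_1)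

lemma subalg_sc: "r \<in> subalg emb S \<Longrightarrow> sc c r \<in> subalg emb S"
  by (simp add: sc_def subalg.mult subalg.scal)

lemma subalg_diff: "a \<in> subalg emb S \<Longrightarrow> b \<in> subalg emb S \<Longrightarrow> a - b \<in> subalg emb S"
  using subalg.add[of a emb S "- b"] subalg.neg by auto

lemma subalg_power: "r \<in> subalg emb S \<Longrightarrow> r ^ n \<in> subalg emb S"
  by (induction n) (auto simp: subalg_1 subalg.mult)

lemma subalg_sum: "(\<And>i. i \<in> F \<Longrightarrow> f i \<in> subalg emb S) \<Longrightarrow> sum f F \<in> subalg emb S"
  by (induction F rule: infinite_finite_induct) (auto simp: subalg_0 subalg.add)

lemma subalg_least:
  assumes "r \<in> subalg emb S" and "S \<subseteq> subalg emb S'"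
  shows "r \<in> subalg emb S'"
  using assms(1)
  by induction (use assms(2) in \<open>auto intro: subalg.intros\<close>)

end

lemma oprod_cong:
  fixes f g :: "nat \<Rightarrow> 'a::ring_1"
  assumes "\<And>j. j \<in> {1..n} \<Longrightarrow> f j = g j"
  shows "oprod n f = oprod n g"
  using assms by (induction n) auto

lemma oprod_stop:
  fixes f :: "nat \<Rightarrow> 'a::ring_1"
  assumes "l \<le> n" and "\<And>j. l < j \<Longrightarrow> j \<le> n \<Longrightarrow> f j = 1"
  shows "oprod n f = oprod l f"
  using assms by (induction n) (auto simp: le_Suc_eq)

locale ore_tower = central_scalars emb
  for emb :: "'k::field_char_0 \<Rightarrow> 'r::ring_1" +
  fixes N :: nat and x :: "nat \<Rightarrow> 'r" and \<sigma> \<delta> :: "nat \<Rightarrow> 'r \<Rightarrow> 'r"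
  assumes ore: "iterated_ore emb N x \<sigma> \<delta>"
begin

abbreviation R :: "nat \<Rightarrow> 'r set" where "R k \<equiv> Rsub emb x k"

text \<open>The maps \<open>\<sigma>\<close> and \<open>\<delta>\<close> are constrained only from
  level 2 on. At level 1 the coefficient ring is K, which commutes with \<open>x 1\<close>, so the
  identity and the zero map make every later statement uniform in the level.\<close>

definition sg :: "nat \<Rightarrow> 'r \<Rightarrow> 'r" where "sg k = (if k < 2 then id else \<sigma> k)"
definition dl :: "nat \<Rightarrow> 'r \<Rightarrow> 'r" where "dl k = (if k < 2 then (\<lambda>_. 0) else \<delta> k)"

lemma R_0: "R 0 = range emb"
proof -
  have "r \<in> range emb" if "r \<in> subalg emb {}" for r
    using that
  proof induction
    case (add a b) then show ?case by (auto simp flip: emb_add)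
  next
    case (mult a b) then show ?case by (auto simp flip: emb_mult)
  next
    case (neg a)
    have "- emb c = emb (- c)" for c by (simp add: emb_eq_sc)
    then show ?case using neg by auto
  qed auto
  then show ?thesis by (auto simp: Rsub_def intro: subalg.scal)
qed

lemma R_mono: "k \<le> l \<Longrightarrow> R k \<subseteq> R l"
  unfolding Rsub_def by (intro subsetI, erule subalg_least) (auto intro: subalg.gen)

lemma x_in_R: "1 \<le> i \<Longrightarrow> i \<le> k \<Longrightarrow> x i \<in> R k"
  unfolding Rsub_def by (auto intro!: subalg.gen)

lemma R_0_in: "0 \<in> R k" and R_1_in: "1 \<in> R k" and R_emb: "emb c \<in> R k"
  and R_sc: "a \<in> R k \<Longrightarrow> sc c a \<in> R k"
  and R_add: "a \<in> R k \<Longrightarrow> b \<in> R k \<Longrightarrow> a + b \<in> R k"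
  and R_neg: "a \<in> R k \<Longrightarrow> - a \<in> R k"
  and R_diff: "a \<in> R k \<Longrightarrow> b \<in> R k \<Longrightarrow> a - b \<in> R k"
  and R_mult: "a \<in> R k \<Longrightarrow> b \<in> R k \<Longrightarrow> a * b \<in> R k"
  and R_power: "a \<in> R k \<Longrightarrow> a ^ d \<in> R k"
  unfolding Rsub_def
  by (auto intro: subalg_0 subalg_1 subalg_sc subalg_diff subalg_power subalg.intros)

lemma R_sum: "(\<And>i. i \<in> F \<Longrightarrow> f i \<in> R k) \<Longrightarrow> sum f F \<in> R k"
  unfolding Rsub_def by (rule subalg_sum)

lemmas R_intros = R_0_in R_1_in R_emb R_sc R_add R_neg R_diff R_mult R_power R_sum

lemma sg_dl:
  assumes "k \<in> {1..N}"
  shows sg_in: "a \<in> R (k - 1) \<Longrightarrow> sg k a \<in> R (k - 1)"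
    and dl_in: "a \<in> R (k - 1) \<Longrightarrow> dl k a \<in> R (k - 1)"
    and sg_add: "a \<in> R (k - 1) \<Longrightarrow> b \<in> R (k - 1) \<Longrightarrow> sg k (a + b) = sg k a + sg k b"
    and sg_mult: "a \<in> R (k - 1) \<Longrightarrow> b \<in> R (k - 1) \<Longrightarrow> sg k (a * b) = sg k a * sg k b"
    and sg_emb: "sg k (emb c) = emb c"
    and x_comm: "a \<in> R (k - 1) \<Longrightarrow> x k * a = sg k a * x k + dl k a"
    and sg_inj: "inj_on (sg k) (R (k - 1))"
proof -
  have ge2: "k \<ge> 2 \<Longrightarrow> k \<in> {2..N}" using assms by auto
  note O = ore[unfolded iterated_ore_def, THEN conjunct2, THEN conjunct2, THEN conjunct2,
      THEN conjunct2, rule_format, OF ge2]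
  show "a \<in> R (k - 1) \<Longrightarrow> sg k a \<in> R (k - 1)"
    using O bij_betwE unfolding sg_def by fastforce
  show "a \<in> R (k - 1) \<Longrightarrow> dl k a \<in> R (k - 1)"
    using O unfolding dl_def by (auto simp: R_0_in)
  show "a \<in> R (k - 1) \<Longrightarrow> b \<in> R (k - 1) \<Longrightarrow> sg k (a + b) = sg k a + sg k b"
    using O unfolding sg_def by auto
  show "a \<in> R (k - 1) \<Longrightarrow> b \<in> R (k - 1) \<Longrightarrow> sg k (a * b) = sg k a * sg k b"
    using O unfolding sg_def by auto
  show "sg k (emb c) = emb c"
    using O unfolding sg_def by auto
  show "a \<in> R (k - 1) \<Longrightarrow> x k * a = sg k a * x k + dl k a"
  proof (cases "k < 2")
    case True
    then have "k = 1" using assms by auto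
    assume "a \<in> R (k - 1)"
    then have "a \<in> range emb" using R_0 \<open>k = 1\<close> by simp
    then show ?thesis using True by (auto simp: sg_def dl_def emb_comm)
  next
    case False
    then show "a \<in> R (k - 1) \<Longrightarrow> ?thesis" using O unfolding sg_def dl_def by auto
  qed
  show "inj_on (sg k) (R (k - 1))"
    using O unfolding sg_def by (auto simp: bij_betw_def)
qed

lemma sg_0: "k \<in> {1..N} \<Longrightarrow> sg k 0 = 0"
  using sg_emb[of k 0] by (simp add: emb_0)

lemma sg_sc: "k \<in> {1..N} \<Longrightarrow> a \<in> R (k - 1) \<Longrightarrow> sg k (sc c a) = sc c (sg k a)"
  by (simp add: sc_def sg_mult sg_emb R_emb)

lemma sg_eq_0: "k \<in> {1..N} \<Longrightarrow> a \<in> R (k - 1) \<Longrightarrow> sg k a = 0 \<Longrightarrow> a = 0"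
  using sg_inj sg_0 R_0_in unfolding inj_on_def by metis

lemma sg_pow_in: "k \<in> {1..N} \<Longrightarrow> a \<in> R (k - 1) \<Longrightarrow> (sg k ^^ d) a \<in> R (k - 1)"
  by (induction d) (simp, metis comp_apply funpow.simps(2) sg_in)

lemma sg_pow_eq_0: "k \<in> {1..N} \<Longrightarrow> a \<in> R (k - 1) \<Longrightarrow> (sg k ^^ d) a = 0 \<Longrightarrow> a = 0"
  by (induction d) (simp, metis comp_apply funpow.simps(2) sg_eq_0 sg_pow_in)

text \<open>Left polynomials in \<open>x l\<close> over \<open>R (l - 1)\<close> of degree strictly
  below \<open>d\<close>. The strict bound makes \<open>Fil l 0\<close> zero, so inductions on the
  degree start trivially and \<open>Fil l d\<close> is exactly the room for what lies below a
  leading term \<open>b * x l ^ d\<close>.\<close>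

primrec Fil :: "nat \<Rightarrow> nat \<Rightarrow> 'r set" where
  "Fil l 0 = {0}"
| "Fil l (Suc d) = {b * x l ^ d + r | b r. b \<in> R (l - 1) \<and> r \<in> Fil l d}"

lemma Fil_SucI: "b \<in> R (l - 1) \<Longrightarrow> r \<in> Fil l d \<Longrightarrow> b * x l ^ d + r \<in> Fil l (Suc d)"
  by auto

lemma Fil_SucE:
  assumes "r \<in> Fil l (Suc d)"
  obtains b s where "b \<in> R (l - 1)" "s \<in> Fil l d" "r = b * x l ^ d + s"
  using assms by auto

lemma Fil_0_in: "0 \<in> Fil l d"
proof (induction d)
  case (Suc d) then show ?case using Fil_SucI[OF R_0_in Suc] by force
qed auto

lemma Fil_mono: "d \<le> e \<Longrightarrow> Fil l d \<subseteq> Fil l e"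
proof (induction e)
  case (Suc e)
  have "Fil l e \<subseteq> Fil l (Suc e)"
    using Fil_SucI[OF R_0_in] by fastforce
  then show ?case using Suc by (auto simp: le_Suc_eq)
qed auto

lemma Fil_add: "r \<in> Fil l d \<Longrightarrow> s \<in> Fil l d \<Longrightarrow> r + s \<in> Fil l d"
proof (induction d arbitrary: r s)
  case (Suc d)
  obtain b r' c s' where *: "b \<in> R (l - 1)" "r' \<in> Fil l d" "r = b * x l ^ d + r'"
    "c \<in> R (l - 1)" "s' \<in> Fil l d" "s = c * x l ^ d + s'"
    using Suc.prems by (metis Fil_SucE)
  have "r + s = (b + c) * x l ^ d + (r' + s')" using * by (simp add: algebra_simps)
  then show ?case using * Suc.IH Fil_SucI R_add by metis
qed auto

lemma Fil_lmult: "b \<in> R (l - 1) \<Longrightarrow> r \<in> Fil l d \<Longrightarrow> b * r \<in> Fil l d"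
proof (induction d arbitrary: r)
  case (Suc d)
  obtain c r' where *: "c \<in> R (l - 1)" "r' \<in> Fil l d" "r = c * x l ^ d + r'"
    using Suc.prems by (metis Fil_SucE)
  have "b * r = (b * c) * x l ^ d + b * r'" using * by (simp add: algebra_simps)
  then show ?case using * Suc Fil_SucI R_mult by metis
qed auto

lemma Fil_sc: "r \<in> Fil l d \<Longrightarrow> sc c r \<in> Fil l d"
  unfolding sc_def by (rule Fil_lmult[OF R_emb])

lemma Fil_neg: "r \<in> Fil l d \<Longrightarrow> - r \<in> Fil l d"
  using Fil_sc[of r l d "-1"] by simp

lemma Fil_diff: "r \<in> Fil l d \<Longrightarrow> s \<in> Fil l d \<Longrightarrow> r - s \<in> Fil l d"
  using Fil_add[of r l d "- s"] Fil_neg by auto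

lemma Fil_1: "Fil l 1 = R (l - 1)"
  by auto

lemma Fil_subset_R: "1 \<le> l \<Longrightarrow> Fil l d \<subseteq> R l"
proof (induction d)
  case (Suc d)
  show ?case
  proof
    fix r assume "r \<in> Fil l (Suc d)"
    then obtain b s where "b \<in> R (l - 1)" "s \<in> Fil l d" "r = b * x l ^ d + s" by (rule Fil_SucE)
    moreover have "x l \<in> R l" using Suc.prems by (simp add: x_in_R)
    ultimately show "r \<in> R l" using Suc R_mono[of "l - 1" l] by (auto intro!: R_add R_mult R_power)
  qed
qed (auto simp: R_0_in)

context
  fixes l assumes l: "l \<in> {1..N}"
begin

lemma Fil_xl: "r \<in> Fil l d \<Longrightarrow> x l * r \<in> Fil l (Suc d)"
proof (induction d arbitrary: r)
  case 0 then show ?case using R_0_in by auto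
next
  case (Suc d)
  obtain c r' where *: "c \<in> R (l - 1)" "r' \<in> Fil l d" "r = c * x l ^ d + r'"
    using Suc.prems by (metis Fil_SucE)
  have "x l * r = sg l c * x l ^ Suc d + (dl l c * x l ^ d + x l * r')"
    using * x_comm[OF l, of c] by (simp add: algebra_simps flip: mult.assoc)
  moreover have "dl l c * x l ^ d + x l * r' \<in> Fil l (Suc d)"
    using * Suc.IH Fil_SucI[OF dl_in[OF l *(1)] Fil_0_in[of l d]]
    by (intro Fil_add) auto
  ultimately show ?case using * l Fil_SucI sg_in by metis
qed

lemma Fil_xpow: "r \<in> Fil l d \<Longrightarrow> x l ^ e * r \<in> Fil l (e + d)"
  by (induction e) (auto simp: mult.assoc simp del: Fil.simps intro: Fil_xl)

text \<open>Only one bound carries a \<open>Suc\<close>: with strict bounds, degree at most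
  \<open>d\<close> times degree below \<open>e\<close> has degree below
  \<open>d + e\<close>.\<close>

lemma Fil_mult: "r \<in> Fil l (Suc d) \<Longrightarrow> s \<in> Fil l e \<Longrightarrow> r * s \<in> Fil l (d + e)"
proof (induction d arbitrary: r)
  case 0 then show ?case using Fil_lmult by auto
next
  case (Suc d)
  obtain c r' where *: "c \<in> R (l - 1)" "r' \<in> Fil l (Suc d)" "r = c * x l ^ Suc d + r'"
    using Suc.prems by (metis Fil_SucE)
  have "r * s = c * (x l ^ Suc d * s) + r' * s" using * by (simp add: algebra_simps)
  moreover have "c * (x l ^ Suc d * s) \<in> Fil l (Suc d + e)"
    by (intro Fil_lmult * Fil_xpow Suc.prems)
  moreover have "r' * s \<in> Fil l (Suc d + e)"
    using Suc.IH[OF *(2) Suc.prems(2)] Fil_mono[of "d + e" "Suc d + e" l] by (auto simp del: Fil.simps)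
  ultimately show ?case by (metis Fil_add)
qed

lemma xpow_comm:
  assumes "b \<in> R (l - 1)"
  obtains r where "r \<in> Fil l d" "x l ^ d * b = (sg l ^^ d) b * x l ^ d + r"
proof -
  have "\<exists>r\<in>Fil l d. x l ^ d * b = (sg l ^^ d) b * x l ^ d + r"
  proof (induction d)
    case (Suc d)
    then obtain r where r: "r \<in> Fil l d" "x l ^ d * b = (sg l ^^ d) b * x l ^ d + r" by blast
    let ?b = "(sg l ^^ d) b"
    have b: "?b \<in> R (l - 1)" by (rule sg_pow_in[OF l assms])
    have "x l ^ Suc d * b = x l * (?b * x l ^ d + r)" using r(2) by (simp add: mult.assoc)
    also have "\<dots> = (x l * ?b) * x l ^ d + x l * r" by (simp add: algebra_simps)
    also have "\<dots> = sg l ?b * x l ^ Suc d + (dl l ?b * x l ^ d + x l * r)"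
      using x_comm[OF l b] by (simp add: algebra_simps)
    finally show ?case
      using Fil_add[OF Fil_SucI[OF dl_in[OF l b] Fil_0_in[of l d]] Fil_xl[OF r(1)]] by auto
  qed auto
  then show ?thesis using that by blast
qed

text \<open>The union on the right contains the scalars and the generators and is closed under sums
  and products, so it exhausts the generated subalgebra.\<close>

lemma R_eq_Fil: "R l = (\<Union>d. Fil l d)"
proof
  have "r \<in> (\<Union>d. Fil l d)" if "r \<in> subalg emb (x ` {1..l})" for r
    using that
  proof induction
    case (scal c)
    have "emb c \<in> Fil l 1" unfolding Fil_1 by (rule R_emb)
    then show ?case by blast
  next
    case (gen s)
    then obtain i where i: "i \<in> {1..l}" "s = x i" by blast
    show ?case
    proof (cases "i = l")
      case True
      have "1 * x l ^ 1 + 0 \<in> Fil l (Suc 1)" by (intro Fil_SucI R_1_in Fil_0_in)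
      then show ?thesis using True i by (auto simp del: Fil.simps)
    next
      case False
      then have "s \<in> Fil l 1" unfolding Fil_1 using i by (auto intro: x_in_R)
      then show ?thesis by blast
    qed
  next
    case (add a b)
    then obtain d e where "a \<in> Fil l d" "b \<in> Fil l e" by blast
    then have "a + b \<in> Fil l (max d e)"
      using Fil_mono[of d "max d e"] Fil_mono[of e "max d e"] by (intro Fil_add) auto
    then show ?case by blast
  next
    case (mult a b)
    then obtain d e where "a \<in> Fil l d" "b \<in> Fil l e" by blast
    then have "a * b \<in> Fil l (d + e)"
      using Fil_mono[of d "Suc d" l] by (intro Fil_mult) (auto simp del: Fil.simps)
    then show ?case by blast
  next
    case (neg a) then show ?case using Fil_neg by blast
  qed
  then show "R l \<subseteq> (\<Union>d. Fil l d)" unfolding Rsub_def by blast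
  show "(\<Union>d. Fil l d) \<subseteq> R l" using Fil_subset_R l by auto
qed

end

section \<open>Coordinates with respect to the ordered monomials in the generators\<close>

lemma omon_upd:
  assumes "e \<in> nexps (l - 1)" "1 \<le> l" "l \<le> N"
  shows "omon x N (e(l := d)) = omon x N e * x l ^ d"
proof -
  have e: "e j = 0" if "j \<ge> l" for j using assms that unfolding nexps_def by force
  obtain l' where l': "l = Suc l'" using assms by (cases l) auto
  have "omon x N (e(l := d)) = oprod l (\<lambda>j. x j ^ (e(l := d)) j)"
    unfolding omon_def using assms e by (intro oprod_stop) auto
  also have "\<dots> = oprod l' (\<lambda>j. x j ^ e j) * x l ^ d"
    unfolding l' by (auto intro!: arg_cong2[where f = "(*)"] oprod_cong)
  also have "oprod l' (\<lambda>j. x j ^ e j) = omon x N e"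
    unfolding omon_def using assms e l' by (intro oprod_stop[symmetric]) auto
  finally show ?thesis .
qed

definition mono_comb :: "(nat \<Rightarrow> nat) set \<Rightarrow> ((nat \<Rightarrow> nat) \<Rightarrow> 'k) \<Rightarrow> 'r" where
  "mono_comb F c = (\<Sum>e\<in>F. sc (c e) (omon x N e))"

text \<open>The monomials of \<open>F\<close> involve only variables before \<open>x l\<close>, so
  right multiplication by \<open>x l ^ d\<close> merely sets the exponent at \<open>l\<close>. The
  second conclusion allows a vanishing of the new coefficients to be read back for the old
  ones.\<close>

lemma mono_comb_times_x_pow:
  assumes "finite F" "F \<subseteq> nexps (l - 1)" "1 \<le> l" "l \<le> N"
  obtains c' where "mono_comb F c * x l ^ d = mono_comb ((\<lambda>e. e(l := d)) ` F) c'"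
    and "\<And>e. e \<in> F \<Longrightarrow> c' (e(l := d)) = c e"
proof
  have inv: "(e(l := d))(l := 0) = e" if "e \<in> F" for e
  proof -
    have "e l = 0" using assms(2,3) that unfolding nexps_def by force
    then show ?thesis by (simp add: fun_upd_idem)
  qed
  have inj: "inj_on (\<lambda>e. e(l := d)) F" by (rule inj_onI) (metis inv)
  have "mono_comb ((\<lambda>e. e(l := d)) ` F) (\<lambda>e. c (e(l := 0)))
      = (\<Sum>e\<in>F. sc (c ((e(l := d))(l := 0))) (omon x N (e(l := d))))"
    unfolding mono_comb_def by (simp add: sum.reindex[OF inj])
  also have "\<dots> = (\<Sum>e\<in>F. sc (c e) (omon x N e * x l ^ d))"
    using assms(2) by (intro sum.cong refl arg_cong2[where f = sc] omon_upd assms(3,4))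
      (simp_all add: inv subset_iff del: fun_upd_upd)
  finally show "mono_comb F c * x l ^ d = mono_comb ((\<lambda>e. e(l := d)) ` F) (\<lambda>e. c (e(l := 0)))"
    by (simp add: mono_comb_def sum_distrib_right)
  show "c ((e(l := d))(l := 0)) = c e" if "e \<in> F" for e using inv[OF that] by simp
qed

lemma mono_comb_Un:
  assumes "finite F" "finite G" "F \<inter> G = {}"
  shows "mono_comb F c + mono_comb G c' = mono_comb (F \<union> G) (\<lambda>e. if e \<in> F then c e else c' e)"
proof -
  have "mono_comb F c = (\<Sum>e\<in>F. sc (if e \<in> F then c e else c' e) (omon x N e))"
    unfolding mono_comb_def by (intro sum.cong) auto
  moreover have "mono_comb G c' = (\<Sum>e\<in>G. sc (if e \<in> F then c e else c' e) (omon x N e))"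
    unfolding mono_comb_def using assms by (intro sum.cong) auto
  ultimately show ?thesis unfolding mono_comb_def using assms by (simp add: sum.union_disjoint)
qed

text \<open>The leading part contributes monomials with exponent exactly \<open>d\<close> at
  \<open>l\<close> and the rest only smaller ones, so the two supports are disjoint. The level below
  enters as the premise \<open>IH\<close> because this induction on the degree is nested in the
  induction on \<open>l\<close> in \<open>R_mono_comb\<close>.\<close>

lemma Fil_mono_comb_aux:
  assumes l: "1 \<le> l" "l \<le> N"
    and IH: "\<And>b. b \<in> R (l - 1) \<Longrightarrow> \<exists>F c. finite F \<and> F \<subseteq> nexps (l - 1) \<and> b = mono_comb F c"
  shows "r \<in> Fil l d \<Longrightarrow> \<exists>F c. finite F \<and> F \<subseteq> {e \<in> nexps l. e l < d} \<and> r = mono_comb F c"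
proof (induction d arbitrary: r)
  case 0
  then have "r = mono_comb {} (\<lambda>_. 0)" by (simp add: mono_comb_def)
  then show ?case by blast
next
  case (Suc d)
  obtain b s where *: "b \<in> R (l - 1)" "s \<in> Fil l d" "r = b * x l ^ d + s"
    using Suc.prems by (rule Fil_SucE)
  obtain F c where F: "finite F" "F \<subseteq> nexps (l - 1)" "b = mono_comb F c"
    using IH[OF *(1)] by blast
  obtain G c' where G: "finite G" "G \<subseteq> {e \<in> nexps l. e l < d}" "s = mono_comb G c'"
    using Suc.IH[OF *(2)] by blast
  let ?F = "(\<lambda>e. e(l := d)) ` F"
  obtain c'' where c'': "b * x l ^ d = mono_comb ?F c''"
    using mono_comb_times_x_pow[OF F(1,2) l, of c d] F(3) by auto
  have "?F \<inter> G = {}" using G by auto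
  then have eq: "r = mono_comb (?F \<union> G) (\<lambda>e. if e \<in> ?F then c'' e else c' e)"
    unfolding *(3) c'' G(3) using F(1) G(1) by (intro mono_comb_Un) auto
  have "e(l := d) \<in> nexps l" if "e \<in> F" for e
  proof -
    have "e j \<noteq> 0 \<longrightarrow> j \<in> {1..l - 1}" for j using F(2) that unfolding nexps_def by blast
    then show ?thesis using l unfolding nexps_def by fastforce
  qed
  then have "?F \<union> G \<subseteq> {e \<in> nexps l. e l < Suc d}" using G by auto
  moreover have "finite (?F \<union> G)" using F G by simp
  ultimately show ?case using eq by blast
qed

lemma R_mono_comb: "l \<le> N \<Longrightarrow> r \<in> R l \<Longrightarrow> \<exists>F c. finite F \<and> F \<subseteq> nexps l \<and> r = mono_comb F c"
proof (induction l arbitrary: r)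
  case 0
  then obtain a where "r = emb a" using R_0 by auto
  have "omon x N (\<lambda>_. 0) = 1" unfolding omon_def using oprod_stop[of 0 N "\<lambda>_. 1"] by simp
  then have "r = mono_comb {\<lambda>_. 0} (\<lambda>_. a)" using \<open>r = emb a\<close>
    by (simp add: mono_comb_def emb_eq_sc)
  then show ?case by (intro exI[of _ "{\<lambda>_. 0}"]) (auto simp: nexps_def)
next
  case (Suc l)
  then obtain d where "r \<in> Fil (Suc l) d" using R_eq_Fil[of "Suc l"] by auto
  then show ?case using Fil_mono_comb_aux[of "Suc l" r d] Suc by auto
qed

lemma Fil_mono_comb:
  assumes "l \<in> {1..N}" "r \<in> Fil l d"
  shows "\<exists>F c. finite F \<and> F \<subseteq> {e \<in> nexps l. e l < d} \<and> r = mono_comb F c"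
  using Fil_mono_comb_aux[of l r d] R_mono_comb[of "l - 1"] assms by auto

lemma mono_comb_eq_0:
  assumes "finite F" "F \<subseteq> nexps N" "mono_comb F c = 0" "e \<in> F"
  shows "c e = 0"
proof -
  have "kindep emb (omon x N) (nexps N)" using ore unfolding iterated_ore_def by blast
  then show ?thesis using assms unfolding kindep_def mono_comb_def sc_def by blast
qed

lemma nexps_mono: "k \<le> l \<Longrightarrow> nexps k \<subseteq> nexps l"
proof
  fix e :: "nat \<Rightarrow> nat" assume "k \<le> l" "e \<in> nexps k"
  then have "j \<in> {1..l}" if "e j \<noteq> 0" for j using that unfolding nexps_def by fastforce
  then show "e \<in> nexps l" unfolding nexps_def by blast
qed

text \<open>The monomials of \<open>b * x l ^ d\<close> have exponent \<open>d\<close> at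
  \<open>l\<close>, those of an element of \<open>Fil l d\<close> a smaller one, so linear
  independence of the ordered monomials kills all coefficients of \<open>b\<close>. Every later
  comparison of coefficients rests on this.\<close>

lemma Fil_top_eq_0:
  assumes l: "l \<in> {1..N}" and b: "b \<in> R (l - 1)" and "b * x l ^ d \<in> Fil l d"
  shows "b = 0"
proof -
  obtain F c where F: "finite F" "F \<subseteq> nexps (l - 1)" "b = mono_comb F c"
    using R_mono_comb[of "l - 1" b] l b by (meson atLeastAtMost_iff diff_le_self le_trans)
  obtain c' where c': "b * x l ^ d = mono_comb ((\<lambda>e. e(l := d)) ` F) c'"
    "\<And>e. e \<in> F \<Longrightarrow> c' (e(l := d)) = c e"
    using mono_comb_times_x_pow[of F l c d] F l by auto
  obtain G g where G: "finite G" "G \<subseteq> {e \<in> nexps l. e l < d}" "- (b * x l ^ d) = mono_comb G g"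
    using Fil_mono_comb[of l "- (b * x l ^ d)" d] assms Fil_neg by auto
  let ?F = "(\<lambda>e. e(l := d)) ` F"
  have "?F \<inter> G = {}" using G by auto
  then have "mono_comb (?F \<union> G) (\<lambda>e. if e \<in> ?F then c' e else g e) = b * x l ^ d + - (b * x l ^ d)"
    unfolding c'(1) using F G c'(1) by (simp flip: mono_comb_Un)
  then have "mono_comb (?F \<union> G) (\<lambda>e. if e \<in> ?F then c' e else g e) = 0" by simp
  moreover have "?F \<union> G \<subseteq> nexps N"
  proof -
    have "e(l := d) \<in> nexps N" if "e \<in> F" for e
    proof -
      have "e j \<noteq> 0 \<longrightarrow> j \<in> {1..l - 1}" for j using F(2) that unfolding nexps_def by blast
      then show ?thesis using l unfolding nexps_def by fastforce
    qed
    moreover have "G \<subseteq> nexps N" using G(2) nexps_mono[of l N] l by auto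
    ultimately show ?thesis by blast
  qed
  moreover have "finite (?F \<union> G)" using F G by simp
  ultimately have *: "(if e \<in> ?F then c' e else g e) = 0" if "e \<in> ?F \<union> G" for e
    using mono_comb_eq_0 that by blast
  have "c e = 0" if "e \<in> F" for e using c'(2)[OF that] *[of "e(l := d)"] that by auto
  then show ?thesis unfolding F(3) mono_comb_def by simp
qed

lemma Fil_unique:
  assumes l: "l \<in> {1..N}" and "b \<in> R (l - 1)" "c \<in> R (l - 1)" "r \<in> Fil l d" "s \<in> Fil l d"
    and eq: "b * x l ^ d + r = c * x l ^ d + s"
  shows "b = c \<and> r = s"
proof -
  have "(b - c) * x l ^ d = s - r" using eq by (simp add: algebra_simps)
  then have "(b - c) * x l ^ d \<in> Fil l d" using assms Fil_diff by metis
  then have "b - c = 0" using Fil_top_eq_0 l assms R_diff by metis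
  then show ?thesis using eq by simp
qed

text \<open>Moving \<open>c\<close> to the left of \<open>x l ^ d\<close> replaces it by
  \<open>(sg l ^^ d) c\<close> up to lower degree; all other products are of lower degree
  anyway.\<close>

lemma top_mult:
  assumes l: "l \<in> {1..N}" and b: "b \<in> R (l - 1)" "c \<in> R (l - 1)" and r: "r \<in> Fil l d" "s \<in> Fil l e"
  obtains t where "t \<in> Fil l (d + e)"
    "(b * x l ^ d + r) * (c * x l ^ e + s) = b * (sg l ^^ d) c * x l ^ (d + e) + t"
proof -
  obtain u where u: "u \<in> Fil l d" "x l ^ d * c = (sg l ^^ d) c * x l ^ d + u"
    by (rule xpow_comm[OF l b(2)])
  have xe: "x l ^ e \<in> Fil l (Suc e)" using Fil_SucI[OF R_1_in Fil_0_in, of l e] by auto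
  let ?t = "b * (u * x l ^ e) + (b * x l ^ d * s + r * (c * x l ^ e + s))"
  have "(b * x l ^ d + r) * (c * x l ^ e + s)
      = b * ((x l ^ d * c) * x l ^ e) + b * x l ^ d * s + r * (c * x l ^ e + s)"
    by (simp add: algebra_simps)
  also have "\<dots> = b * (sg l ^^ d) c * x l ^ (d + e) + ?t"
    unfolding u(2) by (simp add: algebra_simps power_add)
  finally have eq: "(b * x l ^ d + r) * (c * x l ^ e + s) = b * (sg l ^^ d) c * x l ^ (d + e) + ?t" .
  have *: "v * w \<in> Fil l (d + e)" if "v \<in> Fil l d" "w \<in> Fil l (Suc e)" for v w
  proof (cases d)
    case 0 then show ?thesis using that Fil_0_in by auto
  next
    case (Suc d') then show ?thesis using Fil_mult[OF l, of v d' w "Suc e"] that by (simp del: Fil.simps)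
  qed
  have "b * (u * x l ^ e) \<in> Fil l (d + e)" by (intro Fil_lmult b * u xe)
  moreover have "b * x l ^ d * s \<in> Fil l (d + e)"
    using Fil_lmult[OF b(1) Fil_xpow[OF l r(2)]] by (simp add: mult.assoc)
  moreover have "r * (c * x l ^ e + s) \<in> Fil l (d + e)"
    by (intro * r Fil_SucI b)
  ultimately have "?t \<in> Fil l (d + e)" by (intro Fil_add)
  then show ?thesis using eq that by blast
qed

lemma R_top:
  assumes l: "l \<in> {1..N}" and "r \<in> R l" "r \<noteq> 0"
  obtains b d s where "b \<in> R (l - 1)" "b \<noteq> 0" "s \<in> Fil l d" "r = b * x l ^ d + s"
proof -
  have "\<exists>b d s. b \<in> R (l - 1) \<and> b \<noteq> 0 \<and> s \<in> Fil l d \<and> r = b * x l ^ d + s" if "r \<in> Fil l d" for d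
    using that
  proof (induction d)
    case 0 then show ?case using assms by auto
  next
    case (Suc d)
    obtain b s where "b \<in> R (l - 1)" "s \<in> Fil l d" "r = b * x l ^ d + s"
      using Suc.prems by (rule Fil_SucE)
    then show ?case using Suc.IH by (cases "b = 0") auto
  qed
  then show ?thesis using that assms R_eq_Fil[OF l] by (metis UN_E)
qed

text \<open>Leading coefficients multiply to \<open>b * (sg l ^^ d) c\<close>, which is nonzero by
  injectivity of \<open>sg l\<close> and the induction hypothesis one level below.\<close>

lemma R_domain: "l \<le> N \<Longrightarrow> r \<in> R l \<Longrightarrow> s \<in> R l \<Longrightarrow> r * s = 0 \<Longrightarrow> r = 0 \<or> s = 0"
proof (induction l arbitrary: r s)
  case 0
  then obtain a b where "r = emb a" "s = emb b" using R_0 by auto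
  then show ?case using 0 emb_eq_0_iff emb_mult by (metis mult_eq_0_iff)
next
  case (Suc l)
  have l: "Suc l \<in> {1..N}" using Suc.prems by auto
  show ?case
  proof (rule ccontr)
    assume "\<not> (r = 0 \<or> s = 0)"
    then obtain b d r' c e s' where
      b: "b \<in> R (Suc l - 1)" "b \<noteq> 0" "r' \<in> Fil (Suc l) d" "r = b * x (Suc l) ^ d + r'" and
      c: "c \<in> R (Suc l - 1)" "c \<noteq> 0" "s' \<in> Fil (Suc l) e" "s = c * x (Suc l) ^ e + s'"
      using R_top[OF l Suc.prems(2)] R_top[OF l Suc.prems(3)] by metis
    obtain t where t: "t \<in> Fil (Suc l) (d + e)"
      "r * s = b * (sg (Suc l) ^^ d) c * x (Suc l) ^ (d + e) + t"
      using top_mult[OF l b(1) c(1) b(3) c(3)] b c by auto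
    have in_R: "(sg (Suc l) ^^ d) c \<in> R (Suc l - 1)" using sg_pow_in[OF l c(1)] .
    have "b * (sg (Suc l) ^^ d) c * x (Suc l) ^ (d + e) = - t" using t Suc.prems by (simp add: eq_neg_iff_add_eq_0)
    then have "b * (sg (Suc l) ^^ d) c = 0"
      using Fil_top_eq_0[OF l R_mult[OF b(1) in_R]] t Fil_neg by metis
    then have "(sg (Suc l) ^^ d) c = 0" using Suc.IH b in_R Suc.prems by auto
    then show False using sg_pow_eq_0[OF l c(1)] c by blast
  qed
qed

lemma R_N: "R N = UNIV"
proof -
  have span: "kspan emb (omon x N ` nexps N) = UNIV" using ore unfolding iterated_ore_def by blast
  have omon: "omon x N e \<in> R N" for e
  proof -
    have "oprod l (\<lambda>j. x j ^ e j) \<in> R N" if "l \<le> N" for l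
      using that by (induction l) (auto intro!: R_intros x_in_R)
    then show ?thesis unfolding omon_def by simp
  qed
  have "r \<in> R N" if r: "r \<in> kspan emb (omon x N ` nexps N)" for r
  proof -
    obtain F c where F: "F \<subseteq> omon x N ` nexps N" and r_eq: "r = (\<Sum>s\<in>F. emb (c s) * s)"
      using r unfolding kspan_def by blast
    have "s \<in> R N" if "s \<in> F" for s using F omon that by auto
    then show ?thesis unfolding r_eq by (intro R_sum R_mult R_emb)
  qed
  then show ?thesis using span by blast
qed

lemma domain: "(r::'r) * s = 0 \<Longrightarrow> r = 0 \<or> s = 0"
  using R_domain[of N] R_N by auto

lemma cancel_left: "(r::'r) * s = r * t \<Longrightarrow> r \<noteq> 0 \<Longrightarrow> s = t"
  using domain[of r "s - t"] by (auto simp: algebra_simps)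

lemma cancel_right: "(s::'r) * r = t * r \<Longrightarrow> r \<noteq> 0 \<Longrightarrow> s = t"
  using domain[of "s - t" r] by (auto simp: algebra_simps)

declare Fil.simps(2) [simp del]

lemma Fil_Suc_0: "Fil l (Suc 0) = R (l - 1)"
  using Fil_1 by simp

end

section \<open>Goodearl--Yakimov elements\<close>

text \<open>The side matters: an element that is normal in one ring of the tower need not be normal
  in the larger ones.\<close>

definition (in central_scalars) mults :: "'r set \<Rightarrow> 'r \<Rightarrow> 'r set" where
  "mults S g = {g * s | s. s \<in> S}"

lemma (in central_scalars) multsI: "s \<in> S \<Longrightarrow> g * s \<in> mults S g"
  unfolding mults_def by blast

lemma pred_idx_SomeD:
  assumes "pred_idx \<mu> i = Some p"
  shows "1 \<le> p" "p < i" "\<mu> p = \<mu> i" "\<And>j. p < j \<Longrightarrow> j < i \<Longrightarrow> \<mu> j \<noteq> \<mu> i"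
proof -
  let ?S = "{j. 1 \<le> j \<and> j < i \<and> \<mu> j = \<mu> i}"
  have fin: "finite ?S" by simp
  have ne: "?S \<noteq> {}" and p: "p = Max ?S"
    using assms unfolding pred_idx_def by (auto split: if_splits)
  have "p \<in> ?S" unfolding p by (rule Max_in[OF fin ne])
  then show *: "1 \<le> p" "p < i" "\<mu> p = \<mu> i" by auto
  show "\<mu> j \<noteq> \<mu> i" if "p < j" "j < i" for j
  proof
    assume "\<mu> j = \<mu> i"
    then have "j \<in> ?S" using that * by auto
    then have "j \<le> p" unfolding p by (rule Max_ge[OF fin])
    then show False using that(1) by simp
  qed
qed

lemma pred_idx_NoneD: "pred_idx \<mu> i = None \<Longrightarrow> 1 \<le> j \<Longrightarrow> j < i \<Longrightarrow> \<mu> j \<noteq> \<mu> i"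
  unfolding pred_idx_def by (auto split: if_splits)

lemma succ_gtI:
  assumes "\<And>j. i < j \<Longrightarrow> j \<le> k \<Longrightarrow> \<mu> j \<noteq> \<mu> i"
  shows "succ_gt N \<mu> i k"
proof (cases "\<exists>j. i < j \<and> j \<le> N \<and> \<mu> j = \<mu> i")
  case True
  let ?S = "{j. i < j \<and> j \<le> N \<and> \<mu> j = \<mu> i}"
  define s where "s = Min ?S"
  have "s \<in> ?S" unfolding s_def using True by (intro Min_in) auto
  then have "k < s" using assms[of s] by (cases "s \<le> k") auto
  then have "k < Min ?S" unfolding s_def .
  then show ?thesis using True by (auto simp: succ_gt_def succ_idx_def)
qed (auto simp: succ_gt_def succ_idx_def)

lemma succ_idx_None_iff: "succ_idx N \<mu> i = None \<longleftrightarrow> (\<forall>j. i < j \<longrightarrow> j \<le> N \<longrightarrow> \<mu> j \<noteq> \<mu> i)"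
  unfolding succ_idx_def by auto

text \<open>That \<open>q\<close> is nonzero is assumed separately, since
  \<open>not_root_of_unity 0\<close> holds.\<close>

locale gy_tower = ore_tower emb N x \<sigma> \<delta>
  for emb :: "'k::field_char_0 \<Rightarrow> 'r::ring_1" and N x \<sigma> \<delta> +
  fixes n :: nat and act :: "(nat \<Rightarrow> 'k) \<Rightarrow> 'r \<Rightarrow> 'r" and \<mu> :: "nat \<Rightarrow> nat" and y :: "nat \<Rightarrow> 'r"
    and q :: 'k and a :: "nat \<Rightarrow> nat \<Rightarrow> int"
  assumes torus: "rational_torus_action emb n act"
    and faithful: "\<And>h. h \<in> Htor n \<Longrightarrow> act h = id \<Longrightarrow> h = (\<lambda>i. 1)"
    and x_homog: "\<And>i. i \<in> {1..N} \<Longrightarrow> is_homog emb n act (x i)"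
    and q_nonzero: "q \<noteq> 0" and q_not_root: "not_root_of_unity q"
    and \<sigma>_x: "\<And>k j. k \<in> {2..N} \<Longrightarrow> j \<in> {1..<k} \<Longrightarrow> \<sigma> k (x j) = emb (q powi a k j) * x j"
    and torus_elements: "\<And>k. k \<in> {1..N} \<Longrightarrow> \<exists>h\<in>Htor n. \<exists>qk. not_root_of_unity qk \<and>
        (\<forall>b\<in>Rsub emb x (k - 1). act h b = (if k = 1 then b else \<sigma> k b)) \<and> act h (x k) = emb qk * x k"
    and gy: "GY_elements emb N x n act \<mu> y"
begin

lemma y_homog: "i \<in> {1..N} \<Longrightarrow> is_homog emb n act (y i)"
  and y_eq_x: "i \<in> {1..N} \<Longrightarrow> pred_idx \<mu> i = None \<Longrightarrow> y i = x i"
  and y_pred: "i \<in> {1..N} \<Longrightarrow> pred_idx \<mu> i = Some p \<Longrightarrow> \<exists>c\<in>R (i - 1). y i = y p * x i - c"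
  and y_prime: "k \<in> {1..N} \<Longrightarrow> j \<in> {1..k} \<Longrightarrow> succ_gt N \<mu> j k \<Longrightarrow> homog_prime emb n act (R k) (y j)"
  and \<mu>_image: "\<mu> ` {1..N} = {1..n}"
  using gy unfolding GY_elements_def by blast+

lemma homog_primeD:
  assumes "homog_prime emb n act S g"
  shows "g \<in> S" "g \<noteq> 0"
    and "b \<in> S \<Longrightarrow> \<exists>b'\<in>S. g * b = b' * g"
    and "b \<in> S \<Longrightarrow> \<exists>b'\<in>S. b * g = g * b'"
    and "1 \<notin> mults S g"
    and "b \<in> S \<Longrightarrow> c \<in> S \<Longrightarrow> b * c \<in> mults S g \<Longrightarrow> b \<in> mults S g \<or> c \<in> mults S g"
  using assms unfolding homog_prime_def mults_def by blast+

text \<open>The leading coefficient of \<open>y i\<close> as a polynomial of degree one in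
  \<open>x i\<close>; its lower coefficient is \<open>- c i\<close>. The value 1 in the absence of a
  predecessor lets both shapes of \<open>y i\<close> be treated together.\<close>

definition u :: "nat \<Rightarrow> 'r" where
  "u i = (case pred_idx \<mu> i of None \<Rightarrow> 1 | Some p \<Rightarrow> y p)"

definition c :: "nat \<Rightarrow> 'r" where "c i = u i * x i - y i"

lemma y_eq: "y i = u i * x i - c i"
  by (simp add: c_def)

lemma c_in: "i \<in> {1..N} \<Longrightarrow> c i \<in> R (i - 1)"
  using y_eq_x[of i] y_pred[of i] unfolding c_def u_def
  by (auto split: option.splits simp: R_0_in)

lemma y_prime_self: "i \<in> {1..N} \<Longrightarrow> homog_prime emb n act (R i) (y i)"
  by (intro y_prime succ_gtI) auto

lemma y_prime_pred:
  assumes "i \<in> {1..N}" "pred_idx \<mu> i = Some p"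
  shows "homog_prime emb n act (R (i - 1)) (y p)"
  using pred_idx_SomeD[OF assms(2)] assms(1) by (intro y_prime succ_gtI) auto

lemma pred_in: "i \<in> {1..N} \<Longrightarrow> pred_idx \<mu> i = Some p \<Longrightarrow> p \<in> {1..N} \<and> p < i"
  using pred_idx_SomeD[of \<mu> i p] by auto

lemma y_in: "i \<in> {1..N} \<Longrightarrow> i \<le> k \<Longrightarrow> y i \<in> R k"
  using homog_primeD(1)[OF y_prime_self] R_mono by blast

lemma y_nonzero: "i \<in> {1..N} \<Longrightarrow> y i \<noteq> 0"
  using homog_primeD(2)[OF y_prime_self] by blast

lemma one_nonzero: "(1::'r) \<noteq> 0"
  using emb_eq_0_iff[of 1] by (simp add: emb_1)

lemma y_pow_nonzero: "i \<in> {1..N} \<Longrightarrow> y i ^ m \<noteq> 0"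
  using domain y_nonzero by (induction m) (auto simp: one_nonzero)

lemma u_in:
  assumes "i \<in> {1..N}"
  shows "u i \<in> R (i - 1)"
proof (cases "pred_idx \<mu> i")
  case None then show ?thesis by (simp add: u_def R_1_in)
next
  case (Some p)
  then have "p \<in> {1..N}" "p \<le> i - 1" using pred_in[OF assms Some] by auto
  then show ?thesis using Some y_in by (simp add: u_def)
qed

lemma u_nonzero:
  assumes "i \<in> {1..N}"
  shows "u i \<noteq> 0"
proof (cases "pred_idx \<mu> i")
  case None then show ?thesis by (simp add: u_def one_nonzero)
next
  case (Some p) then show ?thesis using pred_in[OF assms Some] y_nonzero by (simp add: u_def)
qed

lemma y_top: "y i = u i * x i ^ 1 + - c i"
  by (simp add: y_eq)

lemma neg_c_in_Fil: "i \<in> {1..N} \<Longrightarrow> - c i \<in> Fil i 1"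
  unfolding Fil_1 by (intro R_neg c_in)

text \<open>Normality of \<open>y i\<close> in \<open>R i\<close> yields some \<open>f\<close> in
  \<open>R i\<close>. A positive degree of \<open>f\<close> in \<open>x i\<close> would give
  \<open>f * y i\<close> degree at least 2, whereas \<open>y i * b\<close> has degree at most 1, so
  \<open>f\<close> lies in \<open>R (i - 1)\<close>. The last two equations compare the coefficients
  of \<open>x i\<close> and of 1.\<close>

lemma y_commute:
  assumes i: "i \<in> {1..N}" and b: "b \<in> R (i - 1)"
  obtains f where "f \<in> R (i - 1)" "y i * b = f * y i" "f * u i = u i * sg i b"
    "u i * dl i b - c i * b = - (f * c i)"
proof -
  have bi: "b \<in> R i" using b R_mono[of "i - 1" i] by auto
  obtain f where f: "f \<in> R i" "y i * b = f * y i"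
    using homog_primeD(3)[OF y_prime_self[OF i] bi] by blast
  have yb: "y i * b = (u i * sg i b) * x i ^ 1 + (u i * dl i b - c i * b)"
  proof -
    have "y i * b = u i * (x i * b) - c i * b" by (simp add: y_eq left_diff_distrib mult.assoc)
    then show ?thesis unfolding x_comm[OF i b] by (simp add: distrib_left mult.assoc)
  qed
  have cf1: "u i * sg i b \<in> R (i - 1)" "u i * dl i b - c i * b \<in> R (i - 1)"
    by (intro R_mult R_diff u_in i sg_in dl_in b c_in)+
  have "f \<in> R (i - 1)"
  proof (cases "f = 0")
    case True then show ?thesis by (simp add: R_0_in)
  next
    case False
    obtain g d s where g: "g \<in> R (i - 1)" "g \<noteq> 0" "s \<in> Fil i d" "f = g * x i ^ d + s"
      using R_top[OF i f(1) False] .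
    obtain t where t: "t \<in> Fil i (d + 1)" "f * y i = g * (sg i ^^ d) (u i) * x i ^ (d + 1) + t"
      using top_mult[OF i g(1) u_in[OF i] g(3) neg_c_in_Fil[OF i]] unfolding g(4) y_top[of i] .
    have "d = 0"
    proof (rule ccontr)
      assume "d \<noteq> 0"
      have "f * y i \<in> Fil i (Suc 1)"
        unfolding f(2)[symmetric] yb using cf1 by (intro Fil_SucI) (simp_all only: Fil_1)
      then have "f * y i - t \<in> Fil i (d + 1)"
        using t(1) Fil_mono[of "Suc 1" "d + 1" i] \<open>d \<noteq> 0\<close> by (intro Fil_diff) auto
      then have "g * (sg i ^^ d) (u i) * x i ^ (d + 1) \<in> Fil i (d + 1)" unfolding t(2) by simp
      then have "g * (sg i ^^ d) (u i) = 0"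
        by (rule Fil_top_eq_0[OF i R_mult[OF g(1) sg_pow_in[OF i u_in[OF i]]]])
      then show False
        using domain g(2) sg_pow_eq_0[OF i u_in[OF i]] u_nonzero[OF i] by blast
    qed
    then show ?thesis using g by simp
  qed
  moreover have "f * y i = (f * u i) * x i ^ 1 + - (f * c i)"
    by (simp add: y_eq algebra_simps)
  then have "(u i * sg i b) * x i ^ 1 + (u i * dl i b - c i * b) = (f * u i) * x i ^ 1 + - (f * c i)"
    using f(2) yb by simp
  then have "u i * sg i b = f * u i \<and> u i * dl i b - c i * b = - (f * c i)"
    using \<open>f \<in> R (i - 1)\<close> cf1 i
    by (intro Fil_unique[OF i]) (auto simp only: Fil_1 intro!: R_mult R_neg u_in c_in)
  ultimately show ?thesis using f(2) that by metis
qed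

text \<open>Left multiplication by \<open>y i\<close> raises the degree in \<open>x i\<close> by
  exactly one: the new leading coefficient \<open>u i * sg i g\<close> is nonzero in a
  domain.\<close>

lemma y_shift:
  assumes i: "i \<in> {1..N}" and r: "r \<in> R i" and "y i * r \<in> Fil i (Suc e)"
  shows "r \<in> Fil i e"
proof (rule ccontr)
  assume not_in: "r \<notin> Fil i e"
  then have "r \<noteq> 0" using Fil_0_in by auto
  then obtain g d s where g: "g \<in> R (i - 1)" "g \<noteq> 0" "s \<in> Fil i d" "r = g * x i ^ d + s"
    using R_top[OF i r] by metis
  have "r \<in> Fil i (Suc d)" using g Fil_SucI by metis
  then have "\<not> Suc d \<le> e" using not_in Fil_mono by blast
  obtain t where t: "t \<in> Fil i (1 + d)" "y i * r = u i * (sg i ^^ 1) g * x i ^ (1 + d) + t"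
    using top_mult[OF i u_in[OF i] g(1) neg_c_in_Fil[OF i] g(3)] unfolding g(4) y_top[of i] .
  have "y i * r - t \<in> Fil i (1 + d)"
    using t(1) assms(3) Fil_mono[of "Suc e" "1 + d" i] \<open>\<not> Suc d \<le> e\<close> by (intro Fil_diff) auto
  then have "u i * sg i g * x i ^ (1 + d) \<in> Fil i (1 + d)" unfolding t(2) by simp
  then have "u i * sg i g = 0"
    by (rule Fil_top_eq_0[OF i R_mult[OF u_in[OF i] sg_in[OF i g(1)]]])
  then show False
    using domain g(2) sg_eq_0[OF i g(1)] u_nonzero[OF i] by blast
qed

text \<open>In this form the degree argument shows that an earlier \<open>y j\<close> is never a
  right multiple of a later \<open>y i\<close>.\<close>

lemma y_shift_R:
  assumes i: "i \<in> {1..N}" and r: "r \<in> R i" and "y i * r \<in> R (i - 1)"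
  shows "r = 0"
  using y_shift[OF i r, of 0] assms(3) by (simp add: Fil_Suc_0)

section \<open>Commutation of the \<open>y i\<close> up to powers of \<open>q\<close>\<close>

lemma homog_sg:
  assumes i: "i \<in> {1..N}" and b: "b \<in> R (i - 1)" "is_homog emb n act b"
  obtains \<omega> where "sg i b = sc \<omega> b"
proof -
  obtain h where "h \<in> Htor n" "\<forall>b\<in>Rsub emb x (i - 1). act h b = (if i = 1 then b else \<sigma> i b)"
    using torus_elements[OF i] by blast
  moreover have "(if i = 1 then b else \<sigma> i b) = sg i b" using i by (auto simp: sg_def)
  ultimately show ?thesis using b that unfolding is_homog_def homog_def sc_def by metis
qed

text \<open>As \<open>sg i\<close> scales each earlier generator, it preserves every ring below, not
  just \<open>R (i - 1)\<close>. The comparison of coefficients in \<open>sg_y\<close> takes place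
  in such a smaller ring.\<close>

lemma sg_in_lower:
  assumes i: "i \<in> {1..N}" and l: "l < i" and b: "b \<in> R l"
  shows "sg i b \<in> R l"
proof -
  have sub: "R l \<subseteq> R (i - 1)" using l by (intro R_mono) simp
  have "b \<in> R l \<and> sg i b \<in> R l" using b unfolding Rsub_def
  proof induction
    case (scal d) then show ?case using sg_emb[OF i] by (metis subalg.scal)
  next
    case (gen s)
    then obtain j where j: "j \<in> {1..l}" "s = x j" by blast
    then have "sg i s = emb (q powi a i j) * s" using i l \<sigma>_x[of i j] by (auto simp: sg_def)
    then show ?case using gen by (auto intro: subalg.intros)
  next
    case (add b d)
    then have "sg i (b + d) = sg i b + sg i d" using sub unfolding Rsub_def
      by (intro sg_add[OF i, unfolded Rsub_def]) auto
    then show ?case using add by (auto intro: subalg.intros)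
  next
    case (mult b d)
    then have "sg i (b * d) = sg i b * sg i d" using sub unfolding Rsub_def
      by (intro sg_mult[OF i, unfolded Rsub_def]) auto
    then show ?case using mult by (auto intro: subalg.intros)
  next
    case (neg b)
    then have "sg i (sc (-1) b) = sc (-1) (sg i b)" using sub unfolding Rsub_def
      by (intro sg_sc[OF i, unfolded Rsub_def]) auto
    then have "sg i (- b) = - sg i b" by simp
    then show ?case using neg by (auto intro: subalg.intros)
  qed
  then show ?thesis by blast
qed

text \<open>Homogeneity makes \<open>y l\<close> an eigenvector of \<open>sg i\<close> with some
  eigenvalue \<open>\<omega>\<close>. Comparing coefficients of \<open>x l\<close> in
  \<open>y l = u l * x l - c l\<close> identifies \<open>\<omega>\<close> as the eigenvalue of
  \<open>u l\<close>, a power of \<open>q\<close> by induction, times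
  \<open>q powi a i l\<close>.\<close>

lemma sg_y:
  assumes i: "i \<in> {1..N}"
  shows "1 \<le> l \<Longrightarrow> l < i \<Longrightarrow> \<exists>s. sg i (y l) = sc (q powi s) (y l)"
proof (induction l rule: less_induct)
  case (less l)
  have l: "l \<in> {1..N}" using less.prems i by auto
  have sub: "R l \<subseteq> R (i - 1)" "R (l - 1) \<subseteq> R (i - 1)" 
    using less.prems by (simp_all add: R_mono)
  have "\<exists>s. sg i (u l) = sc (q powi s) (u l)"
  proof (cases "pred_idx \<mu> l")
    case None
    then show ?thesis using sg_emb[OF i, of 1] unfolding u_def by (auto simp: emb_1 intro!: exI[of _ 0])
  next
    case (Some p)
    then have "1 \<le> p" "p < l" using pred_idx_SomeD by auto
    then show ?thesis using less.IH[of p] less.prems Some unfolding u_def by auto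
  qed
  then obtain s where s: "sg i (u l) = sc (q powi s) (u l)" by blast
  have yl: "y l \<in> R l" using y_in l by auto
  obtain \<omega> where \<omega>: "sg i (y l) = sc \<omega> (y l)"
    using homog_sg[OF i _ y_homog[OF l]] sub yl by blast
  have xl: "sg i (x l) = sc (q powi a i l) (x l)"
    using i less.prems \<sigma>_x[of i l] by (auto simp: sg_def sc_def)
  have in_R: "u l \<in> R (i - 1)" "x l \<in> R (i - 1)" "c l \<in> R (i - 1)" "y l \<in> R (i - 1)"
    using u_in[OF l] c_in[OF l] sub yl x_in_R[of l "i - 1"] less.prems by auto
  have "sg i (y l + c l) = sg i (u l * x l)" by (simp add: y_eq)
  then have "sg i (y l) = sg i (u l) * sg i (x l) - sg i (c l)"
    using in_R by (simp add: sg_add[OF i] sg_mult[OF i] algebra_simps)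
  then have eq: "sc (q powi s * q powi a i l) (u l) * x l ^ 1 + - sg i (c l) = sc \<omega> (u l) * x l ^ 1 + - sc \<omega> (c l)"
    using s xl \<omega> by (simp add: y_eq[of l] V.scale_right_diff_distrib mult.commute)
  have "sg i (c l) \<in> R (l - 1)"
    using less.prems by (intro sg_in_lower[OF i _ c_in[OF l]]) simp
  then have "- sg i (c l) \<in> Fil l 1" "- sc \<omega> (c l) \<in> Fil l 1"
    unfolding Fil_1 by (intro R_neg R_sc c_in[OF l], assumption?)+
  then have "sc (q powi s * q powi a i l) (u l) = sc \<omega> (u l)"
    using Fil_unique[OF l R_sc[OF u_in[OF l]] R_sc[OF u_in[OF l]] _ _ eq] by blast
  then have "q powi s * q powi a i l = \<omega>" using u_nonzero[OF l] by (simp add: V.scale_right_imp_eq)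
  then have "\<omega> = q powi (s + a i l)" using q_nonzero by (simp add: power_int_add)
  then show ?case using \<omega> by blast
qed

lemma q_powi_nonzero [simp]: "q powi k \<noteq> 0"
  using q_nonzero by simp

text \<open>By \<open>y_commute\<close>, moving \<open>y l\<close> across the last
  \<open>y (Suc m)\<close> gives a factor \<open>f\<close> with
  \<open>f * u (Suc m) = u (Suc m) * sg (Suc m) (y l)\<close>. Here \<open>sg\<close> contributes a
  power of \<open>q\<close>, and \<open>u (Suc m)\<close> is 1 or an earlier \<open>y p\<close>,
  which commutes with \<open>y l\<close> up to a power of \<open>q\<close> by induction; cancelling
  it determines \<open>f\<close>.\<close>

lemma y_q_commute_aux: "m \<le> N \<Longrightarrow> i \<in> {1..m} \<Longrightarrow> l \<in> {1..m} \<Longrightarrow> \<exists>k. y i * y l = sc (q powi k) (y l * y i)"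
proof (induction m arbitrary: i l)
  case (Suc m)
  have main: "\<exists>k. y (Suc m) * y l = sc (q powi k) (y l * y (Suc m))" if l: "l \<in> {1..m}" for l
  proof -
    have i: "Suc m \<in> {1..N}" and l': "l \<in> {1..N}" using Suc.prems l by auto
    obtain f where f: "f \<in> R (Suc m - 1)" "y (Suc m) * y l = f * y (Suc m)"
      "f * u (Suc m) = u (Suc m) * sg (Suc m) (y l)"
      using y_commute[OF i, of "y l"] y_in[OF l'] l by auto
    obtain s where s: "sg (Suc m) (y l) = sc (q powi s) (y l)" using sg_y[OF i, of l] l by auto
    have "\<exists>k. u (Suc m) * y l = sc (q powi k) (y l * u (Suc m))"
    proof (cases "pred_idx \<mu> (Suc m)")
      case None then show ?thesis unfolding u_def by (auto intro!: exI[of _ 0])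
    next
      case (Some p)
      then show ?thesis using Suc.IH[of p l] pred_idx_SomeD[OF Some] Suc.prems(1) l unfolding u_def by auto
    qed
    then obtain k where "u (Suc m) * y l = sc (q powi k) (y l * u (Suc m))" by blast
    then have "f * u (Suc m) = sc (q powi (s + k)) (y l) * u (Suc m)"
      using f(3) s q_nonzero by (simp add: power_int_add)
    then have "f = sc (q powi (s + k)) (y l)" using cancel_right u_nonzero[OF i] by blast
    then show ?thesis using f(2) by auto
  qed
  have inv: "\<exists>k. r * s = sc (q powi k) (s * r)" if "s * r = sc (q powi k) (r * s)" for r s k
    using that q_nonzero by (intro exI[of _ "- k"]) (simp flip: power_int_add)
  consider "i \<in> {1..m}" "l \<in> {1..m}" | "i = Suc m" "l \<in> {1..m}" | "i \<in> {1..m}" "l = Suc m" | "i = Suc m" "l = Suc m"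
    using Suc.prems by fastforce
  then show ?case
  proof cases
    case 1 then show ?thesis using Suc by auto
  next
    case 2 then show ?thesis using main by auto
  next
    case 3 then show ?thesis using main[of i] inv by blast
  next
    case 4 then show ?thesis by (auto intro!: exI[of _ 0])
  qed
qed auto

text \<open>Choosing the exponent only for \<open>l < i\<close> and negating it for
  \<open>i < l\<close> makes skew-symmetry hold by construction.\<close>

definition B :: "nat \<Rightarrow> nat \<Rightarrow> int" where
  "B i l = (if l < i then SOME k. y i * y l = sc (q powi k) (y l * y i)
     else if i < l then - (SOME k. y l * y i = sc (q powi k) (y i * y l)) else 0)"

lemma B_skew: "B i l = - B l i"
  by (simp add: B_def)

lemma y_q_commute:
  assumes "i \<in> {1..N}" "l \<in> {1..N}"
  shows "y i * y l = sc (q powi B i l) (y l * y i)"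
proof -
  have *: "y i * y l = sc (q powi B i l) (y l * y i)" if "l < i" "i \<in> {1..N}" "l \<in> {1..N}" for i l
    using someI_ex[OF y_q_commute_aux[of N i l]] that by (simp add: B_def)
  consider "l < i" | "i < l" | "i = l" by linarith
  then show ?thesis
  proof cases
    case 2
    have "y l * y i = sc (q powi B l i) (y i * y l)" using *[OF 2] assms by auto
    then show ?thesis using q_nonzero by (subst B_skew) (simp flip: power_int_add)
  qed (use * assms in \<open>auto simp: B_def\<close>)
qed

definition ldiv :: "nat \<Rightarrow> 'r \<Rightarrow> 'r \<Rightarrow> bool" where
  "ldiv l g h \<longleftrightarrow> (\<forall>w\<in>R l. \<forall>v\<in>R l. g * w = h * v \<longrightarrow> w \<in> mults (R l) h)"

text \<open>Since \<open>g\<close> and \<open>h\<close> lie in \<open>R (l - 1)\<close>, left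
  multiplication by them acts on each coefficient of a polynomial in \<open>x l\<close> separately,
  so the quotient is assembled coefficient by coefficient.\<close>

lemma ldiv_step:
  assumes l: "l \<in> {1..N}" and gh: "g \<in> R (l - 1)" "h \<in> R (l - 1)" and "ldiv (l - 1) g h"
  shows "ldiv l g h"
proof -
  have *: "w \<in> mults (R l) h" if "w \<in> Fil l d" "v \<in> Fil l d" "g * w = h * v" for w v d
    using that
  proof (induction d arbitrary: w v)
    case 0 then show ?case using R_0_in by (force simp: mults_def)
  next
    case (Suc d)
    obtain b r where b: "b \<in> R (l - 1)" "r \<in> Fil l d" "w = b * x l ^ d + r"
      using Suc.prems(1) by (rule Fil_SucE)
    obtain b' r' where b': "b' \<in> R (l - 1)" "r' \<in> Fil l d" "v = b' * x l ^ d + r'"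
      using Suc.prems(2) by (rule Fil_SucE)
    have "(g * b) * x l ^ d + g * r = (h * b') * x l ^ d + h * r'"
      using Suc.prems(3) b b' by (simp add: algebra_simps)
    then have eq: "g * b = h * b' \<and> g * r = h * r'"
      by (rule Fil_unique[OF l R_mult[OF gh(1) b(1)] R_mult[OF gh(2) b'(1)]
            Fil_lmult[OF gh(1) b(2)] Fil_lmult[OF gh(2) b'(2)]])
    then obtain s where s: "s \<in> R (l - 1)" "b = h * s"
      using assms(4) b(1) b'(1) unfolding ldiv_def mults_def by blast
    obtain t where t: "t \<in> R l" "r = h * t"
      using Suc.IH[OF b(2) b'(2)] eq unfolding mults_def by blast
    have "w = h * (s * x l ^ d + t)" using b s t by (simp add: algebra_simps)
    moreover have "s * x l ^ d + t \<in> R l"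
      using s t l R_mono[of "l - 1" l] x_in_R[of l l] by (auto intro!: R_add R_mult R_power)
    ultimately show ?case unfolding mults_def by blast
  qed
  show ?thesis unfolding ldiv_def
  proof (intro ballI impI)
    fix w v assume "w \<in> R l" "v \<in> R l" and eq: "g * w = h * v"
    then obtain d e where "w \<in> Fil l d" "v \<in> Fil l e" using R_eq_Fil[OF l] by auto
    then have "w \<in> Fil l (max d e)" "v \<in> Fil l (max d e)"
      using Fil_mono[of d "max d e" l] Fil_mono[of e "max d e" l] by auto
    then show "w \<in> mults (R l) h" using * eq by blast
  qed
qed

lemma ldiv_UNIV:
  assumes "ldiv k g h" "g \<in> R k" "h \<in> R k" "k \<le> N" and eq: "g * w = h * v"
  obtains s where "w = h * s"
proof -
  have "ldiv l g h" if "k \<le> l" "l \<le> N" for l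
    using that
  proof (induction l rule: dec_induct)
    case (step l)
    then show ?case using ldiv_step[of "Suc l" g h] R_mono[of k l] assms by auto
  qed (use assms in auto)
  then have "ldiv N g h" using assms(4) by blast
  then have "w \<in> mults (R N) h" using eq by (auto simp: ldiv_def R_N)
  then show ?thesis using that unfolding mults_def by blast
qed

text \<open>It suffices to argue in the ring \<open>R\<close> of the larger index. For
  \<open>i < k\<close> this is primality of \<open>y k\<close>. For \<open>k < i\<close> primality
  of \<open>y k\<close> may already be lost in \<open>R i\<close>, so primality of
  \<open>y i\<close> is used on the other side: it gives \<open>v = y i * t\<close>, and commuting
  \<open>y k\<close> past \<open>y i\<close> allows \<open>y i\<close> to be cancelled.\<close>

lemma y_left_cancel:
  assumes i: "i \<in> {1..N}" and k: "k \<in> {1..N}" and "i \<noteq> k" and eq: "y i * w = y k * v"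
  obtains s where "w = y k * s"
proof (cases "i < k")
  case True
  have "ldiv k (y i) (y k)" unfolding ldiv_def
  proof (intro ballI impI)
    fix w v assume w: "w \<in> R k" "v \<in> R k" "y i * w = y k * v"
    have yi: "y i \<in> R (k - 1)" "y i \<in> R k" using y_in[OF i] True by auto
    have "y i \<notin> mults (R k) (y k)"
    proof
      assume "y i \<in> mults (R k) (y k)"
      then obtain t where t: "t \<in> R k" "y i = y k * t" unfolding mults_def by blast
      then have "t = 0" using y_shift_R[OF k] yi by metis
      then show False using t y_nonzero[OF i] by simp
    qed
    moreover have "y i * w \<in> mults (R k) (y k)" using multsI[OF w(2), of "y k"] w(3) by simp
    ultimately show "w \<in> mults (R k) (y k)"
      using homog_primeD(6)[OF y_prime_self[OF k] yi(2) w(1)] by blast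
  qed
  then show ?thesis using ldiv_UNIV[of k "y i" "y k" w v] y_in i k True eq that by fastforce
next
  case False
  then have "k < i" using \<open>i \<noteq> k\<close> by simp
  have "ldiv i (y i) (y k)" unfolding ldiv_def
  proof (intro ballI impI)
    fix w v assume w: "w \<in> R i" "v \<in> R i" "y i * w = y k * v"
    have yk: "y k \<in> R (i - 1)" "y k \<in> R i" using y_in[OF k] \<open>k < i\<close> by auto
    have "y k \<notin> mults (R i) (y i)"
    proof
      assume "y k \<in> mults (R i) (y i)"
      then obtain t where t: "t \<in> R i" "y k = y i * t" unfolding mults_def by blast
      then have "t = 0" using y_shift_R[OF i] yk by metis
      then show False using t y_nonzero[OF k] by simp
    qed
    moreover have "y k * v \<in> mults (R i) (y i)" using multsI[OF w(1), of "y i"] w(3) by simp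
    ultimately obtain t where t: "t \<in> R i" "v = y i * t"
      using homog_primeD(6)[OF y_prime_self[OF i] yk(2) w(2)] unfolding mults_def by blast
    have "y i * w = y i * (y k * sc (q powi B k i) t)"
      using w(3) y_q_commute[OF k i] unfolding t(2) by (simp flip: mult.assoc)
    then have "w = y k * sc (q powi B k i) t" using cancel_left y_nonzero[OF i] by blast
    then show "w \<in> mults (R i) (y k)" using t R_sc unfolding mults_def by blast
  qed
  then show ?thesis using ldiv_UNIV[of i "y i" "y k" w v] y_in i k \<open>k < i\<close> eq that by fastforce
qed

section \<open>The remainder \<open>c i\<close> for an index \<open>i\<close> with predecessor
  \<open>p\<close>\<close>

context
  fixes i p assumes i: "i \<in> {1..N}" and p: "pred_idx \<mu> i = Some p"
begin

lemma p_in: "p \<in> {1..N}" "p < i" "y p \<in> R (i - 1)" "y p \<in> R i"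
  using pred_in[OF i p] y_in by auto

lemma u_eq: "u i = y p"
  using p by (simp add: u_def)

text \<open>Otherwise \<open>y i\<close> would factor as \<open>y p * (x i - s)\<close>. By
  primality \<open>y i\<close> divides one factor: not \<open>y p\<close>, by degree; and if
  \<open>x i - s = y i * t\<close>, then \<open>t\<close> has degree 0 and cancelling
  \<open>y i\<close> makes \<open>y p\<close> a unit of \<open>R (i - 1)\<close>, where it is
  prime.\<close>

lemma c_not_mult: "c i \<notin> mults (R (i - 1)) (y p)"
proof
  assume "c i \<in> mults (R (i - 1)) (y p)"
  then obtain s where s: "s \<in> R (i - 1)" "c i = y p * s" unfolding mults_def by blast
  have yi: "y i = y p * (x i - s)" by (simp add: y_eq u_eq s algebra_simps)
  have xs: "x i - s \<in> Fil i (Suc 1)"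
    using Fil_SucI[of 1 i "- s" 1] R_neg[OF s(1)] by (simp add: R_1_in Fil_Suc_0)
  then have xs': "x i - s \<in> R i" using Fil_subset_R[of i] i by (simp add: subset_iff)
  have "y i = y i * 1" by simp
  then have "y p * (x i - s) \<in> mults (R i) (y i)"
    using multsI[OF R_1_in[of i], of "y i"] yi by simp
  then consider "y p \<in> mults (R i) (y i)" | "x i - s \<in> mults (R i) (y i)"
    using homog_primeD(6)[OF y_prime_self[OF i] p_in(4) xs'] by blast
  then show False
  proof cases
    case 1
    then obtain t where t: "t \<in> R i" "y p = y i * t" unfolding mults_def by blast
    then have "t = 0" using y_shift_R[OF i] p_in by metis
    then show False using t y_nonzero p_in by simp
  next
    case 2
    then obtain t where t: "t \<in> R i" "x i - s = y i * t" unfolding mults_def by blast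
    then have "t \<in> Fil i 1" using y_shift[OF i, of t 1] xs by simp
    then have t1: "t \<in> R (i - 1)" unfolding Fil_1 .
    have "y i * 1 = (y p * y i) * t" using yi t(2) by (simp add: mult.assoc)
    also have "\<dots> = y i * (y p * sc (q powi B p i) t)"
      unfolding y_q_commute[OF p_in(1) i] by (simp add: mult.assoc)
    finally have "1 = y p * sc (q powi B p i) t" using cancel_left y_nonzero[OF i] by blast
    then have "1 \<in> mults (R (i - 1)) (y p)" using t1 R_sc unfolding mults_def by blast
    then show False using homog_primeD(5)[OF y_prime_pred[OF i p]] by blast
  qed
qed

text \<open>The successor of \<open>p\<close> is \<open>i\<close>, so \<open>y p\<close> is still
  prime in \<open>R (i - 1)\<close>, the ring that contains \<open>c i\<close>;
  \<open>ldiv_UNIV\<close> carries the conclusion up to the whole ring.\<close>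

lemma c_left_cancel:
  assumes "c i * w = y p * v"
  obtains s where "w = y p * s"
proof -
  have "ldiv (i - 1) (c i) (y p)" unfolding ldiv_def
  proof (intro ballI impI)
    fix w v assume w: "w \<in> R (i - 1)" "v \<in> R (i - 1)" "c i * w = y p * v"
    then have "c i * w \<in> mults (R (i - 1)) (y p)" using multsI by simp
    then show "w \<in> mults (R (i - 1)) (y p)"
      using homog_primeD(6)[OF y_prime_pred[OF i p] c_in[OF i] w(1)] c_not_mult by blast
  qed
  moreover have "i - 1 \<le> N" using i by auto
  ultimately show ?thesis using ldiv_UNIV[OF _ c_in[OF i] p_in(3) _ assms] that by blast
qed

text \<open>As \<open>y i = y p * x i - c i\<close> is homogeneous, the torus element that acts as
  \<open>sg i\<close> on \<open>R (i - 1)\<close> scales \<open>c i\<close> in the same way as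
  \<open>y p * x i\<close>; the scalar \<open>qi\<close> is its eigenvalue on
  \<open>x i\<close>.\<close>

lemma sg_y_c:
  obtains \<nu> qi where "\<nu> \<noteq> 0" "not_root_of_unity qi" "sg i (y p) = sc \<nu> (y p)"
    "sg i (c i) = sc (\<nu> * qi) (c i)"
proof -
  obtain h qi where h: "h \<in> Htor n" "not_root_of_unity qi"
    "\<forall>b\<in>Rsub emb x (i - 1). act h b = (if i = 1 then b else \<sigma> i b)" "act h (x i) = emb qi * x i"
    using torus_elements[OF i] by blast
  have hsg: "act h b = sg i b" if "b \<in> R (i - 1)" for b
    using h(3) that i by (auto simp: sg_def)
  have aut: "kalg_aut emb (act h)" using torus h(1) unfolding rational_torus_action_def by blast
  obtain s where s: "sg i (y p) = sc (q powi s) (y p)" using sg_y[OF i, of p] p_in by auto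
  obtain \<omega> where \<omega>: "act h (y i) = sc \<omega> (y i)"
    using y_homog[OF i] h(1) unfolding is_homog_def homog_def sc_def by blast
  have "act h (y i + c i) = act h (y p * x i)" by (simp add: y_eq[of i] u_eq)
  then have "act h (y i) = act h (y p) * act h (x i) - act h (c i)"
    using aut unfolding kalg_aut_def by (auto simp: algebra_simps)
  then have "sc (q powi s * qi) (y p) * x i ^ 1 + - sg i (c i) = sc \<omega> (y p) * x i ^ 1 + - sc \<omega> (c i)"
    using s \<omega> h(4) hsg[OF p_in(3)] hsg[OF c_in[OF i]]
    by (simp add: y_eq[of i] u_eq V.scale_right_diff_distrib mult.commute flip: sc_def)
  moreover have "- sg i (c i) \<in> Fil i 1" "- sc \<omega> (c i) \<in> Fil i 1"
    unfolding Fil_1 by (intro R_neg R_sc sg_in[OF i] c_in[OF i])+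
  ultimately have "sc (q powi s * qi) (y p) = sc \<omega> (y p) \<and> - sg i (c i) = - sc \<omega> (c i)"
    by (intro Fil_unique[OF i R_sc[OF p_in(3)] R_sc[OF p_in(3)]])
  then have "\<omega> = q powi s * qi" "sg i (c i) = sc \<omega> (c i)"
    using y_nonzero p_in V.scale_right_imp_eq by auto
  then show ?thesis using that[of "q powi s" qi] h(2) s q_powi_nonzero by metis
qed

text \<open>Here \<open>\<kappa> m = \<nu>^(m+1) (q\<^sub>i^(m+1) - 1)\<close>, which is nonzero because \<open>q\<^sub>i\<close> is not a root of unity.\<close>

lemma x_y_pow_commute:
  obtains \<nu> \<kappa> where "\<And>m. \<kappa> m \<noteq> 0"
    "\<And>m. \<exists>f. x i * y p ^ Suc m = sc (\<nu> ^ Suc m) (y p ^ Suc m * x i) + y p ^ m * (sc (\<kappa> m) (c i) + y p * f)"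
proof -
  obtain \<nu> qi where \<nu>: "\<nu> \<noteq> 0" "not_root_of_unity qi" "sg i (y p) = sc \<nu> (y p)"
    "sg i (c i) = sc (\<nu> * qi) (c i)" by (rule sg_y_c)
  let ?P = "R (i - 1)"
  have right: "\<exists>b'\<in>?P. b * y p = y p * b'" if "b \<in> ?P" for b
    using homog_primeD(4)[OF y_prime_pred[OF i p] that] .
  obtain c' where c': "c' \<in> ?P" "c i * y p = y p * c'" using right c_in[OF i] by blast
  have yp0: "y p \<noteq> 0" using y_nonzero p_in by blast
  \<comment> \<open>\<open>y_commute\<close> for \<open>b = y p\<close>: the factor \<open>f\<close>
    turns out to be \<open>\<nu>\<close> times \<open>y p\<close>, and the last equation then
    evaluates \<open>dl i (y p)\<close>.\<close>
  obtain f where f: "f \<in> ?P" "f * y p = y p * sg i (y p)" "y p * dl i (y p) - c i * y p = - (f * c i)"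
    using y_commute[OF i p_in(3)] unfolding u_eq by metis
  have "f * y p = sc \<nu> (y p) * y p" using f(2) \<nu>(3) by simp
  then have "f = sc \<nu> (y p)" using cancel_right yp0 by blast
  then have "y p * dl i (y p) = y p * (c' - sc \<nu> (c i))" using f(3) c'(2) by (simp add: algebra_simps)
  then have dl_y: "dl i (y p) = c' - sc \<nu> (c i)" using cancel_left yp0 by blast
  \<comment> \<open>\<open>y_commute\<close> for \<open>b = c i\<close>: now
    \<open>(f - c i) * c i\<close> is a right multiple of \<open>y p\<close>, so primality forces
    \<open>f\<close> to be congruent to \<open>c i\<close>. Hence \<open>c'\<close> is congruent to
    \<open>\<nu> * qi\<close> times \<open>c i\<close> modulo \<open>y p\<close>.\<close>
  obtain f where f: "f \<in> ?P" "f * y p = y p * sg i (c i)" "y p * dl i (c i) - c i * c i = - (f * c i)"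
    using y_commute[OF i c_in[OF i]] unfolding u_eq by metis
  have "(f - c i) * c i = y p * (- dl i (c i))" using f(3) by (simp add: algebra_simps)
  then have "(f - c i) * c i \<in> mults ?P (y p)"
    unfolding mults_def using R_neg dl_in[OF i c_in[OF i]] by blast
  then have "f - c i \<in> mults ?P (y p)"
    using homog_primeD(6)[OF y_prime_pred[OF i p] R_diff[OF f(1) c_in[OF i]] c_in[OF i]] c_not_mult by blast
  then obtain g where g: "g \<in> ?P" "f - c i = y p * g" unfolding mults_def by blast
  obtain g' where g': "g' \<in> ?P" "g * y p = y p * g'" using right g by blast
  have "f = c i + y p * g" using g(2) by (simp add: algebra_simps)
  then have "y p * sc (\<nu> * qi) (c i) = y p * (c' + y p * g')"
    using f(2) c'(2) g'(2) \<nu>(4) by (simp add: algebra_simps)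
  then have c'_eq: "c' = sc (\<nu> * qi) (c i) - y p * g'"
    using cancel_left yp0 by (metis add_diff_cancel_right')
  define \<kappa> where "\<kappa> m = \<nu> ^ Suc m * (qi ^ Suc m - 1)" for m
  \<comment> \<open>The first summand arises from moving \<open>x i\<close> across the last factor
    \<open>y p\<close>, the second from moving \<open>c i\<close> across it.\<close>
  have \<kappa>_step: "\<kappa> (Suc m) = \<nu> ^ Suc m * \<kappa> 0 + \<kappa> m * (\<nu> * qi)" for m
    unfolding \<kappa>_def by (simp add: algebra_simps)
  have x_y: "x i * y p = sc \<nu> (y p * x i) + (sc (\<kappa> 0) (c i) - y p * g')"
    using x_comm[OF i p_in(3)] \<nu>(3) dl_y c'_eq unfolding \<kappa>_def by (simp add: algebra_simps)
  \<comment> \<open>Stronger than the goal: \<open>f\<close> stays in \<open>R (i - 1)\<close>,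
    where \<open>y p\<close> is normal, so that it can be carried past the next factor
    \<open>y p\<close>.\<close>
  have "\<exists>f\<in>?P. x i * y p ^ Suc m = sc (\<nu> ^ Suc m) (y p ^ Suc m * x i) + y p ^ m * (sc (\<kappa> m) (c i) + y p * f)" for m
  proof (induction m)
    case 0 then show ?case using x_y g' by (intro bexI[of _ "- g'"]) (auto intro: R_neg)
  next
    case (Suc m)
    then obtain f where f: "f \<in> ?P"
      "x i * y p ^ Suc m = sc (\<nu> ^ Suc m) (y p ^ Suc m * x i) + y p ^ m * (sc (\<kappa> m) (c i) + y p * f)" by blast
    obtain f' where f': "f' \<in> ?P" "f * y p = y p * f'" using right f by blast
    let ?f = "f' - sc (\<nu> ^ Suc m) g' - sc (\<kappa> m) g'"
    have "x i * y p ^ Suc (Suc m) = x i * y p ^ Suc m * y p"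
      by (simp add: mult.assoc power_commutes)
    also have "\<dots> = sc (\<nu> ^ Suc m) (y p ^ Suc m * (x i * y p)) + y p ^ m * (sc (\<kappa> m) (c i * y p) + y p * (f * y p))"
      unfolding f(2) by (simp add: algebra_simps)
    also have "y p ^ m * (sc (\<kappa> m) (c i * y p) + y p * (f * y p)) = y p ^ Suc m * (sc (\<kappa> m) c' + y p * f')"
      unfolding c'(2) f'(2) power_Suc2 by (simp add: algebra_simps)
    also have "sc (\<nu> ^ Suc m) (y p ^ Suc m * (x i * y p))
        = sc (\<nu> ^ Suc (Suc m)) (y p ^ Suc (Suc m) * x i) + y p ^ Suc m * sc (\<nu> ^ Suc m) (sc (\<kappa> 0) (c i) - y p * g')"
    proof -
      have "y p ^ m * (y p * r) = y p * (y p ^ m * r)" for r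
        by (simp add: power_commutes flip: mult.assoc)
      then show ?thesis
        unfolding x_y by (simp add: distrib_left V.scale_right_distrib mult.assoc mult.commute[of "\<nu> ^ m" \<nu>])
    qed
    finally have "x i * y p ^ Suc (Suc m) = sc (\<nu> ^ Suc (Suc m)) (y p ^ Suc (Suc m) * x i)
        + y p ^ Suc m * (sc (\<nu> ^ Suc m) (sc (\<kappa> 0) (c i) - y p * g') + (sc (\<kappa> m) c' + y p * f'))"
      by (simp add: distrib_left add.assoc)
    also have "sc (\<nu> ^ Suc m) (sc (\<kappa> 0) (c i) - y p * g') + (sc (\<kappa> m) c' + y p * f')
        = sc (\<kappa> (Suc m)) (c i) + y p * ?f"
      unfolding c'_eq \<kappa>_step
      by (simp add: V.scale_right_diff_distrib V.scale_left_distrib right_diff_distrib)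
    finally show ?case using f' g' by (intro bexI[of _ ?f]) (auto intro!: R_diff R_sc)
  qed
  moreover have "\<kappa> m \<noteq> 0" for m
    using \<nu>(1,2) unfolding \<kappa>_def not_root_of_unity_def by (metis eq_iff_diff_eq_0 mult_eq_0_iff power_not_zero zero_less_Suc)
  ultimately show ?thesis using that[of \<kappa> \<nu>] by blast
qed

end

text \<open>In \<open>R p\<close> each factor \<open>y p\<close> costs one degree in
  \<open>x p\<close>, so an element of degree below \<open>d\<close> divisible by
  \<open>y p ^ d\<close> is zero. Above level \<open>p\<close>, division by powers of
  \<open>y p\<close> happens in the coefficients of \<open>x (Suc l)\<close>, and the induction
  hypothesis applies to each of them.\<close>

lemma y_pow_div_bounded_aux:
  assumes p: "p \<in> {1..N}"
  shows "p \<le> l \<Longrightarrow> l \<le> N \<Longrightarrow> r \<in> R l \<Longrightarrow> (\<And>m. \<exists>s\<in>R l. r = y p ^ m * s) \<Longrightarrow> r = 0"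
proof (induction l arbitrary: r rule: dec_induct)
  case base
  obtain d where d: "r \<in> Fil p d" using base.prems R_eq_Fil[OF p] by auto
  obtain s where s: "s \<in> R p" "r = y p ^ d * s" using base.prems by blast
  have "s \<in> Fil p 0" if "s \<in> R p" "y p ^ d * s \<in> Fil p d" for s d
    using that
  proof (induction d)
    case (Suc d)
    have "y p ^ d * s \<in> R p" by (intro R_mult R_power Suc.prems y_in[OF p]) simp
    then have "y p ^ d * s \<in> Fil p d" using y_shift[OF p, of "y p ^ d * s" d] Suc.prems by (simp add: mult.assoc)
    then show ?case using Suc by blast
  qed auto
  then have "s = 0" using s d by simp
  then show ?case using s by simp
next
  case (step l)
  have l: "Suc l \<in> {1..N}" using step by auto
  have yp: "y p ^ m \<in> R l" for m using y_in[OF p] step by (intro R_power) auto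
  have "r = 0" if "r \<in> Fil (Suc l) d" "\<And>m. \<exists>s\<in>R (Suc l). r = y p ^ m * s" for r d
    using that
  proof (induction d arbitrary: r)
    case (Suc d)
    obtain b r' where b: "b \<in> R (Suc l - 1)" "r' \<in> Fil (Suc l) d" "r = b * x (Suc l) ^ d + r'"
      using Suc.prems(1) by (rule Fil_SucE)
    have "\<exists>g t. g \<in> R l \<and> t \<in> Fil (Suc l) d \<and> b = y p ^ m * g \<and> r' = y p ^ m * t" for m
    proof -
      obtain s where s: "s \<in> R (Suc l)" "r = y p ^ m * s" using Suc.prems by blast
      \<comment> \<open>The quotient has no larger degree than \<open>r\<close>, because
        \<open>y p ^ m\<close> is a nonzero left factor from the coefficient domain.\<close>
      have "s \<in> Fil (Suc l) (Suc d)"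
      proof (rule ccontr)
        assume not: "s \<notin> Fil (Suc l) (Suc d)"
        then have "s \<noteq> 0" using Fil_0_in by auto
        then obtain g e t where g: "g \<in> R (Suc l - 1)" "g \<noteq> 0" "t \<in> Fil (Suc l) e" "s = g * x (Suc l) ^ e + t"
          using R_top[OF l s(1)] by metis
        then have "s \<in> Fil (Suc l) (Suc e)" using Fil_SucI by metis
        then have "\<not> Suc e \<le> Suc d" using not Fil_mono by blast
        then have "r \<in> Fil (Suc l) e" using Suc.prems(1) Fil_mono[of "Suc d" e "Suc l"] by auto
        moreover have "y p ^ m * t \<in> Fil (Suc l) e" using Fil_lmult[of "y p ^ m" "Suc l" t e] yp g by simp
        moreover have "(y p ^ m * g) * x (Suc l) ^ e = r - y p ^ m * t"
          using s g by (simp add: algebra_simps)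
        ultimately have "y p ^ m * g = 0"
          using Fil_top_eq_0[OF l, of "y p ^ m * g" e] Fil_diff yp g R_mult by (metis diff_Suc_1)
        then show False using domain[of "y p ^ m" g] g(2) y_nonzero[OF p] y_pow_nonzero[OF p] by blast
      qed
      then obtain g t where g: "g \<in> R (Suc l - 1)" "t \<in> Fil (Suc l) d" "s = g * x (Suc l) ^ d + t"
        by (rule Fil_SucE)
      have "b * x (Suc l) ^ d + r' = (y p ^ m * g) * x (Suc l) ^ d + y p ^ m * t"
        using b s g by (simp add: algebra_simps)
      then have "b = y p ^ m * g \<and> r' = y p ^ m * t"
        using yp g b by (intro Fil_unique[OF l]) (auto intro!: R_mult Fil_lmult)
      then show ?thesis using g by auto
    qed
    then have "b = 0" "r' = 0"
      using step.IH[of b] step.prems b Suc.IH[OF b(2)] Fil_subset_R[of "Suc l" d] by (auto, blast+)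
    then show ?case using b by simp
  qed auto
  then show ?case using step.prems R_eq_Fil[OF l] by blast
qed

lemma y_pow_div_bounded:
  assumes p: "p \<in> {1..N}" and "\<And>m. \<exists>s. r = y p ^ m * s"
  shows "r = 0"
  using y_pow_div_bounded_aux[OF p, of N r] assms by (simp add: R_N)

text \<open>Let \<open>y p ^ Suc k\<close> be the exact power of \<open>y p\<close> dividing
  \<open>z\<close>, with quotient \<open>w\<close>. Commuting \<open>x i\<close> past
  \<open>z\<close> and reducing modulo \<open>y p ^ Suc k\<close> leaves only a nonzero multiple of
  \<open>y p ^ k * c i * w\<close>, so \<open>c i * w\<close> and hence \<open>w\<close> is
  divisible by \<open>y p\<close>, a contradiction.\<close>

lemma commuting_multiple_eq_0:
  assumes i: "i \<in> {1..N}" and p: "pred_idx \<mu> i = Some p"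
    and z: "x i * z = z * x i" and v: "z = y p * v"
  shows "z = 0"
proof (rule ccontr)
  assume "z \<noteq> 0"
  let ?P = "\<lambda>m. \<exists>s. z = y p ^ m * s"
  have pN: "p \<in> {1..N}" using pred_in[OF i p] by blast
  define M where "M = (LEAST m. \<not> ?P m)"
  have ex: "\<exists>m. \<not> ?P m" using y_pow_div_bounded[OF pN] \<open>z \<noteq> 0\<close> by blast
  then have M: "\<not> ?P M" unfolding M_def by (rule LeastI_ex)
  \<comment> \<open>\<open>M\<close> is the first power of \<open>y p\<close> that does not divide
    \<open>z\<close>; by assumption it exceeds 1.\<close>
  have "?P 0" "?P 1" using v by auto
  then obtain k where k: "M = Suc (Suc k)" using M by (metis One_nat_def not0_implies_Suc)
  have "?P (Suc k)" using not_less_Least[of "Suc k" "\<lambda>m. \<not> ?P m"] k unfolding M_def by auto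
  then obtain w where w: "z = y p ^ Suc k * w" by blast
  obtain \<nu> \<kappa> f where \<kappa>: "\<kappa> \<noteq> 0" and
    comm: "x i * y p ^ Suc k = sc (\<nu> ^ Suc k) (y p ^ Suc k * x i) + y p ^ k * (sc \<kappa> (c i) + y p * f)"
    using x_y_pow_commute[OF i p] by metis
  have "y p ^ k * ((sc \<kappa> (c i) + y p * f) * w) = (x i * y p ^ Suc k) * w - sc (\<nu> ^ Suc k) (y p ^ Suc k * x i) * w"
    unfolding comm by (simp add: algebra_simps)
  also have "(x i * y p ^ Suc k) * w = y p ^ Suc k * w * x i"
    using z unfolding w by (simp only: mult.assoc)
  also have "y p ^ Suc k * w * x i - sc (\<nu> ^ Suc k) (y p ^ Suc k * x i) * w
      = y p ^ k * (y p * (w * x i - sc (\<nu> ^ Suc k) (x i * w)))"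
    unfolding power_Suc2 by (simp add: right_diff_distrib mult.assoc del: power_Suc)
  finally have "(sc \<kappa> (c i) + y p * f) * w = y p * (w * x i - sc (\<nu> ^ Suc k) (x i * w))"
    using cancel_left y_pow_nonzero[OF pN] by blast
  then have "sc \<kappa> (c i * w) = y p * (w * x i - sc (\<nu> ^ Suc k) (x i * w) - f * w)"
    by (simp add: algebra_simps)
  then have "sc (1 / \<kappa>) (sc \<kappa> (c i * w)) = sc (1 / \<kappa>) (y p * (w * x i - sc (\<nu> ^ Suc k) (x i * w) - f * w))" by simp
  then have "c i * w = y p * sc (1 / \<kappa>) (w * x i - sc (\<nu> ^ Suc k) (x i * w) - f * w)"
    using \<kappa> by simp
  then obtain s where "w = y p * s" using c_left_cancel[OF i p] by blast
  then have "z = y p ^ M * s" unfolding w k power_Suc2 by (simp add: mult.assoc del: power_Suc)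
  then show False using M by blast
qed

end

section \<open>Laurent monomials in q-commuting units\<close>

lemma rinv_unit:
  assumes "is_unit w"
  shows "rinv w * w = 1" "w * rinv w = 1"
proof -
  obtain v where v: "v * w = 1" "w * v = 1" using assms unfolding is_unit_def by blast
  have "rinv w = v" unfolding rinv_def
  proof (rule the_equality)
    fix v' assume "v' * w = 1 \<and> w * v' = 1"
    then show "v' = v" using v by (metis mult.assoc mult_1 mult_1_right)
  qed (use v in simp)
  then show "rinv w * w = 1" "w * rinv w = 1" using v by simp_all
qed

lemma is_unit_mult:
  assumes "is_unit v" "is_unit w"
  shows "is_unit (v * w)"
  unfolding is_unit_def
proof (intro exI conjI)
  show "rinv w * rinv v * (v * w) = 1"
    using rinv_unit[OF assms(1)] rinv_unit[OF assms(2)]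
    by (metis mult.assoc mult_1)
  show "v * w * (rinv w * rinv v) = 1"
    using rinv_unit[OF assms(1)] rinv_unit[OF assms(2)]
    by (metis mult.assoc mult_1)
qed

lemma unit_cancel_right: "is_unit w \<Longrightarrow> v * w = v' * w \<Longrightarrow> v = v'"
  by (metis rinv_unit(2) mult.assoc mult_1_right)

lemma unit_cancel_left: "is_unit w \<Longrightarrow> w * v = w * v' \<Longrightarrow> v = v'"
  by (metis rinv_unit(1) mult.assoc mult_1)

lemma ipow_0 [simp]: "ipow w 0 = 1"
  by (simp add: ipow_def)

lemma ipow_nat: "ipow w (int k) = w ^ k"
  by (simp add: ipow_def)

lemma ipow_1 [simp]: "ipow w 1 = w"
  using ipow_nat[of w 1] by simp

lemma ipow_Suc:
  assumes "is_unit w"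
  shows "ipow w (k + 1) = ipow w k * w"
proof (cases "0 \<le> k")
  case True
  then obtain j where "k = int j" using nonneg_int_cases by blast
  then show ?thesis using ipow_nat[of w "Suc j"] by (simp add: ipow_nat power_commutes add.commute)
next
  case False
  then obtain j where j: "k = - int (Suc j)" by (metis not_le zero_less_imp_eq_int neg_0_less_iff_less
        minus_minus gr0_implies_Suc of_nat_0_less_iff)
  have eq: "rinv w ^ Suc j * w = rinv w ^ j"
    using rinv_unit[OF assms] by (simp add: power_Suc2 mult.assoc del: power_Suc)
  have "nat (- k) = Suc j" using j by arith
  then have "ipow w k = rinv w ^ Suc j" using False by (simp add: ipow_def del: power_Suc)
  moreover have "ipow w (k + 1) = rinv w ^ j" using j by (cases "j = 0") (simp_all add: ipow_def)
  ultimately show ?thesis using eq by simp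
qed

lemma ipow_pred:
  assumes "is_unit w"
  shows "ipow w (k - 1) = ipow w k * rinv w"
  using ipow_Suc[OF assms, of "k - 1"] rinv_unit[OF assms] by (simp add: mult.assoc)

lemma ipow_add:
  assumes "is_unit w"
  shows "ipow w (k + l) = ipow w k * ipow w l"
proof (induction l rule: int_induct[of _ 0])
  case (step1 l)
  then show ?case using ipow_Suc[OF assms, of "k + l"] ipow_Suc[OF assms, of l]
    by (simp add: add.assoc mult.assoc)
next
  case (step2 l)
  then show ?case using ipow_pred[OF assms, of "k + l"] ipow_pred[OF assms, of l]
    by (simp add: mult.assoc algebra_simps)
qed auto

lemma is_unit_1: "is_unit 1"
  unfolding is_unit_def by (intro exI[of _ 1]) simp

lemma ipow_unit: "is_unit w \<Longrightarrow> is_unit (ipow w k)"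
  unfolding is_unit_def using ipow_add[of w k "- k"] ipow_add[of w "- k" k]
  by (intro exI[of _ "ipow w (- k)"]) (auto simp: is_unit_def)

lemma (in central_scalars) ipow_q_commute:
  assumes w: "is_unit w" and c: "c \<noteq> 0" and comm: "v * w = sc c (w * v)"
  shows "v * ipow w k = sc (c powi k) (ipow w k * v)"
proof (induction k rule: int_induct[of _ 0])
  case (step1 l)
  have "v * ipow w (l + 1) = (v * ipow w l) * w" using ipow_Suc[OF w] by (simp add: mult.assoc)
  also have "\<dots> = sc (c powi l) (ipow w l * (v * w))" using step1 by (simp add: mult.assoc)
  also have "\<dots> = sc (c powi (l + 1)) (ipow w (l + 1) * v)"
    unfolding comm ipow_Suc[OF w] using c by (simp add: power_int_add mult.assoc mult.commute)
  finally show ?case .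
next
  case (step2 l)
  have "w * (v * rinv w) = sc (1 / c) (sc c (w * v)) * rinv w" using c by (simp add: mult.assoc)
  also have "\<dots> = sc (1 / c) v" unfolding comm[symmetric] using rinv_unit[OF w] by (simp add: mult.assoc)
  finally have "v * rinv w = sc (1 / c) (rinv w * v)"
    by (metis (no_types, lifting) rinv_unit(1)[OF w] mult.assoc mult_1 sc_mult_right)
  then have *: "v * rinv w = sc (c powi (-1)) (rinv w * v)" by (simp add: divide_inverse)
  have "v * ipow w (l - 1) = (v * ipow w l) * rinv w" using ipow_pred[OF w] by (simp add: mult.assoc)
  also have "\<dots> = sc (c powi l) (ipow w l * (v * rinv w))" using step2 by (simp add: mult.assoc)
  also have "\<dots> = sc (c powi l * c powi (-1)) (ipow w (l - 1) * v)"
    unfolding * ipow_pred[OF w] by (simp add: mult.assoc)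
  also have "c powi l * c powi (-1) = c powi (l - 1)" using c power_int_add[of c l "-1"] by simp
  finally show ?case .
qed auto

locale q_units = central_scalars emb
  for emb :: "'k::field_char_0 \<Rightarrow> 't::ring_1" +
  fixes N :: nat and Y :: "nat \<Rightarrow> 't" and q :: 'k and B :: "nat \<Rightarrow> nat \<Rightarrow> int"
  assumes q_nz: "q \<noteq> 0"
    and units: "\<And>j. j \<in> {1..N} \<Longrightarrow> is_unit (Y j)"
    and q_commute: "\<And>i j. i \<in> {1..N} \<Longrightarrow> j \<in> {1..N} \<Longrightarrow> Y i * Y j = sc (q powi B i j) (Y j * Y i)"
    and skew: "\<And>i j. B i j = - B j i"
begin

text \<open>Equality up to a power of \<open>q\<close>. Most reordering factors may stay
  unspecified; the one that matters is recorded in \<open>Y_M\<close>.\<close>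

definition qeq :: "'t \<Rightarrow> 't \<Rightarrow> bool" (infix "\<approx>" 50) where
  "v \<approx> w \<longleftrightarrow> (\<exists>k. v = sc (q powi k) w)"

definition M :: "(nat \<Rightarrow> int) \<Rightarrow> 't" where "M m = oprod N (\<lambda>j. ipow (Y j) (m j))"

text \<open>The exponent of \<open>q\<close> by which conjugation with \<open>Y i\<close> scales the
  Laurent monomial \<open>M m\<close>, see \<open>Y_M\<close>.\<close>

definition b :: "nat \<Rightarrow> (nat \<Rightarrow> int) \<Rightarrow> int" where "b i m = (\<Sum>j\<in>{1..N}. B i j * m j)"

lemma qeq_refl: "v \<approx> v"
  unfolding qeq_def by (intro exI[of _ 0]) simp

lemma qeq_sym: "v \<approx> w \<Longrightarrow> w \<approx> v"
proof -
  assume "v \<approx> w"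
  then obtain k where "v = sc (q powi k) w" unfolding qeq_def by blast
  then have "w = sc (q powi (- k)) v" using q_nz by (simp flip: power_int_add)
  then show "w \<approx> v" unfolding qeq_def by blast
qed

lemma qeq_trans [trans]: "v \<approx> w \<Longrightarrow> w \<approx> z \<Longrightarrow> v \<approx> z"
proof -
  assume "v \<approx> w" "w \<approx> z"
  then obtain k l where "v = sc (q powi k) w" "w = sc (q powi l) z" unfolding qeq_def by blast
  then have "v = sc (q powi (k + l)) z" using q_nz by (simp add: power_int_add)
  then show "v \<approx> z" unfolding qeq_def by blast
qed

lemma qeq_mult: "v \<approx> v' \<Longrightarrow> w \<approx> w' \<Longrightarrow> v * w \<approx> v' * w'"
proof -
  assume "v \<approx> v'" "w \<approx> w'"
  then obtain k l where "v = sc (q powi k) v'" "w = sc (q powi l) w'" unfolding qeq_def by blast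
  then have "v * w = sc (q powi (k + l)) (v' * w')" using q_nz by (simp add: power_int_add mult.commute)
  then show "v * w \<approx> v' * w'" unfolding qeq_def by blast
qed

lemma ipow_qeq_commute: "is_unit w \<Longrightarrow> v * w \<approx> w * v \<Longrightarrow> v * ipow w k \<approx> ipow w k * v"
proof -
  assume w: "is_unit w" and "v * w \<approx> w * v"
  then obtain l where "v * w = sc (q powi l) (w * v)" unfolding qeq_def by blast
  then have "v * ipow w k = sc ((q powi l) powi k) (ipow w k * v)"
    using q_nz by (intro ipow_q_commute w) auto
  then show ?thesis unfolding qeq_def by (metis power_int_mult)
qed

lemma oprod_qeq_commute:
  "(\<And>j. j \<in> {1..k} \<Longrightarrow> v * f j \<approx> f j * v) \<Longrightarrow> v * oprod k f \<approx> oprod k f * v"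
proof (induction k)
  case (Suc k)
  have "v * oprod (Suc k) f = (v * oprod k f) * f (Suc k)" by (simp add: mult.assoc)
  also have "\<dots> \<approx> (oprod k f * v) * f (Suc k)"
    using Suc by (intro qeq_mult[OF _ qeq_refl, of "v * oprod k f"]) auto
  also have "\<dots> = oprod k f * (v * f (Suc k))" by (simp add: mult.assoc)
  also have "\<dots> \<approx> oprod k f * (f (Suc k) * v)" by (rule qeq_mult[OF qeq_refl Suc.prems]) simp
  also have "\<dots> = oprod (Suc k) f * v" by (simp add: mult.assoc)
  finally show ?case .
qed (simp add: qeq_refl)

lemma oprod_qeq_mult:
  assumes "\<And>i j. i \<in> {1..k} \<Longrightarrow> j \<in> {1..k} \<Longrightarrow> f i * g j \<approx> g j * f i"
  shows "oprod k f * oprod k g \<approx> oprod k (\<lambda>j. f j * g j)"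
  using assms
proof (induction k)
  case (Suc k)
  have "oprod (Suc k) f * oprod (Suc k) g = oprod k f * ((f (Suc k) * oprod k g) * g (Suc k))"
    by (simp add: mult.assoc)
  also have "\<dots> \<approx> oprod k f * ((oprod k g * f (Suc k)) * g (Suc k))"
    by (rule qeq_mult[OF qeq_refl], rule qeq_mult[OF _ qeq_refl], rule oprod_qeq_commute)
      (use Suc.prems in auto)
  also have "\<dots> = (oprod k f * oprod k g) * (f (Suc k) * g (Suc k))" by (simp add: mult.assoc)
  also have "\<dots> \<approx> oprod k (\<lambda>j. f j * g j) * (f (Suc k) * g (Suc k))"
    using Suc by (intro qeq_mult qeq_refl) auto
  finally show ?case by simp
qed (simp add: qeq_refl)

lemma ipow_Y_commute:
  assumes "i \<in> {1..N}" "j \<in> {1..N}"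
  shows "ipow (Y i) k * ipow (Y j) l \<approx> ipow (Y j) l * ipow (Y i) k"
proof -
  have "Y j * Y i \<approx> Y i * Y j" using q_commute[of j i] assms unfolding qeq_def by blast
  then have "Y j * ipow (Y i) k \<approx> ipow (Y i) k * Y j" by (rule ipow_qeq_commute[OF units[OF assms(1)]])
  then have "ipow (Y i) k * Y j \<approx> Y j * ipow (Y i) k" by (rule qeq_sym)
  then show ?thesis by (rule ipow_qeq_commute[OF units[OF assms(2)]])
qed

lemma M_mult: "M m * M m' \<approx> M (\<lambda>j. m j + m' j)"
proof -
  have "M m * M m' \<approx> oprod N (\<lambda>j. ipow (Y j) (m j) * ipow (Y j) (m' j))"
    unfolding M_def by (intro oprod_qeq_mult ipow_Y_commute)
  also have "\<dots> = M (\<lambda>j. m j + m' j)"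
    unfolding M_def using units by (intro oprod_cong) (simp add: ipow_add)
  finally show ?thesis .
qed

lemma M_0: "M (\<lambda>_. 0) = 1"
  unfolding M_def using oprod_stop[of 0 N "\<lambda>_. 1::'t"] by simp

lemma oprod_single:
  fixes v :: "'a::ring_1"
  shows "i \<in> {1..k} \<Longrightarrow> oprod k (\<lambda>j. if j = i then v else 1) = v"
proof (induction k)
  case (Suc k)
  show ?case
  proof (cases "i = Suc k")
    case True
    have "oprod k (\<lambda>j. if j = i then v else 1) = oprod k (\<lambda>_. 1)" using True by (intro oprod_cong) auto
    then show ?thesis using True oprod_stop[of 0 k "\<lambda>_. 1::'a"] by simp
  qed (use Suc in auto)
qed auto

lemma M_single: "i \<in> {1..N} \<Longrightarrow> M (\<lambda>j. if j = i then k else 0) = ipow (Y i) k"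
proof -
  assume i: "i \<in> {1..N}"
  have "M (\<lambda>j. if j = i then k else 0) = oprod N (\<lambda>j. if j = i then ipow (Y i) k else 1)"
    unfolding M_def by (intro oprod_cong) auto
  then show ?thesis using oprod_single[OF i] by simp
qed

lemma M_unit: "is_unit (M m)"
proof -
  have "is_unit (oprod k (\<lambda>j. ipow (Y j) (m j)))" if "k \<le> N" for k
    using that by (induction k) (auto simp: is_unit_1 intro!: is_unit_mult ipow_unit units)
  then show ?thesis unfolding M_def by simp
qed

lemma Y_M:
  assumes i: "i \<in> {1..N}"
  shows "Y i * M m = sc (q powi b i m) (M m * Y i)"
proof -
  have "Y i * oprod k (\<lambda>j. ipow (Y j) (m j))
      = sc (q powi (\<Sum>j\<in>{1..k}. B i j * m j)) (oprod k (\<lambda>j. ipow (Y j) (m j)) * Y i)" if "k \<le> N" for k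
    using that
  proof (induction k)
    case (Suc k)
    have comm: "Y i * ipow (Y (Suc k)) (m (Suc k))
        = sc (q powi (B i (Suc k) * m (Suc k))) (ipow (Y (Suc k)) (m (Suc k)) * Y i)"
      using ipow_q_commute[OF units _ q_commute[OF i], of "Suc k" "m (Suc k)"] Suc.prems q_nz
      by (simp add: power_int_mult)
    have "Y i * oprod (Suc k) (\<lambda>j. ipow (Y j) (m j))
        = (Y i * oprod k (\<lambda>j. ipow (Y j) (m j))) * ipow (Y (Suc k)) (m (Suc k))" by (simp add: mult.assoc)
    also have "\<dots> = sc (q powi (\<Sum>j\<in>{1..k}. B i j * m j))
        (oprod k (\<lambda>j. ipow (Y j) (m j)) * (Y i * ipow (Y (Suc k)) (m (Suc k))))"
      using Suc by (simp add: mult.assoc)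
    finally show ?case unfolding comm using q_nz
      by (simp add: power_int_add mult.assoc add.commute mult.commute)
  qed simp
  then show ?thesis unfolding M_def b_def by blast
qed

text \<open>A skew form vanishes on the diagonal. Its use: if \<open>b i m = 0\<close> for all
  \<open>i\<close> other than \<open>k\<close>, then \<open>m k * b k m = 0\<close>.\<close>

lemma b_skew: "(\<Sum>i\<in>{1..N}. m i * b i m) = 0"
proof -
  let ?s = "\<Sum>i\<in>{1..N}. m i * b i m"
  have "?s = (\<Sum>i\<in>{1..N}. \<Sum>j\<in>{1..N}. m i * (B i j * m j))"
    unfolding b_def by (simp add: sum_distrib_left)
  also have "\<dots> = (\<Sum>j\<in>{1..N}. \<Sum>i\<in>{1..N}. m i * (B i j * m j))" by (rule sum.swap)
  also have "\<dots> = (\<Sum>j\<in>{1..N}. \<Sum>i\<in>{1..N}. - (m j * (B j i * m i)))"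
    using skew by (intro sum.cong refl) (metis mult.commute mult.left_commute mult_minus_left mult_minus_right)
  also have "\<dots> = - ?s" unfolding b_def by (simp add: sum_negf sum_distrib_left)
  finally show ?thesis by simp
qed

lemma ipow_M: "ipow (M m) k \<approx> M (\<lambda>j. k * m j)"
proof (induction k rule: int_induct[of _ 0])
  case base show ?case using M_0 by (simp add: qeq_refl)
next
  case (step1 l)
  have "ipow (M m) (l + 1) = ipow (M m) l * M m" by (rule ipow_Suc[OF M_unit])
  also have "\<dots> \<approx> M (\<lambda>j. l * m j) * M m" by (intro qeq_mult step1 qeq_refl)
  also have "\<dots> \<approx> M (\<lambda>j. l * m j + m j)" by (rule M_mult)
  finally show ?case by (simp add: algebra_simps)
next
  case (step2 l)
  have "M (\<lambda>j. (l - 1) * m j) = M (\<lambda>j. (l - 1) * m j) * M m * rinv (M m)"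
    using rinv_unit[OF M_unit, of m] by (simp add: mult.assoc)
  also have "\<dots> \<approx> M (\<lambda>j. (l - 1) * m j + m j) * rinv (M m)" by (intro qeq_mult M_mult qeq_refl)
  also have "M (\<lambda>j. (l - 1) * m j + m j) = M (\<lambda>j. l * m j)" by (simp add: algebra_simps)
  also have "M (\<lambda>j. l * m j) * rinv (M m) \<approx> ipow (M m) l * rinv (M m)" by (intro qeq_mult qeq_sym[OF step2(2)] qeq_refl)
  also have "\<dots> = ipow (M m) (l - 1)" by (rule ipow_pred[OF M_unit, symmetric])
  finally show ?case by (rule qeq_sym)
qed

lemma oprod_ipow_M: "oprod k (\<lambda>i. ipow (M (e i)) (g i)) \<approx> M (\<lambda>j. \<Sum>i\<in>{1..k}. g i * e i j)"
proof (induction k)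
  case (Suc k)
  have "oprod (Suc k) (\<lambda>i. ipow (M (e i)) (g i))
      \<approx> M (\<lambda>j. \<Sum>i\<in>{1..k}. g i * e i j) * M (\<lambda>j. g (Suc k) * e (Suc k) j)"
    using qeq_mult[OF Suc ipow_M] by simp
  also have "\<dots> \<approx> M (\<lambda>j. (\<Sum>i\<in>{1..k}. g i * e i j) + g (Suc k) * e (Suc k) j)" by (rule M_mult)
  finally show ?case by (simp add: add.commute)
qed (simp add: M_0 qeq_refl)

text \<open>\<open>v \<mapsto> Y i * v - q\<^sup>l v * Y i\<close> kills the eigenvalue class \<open>q\<^sup>l\<close> and rescales the others, up to a factor
  \<open>Y i\<close> on the right.\<close>

lemma eigencomponent_in:
  assumes diff: "\<And>v w. v \<in> S \<Longrightarrow> w \<in> S \<Longrightarrow> v - w \<in> S" and scale: "\<And>c v. v \<in> S \<Longrightarrow> sc c v \<in> S"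
    and left: "\<And>v. v \<in> S \<Longrightarrow> Y i * v \<in> S" and right: "\<And>v. v \<in> S \<Longrightarrow> v * Y i \<in> S"
    and q1: "not_root_of_unity q"
    and "finite \<Lambda>"
  shows "finite F \<Longrightarrow> \<beta> ` F \<subseteq> insert c \<Lambda> \<Longrightarrow>
    (\<And>m. m \<in> F \<Longrightarrow> Y i * f m = sc (q powi \<beta> m) (f m * Y i)) \<Longrightarrow> sum f F \<in> S \<Longrightarrow>
    \<exists>s. sum f {m \<in> F. \<beta> m = c} * Y i ^ s \<in> S"
  using \<open>finite \<Lambda>\<close>
proof (induction \<Lambda> arbitrary: f F rule: finite_induct)
  case empty
  then have "{m \<in> F. \<beta> m = c} = F" by auto
  then show ?case using empty by (intro exI[of _ 0]) simp
next
  case (insert l \<Lambda>)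
  show ?case
  proof (cases "l = c")
    case True then show ?thesis using insert.IH insert.prems by simp
  next
    case False
    have qne: "q powi c - q powi l \<noteq> 0"
    proof
      assume "q powi c - q powi l = 0"
      then have "q powi (c - l) = 1" "q powi (l - c) = 1" using q_nz by (simp_all add: power_int_diff)
      then have "q ^ nat \<bar>c - l\<bar> = 1" by (cases "c \<ge> l") (simp_all add: power_int_def abs_if split: if_splits)
      then show False using q1 False unfolding not_root_of_unity_def by auto
    qed
    let ?f = "\<lambda>m. sc (q powi \<beta> m - q powi l) (f m * Y i)"
    let ?F = "{m \<in> F. \<beta> m \<noteq> l}"
    have "sum ?f F = Y i * sum f F - sc (q powi l) (sum f F * Y i)"
      using insert.prems(3)
      by (simp add: sum_distrib_left sum_distrib_right V.scale_left_diff_distrib V.scale_sum_right sum_subtractf)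
    moreover have "sum ?f F = sum ?f ?F"
      using insert.prems(1) by (intro sum.mono_neutral_right) auto
    ultimately have sum_in: "sum ?f ?F \<in> S" using insert.prems(4) diff scale left right by simp
    have comm: "Y i * ?f m = sc (q powi \<beta> m) (?f m * Y i)" if "m \<in> ?F" for m
    proof -
      have "Y i * (f m * Y i) = sc (q powi \<beta> m) (f m * Y i * Y i)"
        using insert.prems(3)[of m] that by (simp flip: mult.assoc)
      then show ?thesis by (simp add: mult.commute)
    qed
    obtain s where s: "sum ?f {m \<in> ?F. \<beta> m = c} * Y i ^ s \<in> S"
      using insert.IH[of ?F ?f, OF _ _ comm sum_in] insert.prems(1,2) by auto
    have "{m \<in> ?F. \<beta> m = c} = {m \<in> F. \<beta> m = c}" using False by auto
    moreover have "sum ?f {m \<in> F. \<beta> m = c} = sc (q powi c - q powi l) (sum f {m \<in> F. \<beta> m = c} * Y i)"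
      by (simp add: sum_distrib_right V.scale_sum_right)
    ultimately have "sc (q powi c - q powi l) (sum f {m \<in> F. \<beta> m = c} * Y i ^ Suc s) \<in> S"
      using s by (simp add: mult.assoc)
    then have "sc (1 / (q powi c - q powi l)) (sc (q powi c - q powi l) (sum f {m \<in> F. \<beta> m = c} * Y i ^ Suc s)) \<in> S"
      by (rule scale)
    then show ?thesis using qne by (intro exI[of _ "Suc s"]) simp
  qed
qed

end

section \<open>The quantum torus and independence of monomials\<close>

lemma omon_upd_last:
  fixes z :: "nat \<Rightarrow> 'a::ring_1"
  assumes "e \<in> nexps l" "1 \<le> l" "l \<le> n"
  shows "omon z n e = omon z n (e(l := 0)) * z l ^ e l"
proof -
  have e: "e j = 0" if "j > l" for j using assms(1) that unfolding nexps_def by fastforce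
  obtain l' where l': "l = Suc l'" using assms by (cases l) auto
  have "omon z n e = oprod l (\<lambda>j. z j ^ e j)"
    unfolding omon_def using assms e by (intro oprod_stop) auto
  also have "\<dots> = oprod l' (\<lambda>j. z j ^ (e(l := 0)) j) * z l ^ e l"
    unfolding l' by (auto intro!: arg_cong2[where f = "(*)"] oprod_cong)
  also have "oprod l' (\<lambda>j. z j ^ (e(l := 0)) j) = omon z n (e(l := 0))"
    unfolding omon_def using assms e l' by (intro oprod_stop[symmetric]) auto
  finally show ?thesis .
qed

lemma nexps_upd_0:
  assumes "e \<in> nexps l"
  shows "e(l := 0) \<in> nexps (l - 1)"
proof -
  have "j \<in> {1..l}" if "e j \<noteq> 0" for j using assms that unfolding nexps_def by blast
  then have "j \<in> {1..l - 1}" if "(e(l := 0)) j \<noteq> 0" for j using that by (fastforce split: if_splits)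
  then show ?thesis unfolding nexps_def by blast
qed

locale torus_tower = gy_tower emb N x \<sigma> \<delta> n act \<mu> y q a
  for emb :: "'k::field_char_0 \<Rightarrow> 'r::ring_1" and N x \<sigma> \<delta> n act \<mu> y q a +
  fixes \<iota> :: "'r \<Rightarrow> 't::ring_1"
  assumes loc: "quantum_torus_loc N y \<iota>"
begin

lemma \<iota>_inj: "\<iota> r = \<iota> s \<longleftrightarrow> r = s" and \<iota>_1: "\<iota> 1 = 1"
  and \<iota>_add: "\<iota> (r + s) = \<iota> r + \<iota> s" and \<iota>_mult: "\<iota> (r * s) = \<iota> r * \<iota> s"
  and \<iota>_unit: "j \<in> {1..N} \<Longrightarrow> is_unit (\<iota> (y j))"
  and \<iota>_frac: "\<exists>r. \<exists>m\<in>nexps N. t * \<iota> (omon y N m) = \<iota> r"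
  using loc unfolding quantum_torus_loc_def inj_def by blast+

lemma \<iota>_0: "\<iota> 0 = 0"
  using \<iota>_add[of 0 0] by simp

lemma \<iota>_neg: "\<iota> (- r) = - \<iota> r"
  using \<iota>_add[of r "- r"] \<iota>_0 by (simp add: eq_neg_iff_add_eq_0 add.commute)

lemma \<iota>_diff: "\<iota> (r - s) = \<iota> r - \<iota> s"
  using \<iota>_add[of r "- s"] by (simp add: \<iota>_neg)

lemma \<iota>_power: "\<iota> (r ^ k) = \<iota> r ^ k"
  by (induction k) (auto simp: \<iota>_1 \<iota>_mult)

lemma \<iota>_sum: "\<iota> (sum f F) = (\<Sum>i\<in>F. \<iota> (f i))"
  by (induction F rule: infinite_finite_induct) (auto simp: \<iota>_0 \<iota>_add)

lemma \<iota>_oprod: "\<iota> (oprod k f) = oprod k (\<lambda>j. \<iota> (f j))"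
  by (induction k) (auto simp: \<iota>_1 \<iota>_mult)

lemma \<iota>_omon_unit: "is_unit (\<iota> (omon y N m))"
proof -
  have "is_unit (oprod k (\<lambda>j. \<iota> (y j) ^ m j))" if "k \<le> N" for k
    using that
  proof (induction k)
    case (Suc k)
    then have "is_unit (\<iota> (y (Suc k)) ^ m (Suc k))"
      using ipow_unit[OF \<iota>_unit, of "Suc k" "int (m (Suc k))"] by (simp add: ipow_nat)
    then show ?case using Suc by (auto intro: is_unit_mult)
  qed (simp add: is_unit_1)
  then show ?thesis by (simp add: omon_def \<iota>_oprod \<iota>_power)
qed

text \<open>\<open>quantum_torus_loc\<close> speaks of rings only. Scalars are central in the
  localization because every element becomes regular after right multiplication by a monomial, which
  is a unit commuting with the scalars.\<close>

lemma \<iota>_emb_central: "\<iota> (emb d) * t = t * \<iota> (emb d)"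
proof -
  obtain r m where r: "t * \<iota> (omon y N m) = \<iota> r" using \<iota>_frac by blast
  let ?w = "\<iota> (omon y N m)"
  have "\<iota> (emb d) * t * ?w = \<iota> (emb d * r)" unfolding \<iota>_mult r[symmetric] by (rule mult.assoc)
  also have "\<dots> = t * ?w * \<iota> (emb d)" unfolding r emb_comm by (rule \<iota>_mult)
  also have "\<dots> = t * \<iota> (omon y N m * emb d)" unfolding \<iota>_mult by (rule mult.assoc)
  also have "\<dots> = t * \<iota> (emb d) * ?w" unfolding emb_comm[symmetric] \<iota>_mult by (rule mult.assoc[symmetric])
  finally show ?thesis by (rule unit_cancel_right[OF \<iota>_omon_unit])
qed

sublocale T: central_scalars "\<lambda>d. \<iota> (emb d)"
proof
  show "scalar_emb (\<lambda>d. \<iota> (emb d))"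
    unfolding scalar_emb_def
  proof (intro conjI allI)
    show "inj (\<lambda>d. \<iota> (emb d))"
      using scalar_emb unfolding scalar_emb_def inj_def \<iota>_inj by blast
    show "\<iota> (emb d) * r = r * \<iota> (emb d)" for d r by (rule \<iota>_emb_central)
  qed (simp_all only: emb_1 emb_add emb_mult \<iota>_1 \<iota>_add \<iota>_mult)
qed

lemma \<iota>_sc: "\<iota> (sc d r) = T.sc d (\<iota> r)"
  by (simp add: sc_def T.sc_def \<iota>_mult)

sublocale Q: q_units "\<lambda>d. \<iota> (emb d)" N "\<lambda>j. \<iota> (y j)" q B
proof
  show "\<iota> (y i) * \<iota> (y j) = T.sc (q powi B i j) (\<iota> (y j) * \<iota> (y i))" if "i \<in> {1..N}" "j \<in> {1..N}" for i j
    using y_q_commute[OF that] by (metis \<iota>_mult \<iota>_sc)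
  show "B i j = - B j i" for i j by (rule B_skew)
qed (simp_all only: q_nonzero \<iota>_unit not_False_eq_True)

abbreviation M where "M \<equiv> Q.M"
abbreviation b where "b \<equiv> Q.b"
abbreviation qeq (infix "\<approx>" 50) where "qeq \<equiv> Q.qeq"

lemma lmon_eq_M: "lmon N y \<iota> m = M m"
  by (simp add: lmon_def Q.M_def)

lemma \<iota>_omon: "\<iota> (omon y N m) = M (\<lambda>j. int (m j))"
  by (simp add: omon_def Q.M_def \<iota>_oprod \<iota>_power ipow_nat)

section \<open>Products and independence of monomials in the \<open>y j\<close>\<close>

lemma omon_mult: "\<exists>k. omon y N m * omon y N m' = sc (q powi k) (omon y N (\<lambda>j. m j + m' j))"
proof -
  obtain k where "\<iota> (omon y N m) * \<iota> (omon y N m') = T.sc (q powi k) (\<iota> (omon y N (\<lambda>j. m j + m' j)))"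
    using Q.M_mult[of "\<lambda>j. int (m j)" "\<lambda>j. int (m' j)"] unfolding Q.qeq_def \<iota>_omon by auto
  then have "\<iota> (omon y N m * omon y N m') = \<iota> (sc (q powi k) (omon y N (\<lambda>j. m j + m' j)))"
    by (simp add: \<iota>_mult \<iota>_sc)
  then show ?thesis unfolding \<iota>_inj by blast
qed

lemma omon_times_power:
  assumes "i \<in> {1..N}"
  shows "\<exists>k. omon y N m * y i ^ d = sc (q powi k) (omon y N (m(i := m i + d)))"
proof -
  have "\<iota> (omon y N (\<lambda>j. if j = i then d else 0)) = \<iota> (y i ^ d)"
    using Q.M_single[OF assms, of "int d"]
    by (simp add: \<iota>_omon \<iota>_power ipow_nat if_distrib[of int] cong: if_cong)
  then have "omon y N (\<lambda>j. if j = i then d else 0) = y i ^ d" unfolding \<iota>_inj .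
  moreover have "(\<lambda>j. m j + (if j = i then d else 0)) = m(i := m i + d)" by auto
  ultimately show ?thesis using omon_mult[of m "\<lambda>j. if j = i then d else 0"] by simp
qed

text \<open>Independence, modulo right multiples of \<open>h\<close>, of the monomials without
  \<open>y k\<close>. It serves for \<open>h = 0\<close> with \<open>k = 0\<close>, an index that no
  exponent in \<open>nexps l\<close> uses, and for \<open>h = y k\<close> where \<open>k\<close> has
  no successor.\<close>

definition y_indep :: "nat \<Rightarrow> nat \<Rightarrow> 'r \<Rightarrow> bool" where
  "y_indep l k h \<longleftrightarrow> (\<forall>F d. finite F \<longrightarrow> F \<subseteq> nexps l \<longrightarrow> (\<forall>m\<in>F. m k = 0) \<longrightarrow>
     (\<Sum>m\<in>F. sc (d m) (omon y N m)) \<in> mults (R l) h \<longrightarrow> (\<forall>m\<in>F. d m = 0))"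

lemma omon_y_in: "m \<in> nexps l \<Longrightarrow> l \<le> N \<Longrightarrow> omon y N m \<in> R l"
proof -
  assume m: "m \<in> nexps l" "l \<le> N"
  then have "m j = 0" if "j > l" for j using that unfolding nexps_def by fastforce
  then have eq: "omon y N m = oprod l (\<lambda>j. y j ^ m j)"
    unfolding omon_def using m by (intro oprod_stop) auto
  have "oprod k (\<lambda>j. y j ^ m j) \<in> R l" if "k \<le> l" for k
    using that m by (induction k) (auto simp: R_1_in intro!: R_mult R_power y_in)
  then show ?thesis unfolding eq by blast
qed

text \<open>The leading coefficient of \<open>y l ^ d\<close> is a product of twisted copies of
  \<open>u l\<close>, and \<open>sg l\<close> only scales \<open>u l\<close> by a power of
  \<open>q\<close>.\<close>

lemma y_power_top:
  assumes l: "l \<in> {1..N}"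
  shows "\<exists>\<kappa> r. \<kappa> \<noteq> 0 \<and> r \<in> Fil l d \<and> y l ^ d = sc \<kappa> (u l ^ d) * x l ^ d + r"
proof (induction d)
  case 0
  show ?case by (intro exI[of _ 1] exI[of _ 0]) auto
next
  case (Suc d)
  then obtain \<kappa> r where *: "\<kappa> \<noteq> 0" "r \<in> Fil l d" "y l ^ d = sc \<kappa> (u l ^ d) * x l ^ d + r" by blast
  obtain s where s: "sg l (u l) = sc (q powi s) (u l)"
  proof (cases "pred_idx \<mu> l")
    case None
    then show ?thesis using that[of 0] sg_emb[OF l, of 1] by (simp add: u_def emb_1)
  next
    case (Some p)
    then have "1 \<le> p" "p < l" using pred_idx_SomeD by auto
    then show ?thesis using that sg_y[OF l, of p] Some by (auto simp: u_def)
  qed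
  have pow: "(sg l ^^ d) (u l) = sc ((q powi s) ^ d) (u l)" for d
    by (induction d) (simp_all add: sg_sc[OF l u_in[OF l]] s mult.commute)
  have ud: "sc \<kappa> (u l ^ d) \<in> R (l - 1)" by (intro R_sc R_power u_in l)
  obtain t where t: "t \<in> Fil l (d + 1)"
    "(sc \<kappa> (u l ^ d) * x l ^ d + r) * (u l * x l ^ 1 + - c l)
      = sc \<kappa> (u l ^ d) * (sg l ^^ d) (u l) * x l ^ (d + 1) + t"
    by (rule top_mult[OF l ud u_in[OF l] *(2) neg_c_in_Fil[OF l]])
  have "y l ^ Suc d = y l ^ d * y l" by (simp only: power_Suc2)
  also have "\<dots> = (sc \<kappa> (u l ^ d) * x l ^ d + r) * (u l * x l ^ 1 + - c l)"
    unfolding *(3) by (simp only: y_top[of l])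
  also have "\<dots> = sc (\<kappa> * (q powi s) ^ d) (u l ^ Suc d) * x l ^ Suc d + t"
    unfolding t(2) pow by (simp add: power_commutes)
  finally show ?case using t(1) *(1) q_nonzero
    by (intro exI[of _ "\<kappa> * (q powi s) ^ d"] exI[of _ t]) simp
qed

text \<open>The coefficients of \<open>v\<close> beyond degree \<open>d\<close> are annihilated by
  \<open>h\<close>. Since \<open>h = 0\<close> is allowed, these coefficients need not vanish, so
  the conclusion concerns \<open>h * v\<close> rather than \<open>v\<close>.\<close>

lemma Fil_div:
  assumes l: "l \<in> {1..N}" and h: "h \<in> R (l - 1)" and v: "v \<in> R l" "h * v \<in> Fil l (Suc d)"
  shows "\<exists>g\<in>R (l - 1). \<exists>r\<in>Fil l d. h * v = (h * g) * x l ^ d + h * r"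
proof -
  have "\<exists>g\<in>R (l - 1). \<exists>r\<in>Fil l d. h * v = (h * g) * x l ^ d + h * r" if "v \<in> Fil l (Suc d + e)" for e
    using that v(2)
  proof (induction e arbitrary: v)
    case 0
    then obtain g r where "g \<in> R (l - 1)" "r \<in> Fil l d" "v = g * x l ^ d + r"
      using Fil_SucE[of v l d] by auto
    then show ?case by (intro bexI[of _ g] bexI[of _ r]) (simp_all add: algebra_simps)
  next
    case (Suc e)
    let ?e = "Suc d + e"
    obtain g r where g: "g \<in> R (l - 1)" "r \<in> Fil l ?e" "v = g * x l ^ ?e + r"
      using Fil_SucE[of v l ?e] Suc.prems(1) by auto
    have hr: "h * r \<in> Fil l ?e" by (rule Fil_lmult[OF h g(2)])
    have "(h * g) * x l ^ ?e = h * v - h * r" using g(3) by (simp add: algebra_simps)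
    moreover have "h * v \<in> Fil l ?e" using Suc.prems(2) Fil_mono[of "Suc d" ?e l] by auto
    ultimately have "(h * g) * x l ^ ?e \<in> Fil l ?e" using Fil_diff hr by metis
    then have "h * g = 0" using Fil_top_eq_0[OF l R_mult[OF h g(1)]] by blast
    then have "h * v = h * r" using g(3) by (simp add: distrib_left flip: mult.assoc)
    then show ?case using Suc.IH[OF g(2)] Suc.prems(2) by simp
  qed
  moreover obtain e where "v \<in> Fil l e" using v R_eq_Fil[OF l] by auto
  then have "v \<in> Fil l (Suc d + e)" using Fil_mono[of e "Suc d + e" l] by auto
  ultimately show ?thesis by blast
qed

text \<open>Among the monomials with the highest power \<open>y l ^ D\<close>, comparing
  coefficients of \<open>x l ^ D\<close> gives a relation one level lower, with
  \<open>u l ^ D\<close> in place of \<open>y l ^ D\<close>. The condition on the predecessor of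
  \<open>l\<close> guarantees that no power of \<open>y k\<close> appears in this way. Monomials
  with a lower power of \<open>y l\<close> are handled by induction on \<open>D\<close>.\<close>

lemma y_indep_step:
  assumes l: "l \<in> {1..N}" and h: "h \<in> R (l - 1)" and k: "k < l" "pred_idx \<mu> l \<noteq> Some k"
    and IH: "y_indep (l - 1) k h"
  shows "y_indep l k h"
proof -
  have main: "\<forall>m\<in>F. d m = 0"
    if "finite F" "F \<subseteq> nexps l" "\<forall>m\<in>F. m k = 0" "\<forall>m\<in>F. m l < D"
      "(\<Sum>m\<in>F. sc (d m) (omon y N m)) \<in> mults (R l) h" for F d D
    using that
  proof (induction D arbitrary: F)
    case (Suc D)
    define F1 where "F1 = {m \<in> F. m l = D}"
    define F2 where "F2 = {m \<in> F. m l < D}"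
    have F: "F = F1 \<union> F2" "F1 \<inter> F2 = {}" "finite F1" "finite F2"
      using Suc.prems unfolding F1_def F2_def by (auto simp: less_Suc_eq)
    let ?S = "\<lambda>G. \<Sum>m\<in>G. sc (d m) (omon y N m)"
    have SF: "?S F = ?S F1 + ?S F2" using F by (simp add: sum.union_disjoint)
    have lower: "omon y N (m(l := 0)) \<in> R (l - 1)" if "m \<in> F" for m
      using omon_y_in[OF nexps_upd_0] Suc.prems(2) that l by fastforce
    have yFil: "y l ^ e \<in> Fil l (Suc e)" for e
    proof -
      obtain \<kappa> r where "r \<in> Fil l e" "y l ^ e = sc \<kappa> (u l ^ e) * x l ^ e + r"
        using y_power_top[OF l] by blast
      then show ?thesis using Fil_SucI R_sc R_power u_in[OF l] by metis
    qed
    have omonFil: "omon y N m \<in> Fil l (Suc (m l))" if "m \<in> F" for m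
      using omon_upd_last[of m l N y] Suc.prems(2) that l Fil_lmult[OF lower[OF that] yFil] by auto
    have sumFil: "(\<Sum>m\<in>G. sc (d m) (omon y N m)) \<in> Fil l e"
      if "finite G" "G \<subseteq> F" "\<forall>m\<in>G. m l < e" for G e
      using that
    proof (induction G rule: finite_induct)
      case (insert m G)
      have "omon y N m \<in> Fil l e" using omonFil[of m] insert.prems Fil_mono[of "Suc (m l)" e l] by auto
      then show ?case using insert by (auto intro!: Fil_add Fil_sc)
    qed (simp add: Fil_0_in)
    have S2: "?S F2 \<in> Fil l D" by (intro sumFil) (use F in \<open>auto simp: F2_def\<close>)
    obtain \<kappa> r where \<kappa>: "\<kappa> \<noteq> 0" "r \<in> Fil l D" "y l ^ D = sc \<kappa> (u l ^ D) * x l ^ D + r"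
      using y_power_top[OF l] by blast
    let ?G = "\<Sum>m\<in>F1. sc (d m) (omon y N (m(l := 0)))"
    have G: "?G \<in> R (l - 1)" by (intro R_sum R_sc lower) (auto simp: F1_def)
    have "?S F1 = (\<Sum>m\<in>F1. sc (d m) (omon y N (m(l := 0))) * y l ^ D)"
    proof (intro sum.cong refl)
      fix m assume "m \<in> F1"
      then have "m \<in> nexps l" "m l = D" using Suc.prems(2) by (auto simp: F1_def)
      then show "sc (d m) (omon y N m) = sc (d m) (omon y N (m(l := 0))) * y l ^ D"
        using omon_upd_last[of m l N y] l by simp
    qed
    then have "?S F1 = ?G * y l ^ D" unfolding sum_distrib_right .
    then have S1: "?S F1 = (?G * sc \<kappa> (u l ^ D)) * x l ^ D + ?G * r"
      unfolding \<kappa>(3) distrib_left mult.assoc .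
    have GR: "?G * sc \<kappa> (u l ^ D) \<in> R (l - 1)" by (intro R_mult R_sc R_power G u_in l)
    obtain v where v: "v \<in> R l" "?S F = h * v" using Suc.prems(5) unfolding mults_def by blast
    have "h * v \<in> Fil l (Suc D)" unfolding v(2)[symmetric]
      by (intro sumFil) (use Suc.prems in auto)
    then obtain g s where g: "g \<in> R (l - 1)" "s \<in> Fil l D" "h * v = (h * g) * x l ^ D + h * s"
      using Fil_div[OF l h v(1)] by blast
    have "(?G * sc \<kappa> (u l ^ D)) * x l ^ D + (?G * r + ?S F2) = (h * g) * x l ^ D + h * s"
      using SF S1 v(2) g(3) by (simp add: add.assoc)
    then have "?G * sc \<kappa> (u l ^ D) = h * g"
      using Fil_unique[OF l GR R_mult[OF h g(1)] Fil_add[OF Fil_lmult[OF G \<kappa>(2)] S2] Fil_lmult[OF h g(2)]] by blast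
    then have Gg: "(\<Sum>m\<in>F1. sc (d m * \<kappa>) (omon y N (m(l := 0)) * u l ^ D)) = h * g"
      by (simp add: sum_distrib_right V.scale_sum_right mult.commute)
    \<comment> \<open>The exponent \<open>D\<close> at \<open>l\<close> moves to the predecessor of
      \<open>l\<close>, if there is one. This is injective on \<open>F1\<close>, where all exponents
      at \<open>l\<close> equal \<open>D\<close>.\<close>
    define \<phi> where "\<phi> m = (case pred_idx \<mu> l of None \<Rightarrow> m(l := 0)
      | Some p \<Rightarrow> (m(l := 0))(p := m p + D))" for m :: "nat \<Rightarrow> nat"
    have \<phi>: "\<exists>t. omon y N (m(l := 0)) * u l ^ D = sc (q powi t) (omon y N (\<phi> m))" for m
    proof (cases "pred_idx \<mu> l")
      case None then show ?thesis by (intro exI[of _ 0]) (simp add: \<phi>_def u_def)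
    next
      case (Some p)
      then show ?thesis using omon_times_power[of p "m(l := 0)" D] pred_in[OF l Some]
        by (simp add: \<phi>_def u_def)
    qed
    then obtain t where t: "omon y N (m(l := 0)) * u l ^ D = sc (q powi t m) (omon y N (\<phi> m))" for m
      by metis
    have inj: "inj_on \<phi> F1"
    proof (rule inj_onI)
      fix m m' assume m: "m \<in> F1" "m' \<in> F1" "\<phi> m = \<phi> m'"
      show "m = m'"
      proof
        fix j
        have "m l = m' l" using m by (simp add: F1_def)
        moreover have "\<phi> m j = \<phi> m' j" using m by simp
        ultimately show "m j = m' j" unfolding \<phi>_def by (auto split: option.splits if_splits)
      qed
    qed
    define \<psi> where "\<psi> = the_inv_into F1 \<phi>"
    have \<psi>: "\<psi> (\<phi> m) = m" if "m \<in> F1" for m unfolding \<psi>_def by (rule the_inv_into_f_f[OF inj that])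
    let ?d = "\<lambda>m. d (\<psi> m) * \<kappa> * q powi t (\<psi> m)"
    have "(\<Sum>m\<in>\<phi> ` F1. sc (?d m) (omon y N m)) = h * g"
      unfolding Gg[symmetric] using \<psi> t by (simp add: sum.reindex[OF inj])
    then have in_mults: "(\<Sum>m\<in>\<phi> ` F1. sc (?d m) (omon y N m)) \<in> mults (R (l - 1)) h"
      using multsI[OF g(1)] by metis
    have fin: "finite (\<phi> ` F1)" using F by simp
    have "\<phi> m \<in> nexps (l - 1)" if "m \<in> F1" for m
    proof -
      have "m(l := 0) \<in> nexps (l - 1)" using nexps_upd_0 Suc.prems(2) that by (auto simp: F1_def)
      then have *: "j \<in> {1..l - 1}" if "(m(l := 0)) j \<noteq> 0" for j using that unfolding nexps_def by blast
      have "j \<in> {1..l - 1}" if "\<phi> m j \<noteq> 0" for j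
      proof (cases "pred_idx \<mu> l = Some j")
        case True then show ?thesis using pred_idx_SomeD[OF True] by auto
      next
        case False
        then have "(m(l := 0)) j \<noteq> 0" using that unfolding \<phi>_def by (auto split: option.splits if_splits)
        then show ?thesis by (rule *)
      qed
      then show ?thesis unfolding nexps_def by blast
    qed
    then have sub: "\<phi> ` F1 \<subseteq> nexps (l - 1)" by (rule image_subsetI)
    have \<phi>k: "\<phi> m k = 0" if "m \<in> F1" for m
      using that Suc.prems(3) k unfolding \<phi>_def F1_def by (auto split: option.splits)
    have "\<forall>m\<in>\<phi> ` F1. m k = 0" by (rule ballI, erule imageE) (simp only: \<phi>k)
    then have "\<forall>m\<in>\<phi> ` F1. ?d m = 0"
      using IH[unfolded y_indep_def, THEN spec, THEN spec, THEN mp, THEN mp, THEN mp, THEN mp, OF fin sub _ in_mults]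
      by simp
    then have d1: "d m = 0" if "m \<in> F1" for m using that \<psi> \<kappa>(1) q_nonzero by simp
    then have "?S F = ?S F2" unfolding SF by simp
    then have "?S F2 \<in> mults (R l) h" using Suc.prems(5) by simp
    moreover have "F2 \<subseteq> F" "\<forall>m\<in>F2. m l < D" by (auto simp: F2_def)
    ultimately have d2: "\<forall>m\<in>F2. d m = 0"
      using Suc.prems(2,3) by (intro Suc.IH[OF F(4)]) auto
    show ?case unfolding F(1) using d1 d2 by blast
  qed auto
  show ?thesis unfolding y_indep_def
  proof (intro allI impI)
    fix F d assume F: "finite F" "F \<subseteq> nexps l" "\<forall>m\<in>F. m k = 0"
      "(\<Sum>m\<in>F. sc (d m) (omon y N m)) \<in> mults (R l) h"
    have "\<forall>m\<in>F. m l < Suc (\<Sum>m\<in>F. m l)"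
      using member_le_sum[of _ F "\<lambda>m. m l"] F(1) by (simp add: less_Suc_eq_le)
    then show "\<forall>m\<in>F. d m = 0" using main[OF F(1-3) _ F(4)] by blast
  qed
qed

lemma y_independent: "l \<le> N \<Longrightarrow> y_indep l 0 0"
proof (induction l)
  case 0
  have nexps0: "nexps 0 = {\<lambda>_. 0}" unfolding nexps_def by auto
  have "d m = 0" if "F \<subseteq> nexps 0" "(\<Sum>m\<in>F. sc (d m) (omon y N m)) \<in> mults (R 0) 0" "m \<in> F"
    for F m and d :: "(nat \<Rightarrow> nat) \<Rightarrow> 'k"
  proof -
    have F: "F = {m}" "m = (\<lambda>_. 0)" using that nexps0 by auto
    have "omon y N (\<lambda>_. 0) = 1" unfolding omon_def using oprod_stop[of 0 N "\<lambda>_. 1"] by simp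
    then have "sc (d m) 1 = 0" using that(2) F by (auto simp: mults_def)
    then show ?thesis using one_nonzero by simp
  qed
  then show ?case unfolding y_indep_def by blast
next
  case (Suc l)
  have "pred_idx \<mu> (Suc l) \<noteq> Some 0" using pred_idx_SomeD(1)[of \<mu> "Suc l" 0] by auto
  then show ?case using Suc by (intro y_indep_step[of "Suc l"]) (auto simp: R_0_in)
qed

text \<open>At level \<open>k\<close> monomials without \<open>y k\<close> lie in
  \<open>R (k - 1)\<close>, where the only right multiple of \<open>y k\<close> is 0, so plain
  independence applies. As \<open>k\<close> has no successor, it is nobody's predecessor and
  \<open>y_indep_step\<close> lifts the statement to level \<open>N\<close>.\<close>

lemma y_monomials_not_multiple:
  assumes k: "k \<in> s_infty N \<mu>"
    and F: "finite F" "F \<subseteq> nexps N" "\<And>m. m \<in> F \<Longrightarrow> m k = 0"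
    and eq: "(\<Sum>m\<in>F. sc (d m) (omon y N m)) = y k * v" and "m \<in> F"
  shows "d m = 0"
proof -
  have kN: "k \<in> {1..N}" and no_succ: "\<And>j. k < j \<Longrightarrow> j \<le> N \<Longrightarrow> \<mu> j \<noteq> \<mu> k"
    using k unfolding s_infty_def succ_idx_None_iff by auto
  have base: "y_indep k k (y k)" unfolding y_indep_def
  proof (intro allI impI)
    fix F d assume F: "finite F" "F \<subseteq> nexps k" "\<forall>m\<in>F. m k = 0"
      "(\<Sum>m\<in>F. sc (d m) (omon y N m)) \<in> mults (R k) (y k)"
    have "F \<subseteq> nexps (k - 1)"
    proof
      fix m assume m: "m \<in> F"
      then have "m = m(k := 0)" using F(3) by (simp add: fun_upd_idem)
      then show "m \<in> nexps (k - 1)" using nexps_upd_0[of m k] F(2) m by auto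
    qed
    moreover obtain v where v: "v \<in> R k" "(\<Sum>m\<in>F. sc (d m) (omon y N m)) = y k * v"
      using F(4) unfolding mults_def by blast
    moreover have "(\<Sum>m\<in>F. sc (d m) (omon y N m)) \<in> R (k - 1)"
      using \<open>F \<subseteq> nexps (k - 1)\<close> kN by (intro R_sum R_sc omon_y_in) auto
    then have "v = 0" using y_shift_R[OF kN v(1)] v(2) by simp
    ultimately have "(\<Sum>m\<in>F. sc (d m) (omon y N m)) \<in> mults (R (k - 1)) 0"
      using multsI[OF R_0_in] by force
    moreover have "m 0 = 0" if "m \<in> F" for m using that F(2) unfolding nexps_def by force
    ultimately show "\<forall>m\<in>F. d m = 0"
      using y_independent[of "k - 1"] kN F(1) \<open>F \<subseteq> nexps (k - 1)\<close> unfolding y_indep_def by auto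
  qed
  have "y_indep l k (y k)" if "k \<le> l" "l \<le> N" for l
    using that
  proof (induction l rule: dec_induct)
    case base show ?case by fact
  next
    case (step l)
    have "pred_idx \<mu> (Suc l) \<noteq> Some k"
      using no_succ[of "Suc l"] pred_idx_SomeD(3)[of \<mu> "Suc l" k] step by force
    then show ?case using step y_in[OF kN, of l] by (intro y_indep_step[of "Suc l"]) auto
  qed
  then have "y_indep N k (y k)" using kN by auto
  moreover have "(\<Sum>m\<in>F. sc (d m) (omon y N m)) \<in> mults (R N) (y k)"
    unfolding eq R_N by (rule multsI) simp
  ultimately show ?thesis using F \<open>m \<in> F\<close> unfolding y_indep_def by blast
qed

end

section \<open>Partial localizations\<close>

lemma zexps_add: "m \<in> zexps l \<Longrightarrow> m' \<in> zexps l \<Longrightarrow> (\<lambda>j. m j + m' j) \<in> zexps l"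
proof -
  assume m: "m \<in> zexps l" "m' \<in> zexps l"
  have "j \<in> {1..l}" if "m j + m' j \<noteq> 0" for j
  proof -
    have "m j \<noteq> 0 \<or> m' j \<noteq> 0" using that by auto
    then show ?thesis using m unfolding zexps_def by blast
  qed
  then show ?thesis unfolding zexps_def by blast
qed

lemma nexps_add: "m \<in> nexps l \<Longrightarrow> m' \<in> nexps l \<Longrightarrow> (\<lambda>j. m j + m' j) \<in> nexps l"
proof -
  assume m: "m \<in> nexps l" "m' \<in> nexps l"
  have "j \<in> {1..l}" if "m j + m' j \<noteq> 0" for j
  proof -
    have "m j \<noteq> 0 \<or> m' j \<noteq> 0" using that by auto
    then show ?thesis using m unfolding nexps_def by blast
  qed
  then show ?thesis unfolding nexps_def by blast
qed

lemma single_nexps: "i \<in> {1..l} \<Longrightarrow> (\<lambda>j. if j = i then d else 0) \<in> nexps l"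
  unfolding nexps_def by simp

lemma single_zexps: "i \<in> {1..l} \<Longrightarrow> (\<lambda>j. if j = i then d else 0) \<in> zexps l"
  unfolding zexps_def by simp

context torus_tower
begin

abbreviation MN :: "(nat \<Rightarrow> nat) \<Rightarrow> 't" where "MN \<alpha> \<equiv> M (\<lambda>j. int (\<alpha> j))"

lemma M_cong: "(\<And>j. j \<in> {1..N} \<Longrightarrow> m j = m' j) \<Longrightarrow> M m = M m'"
  unfolding Q.M_def by (intro oprod_cong) simp

lemma M_nonneg: "(\<And>j. j \<in> {1..N} \<Longrightarrow> 0 \<le> m j) \<Longrightarrow> M m = \<iota> (omon y N (\<lambda>j. nat (m j)))"
  unfolding \<iota>_omon by (intro M_cong) simp

lemma range_\<iota>:
  shows range_diff: "s \<in> range \<iota> \<Longrightarrow> t \<in> range \<iota> \<Longrightarrow> s - t \<in> range \<iota>"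
    and range_add: "s \<in> range \<iota> \<Longrightarrow> t \<in> range \<iota> \<Longrightarrow> s + t \<in> range \<iota>"
    and range_mult: "s \<in> range \<iota> \<Longrightarrow> t \<in> range \<iota> \<Longrightarrow> s * t \<in> range \<iota>"
    and range_sc: "s \<in> range \<iota> \<Longrightarrow> T.sc d s \<in> range \<iota>"
  by (auto simp flip: \<iota>_diff \<iota>_add \<iota>_mult \<iota>_sc)

lemma range_sum: "(\<And>i. i \<in> F \<Longrightarrow> f i \<in> range \<iota>) \<Longrightarrow> sum f F \<in> range \<iota>"
  using \<iota>_0 by (induction F rule: infinite_finite_induct) (auto intro: range_add range_eqI[of _ _ 0])

lemma range_qeq: "s \<approx> t \<Longrightarrow> t \<in> range \<iota> \<Longrightarrow> s \<in> range \<iota>"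
  unfolding Q.qeq_def using range_sc by auto

lemma M_nonneg_in: "(\<And>j. j \<in> {1..N} \<Longrightarrow> 0 \<le> m j) \<Longrightarrow> M m \<in> range \<iota>"
  by (subst M_nonneg) auto

section \<open>The torus as the span of Laurent monomials\<close>

definition laurent_span :: "'t set" where "laurent_span = T.V.span (M ` zexps N)"

lemma M_in_laurent_span: "m \<in> zexps N \<Longrightarrow> M m \<in> laurent_span"
  unfolding laurent_span_def by (intro T.V.span_base) blast

lemma laurent_span_qeq: "s \<approx> t \<Longrightarrow> t \<in> laurent_span \<Longrightarrow> s \<in> laurent_span"
  unfolding Q.qeq_def laurent_span_def using T.V.span_scale by blast

lemma laurent_span_mult:
  assumes "s \<in> laurent_span" "t \<in> laurent_span"
  shows "s * t \<in> laurent_span"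
proof -
  have *: "M m * t \<in> laurent_span" if m: "m \<in> zexps N" for m
  proof -
    have "T.V.span (M ` zexps N) \<subseteq> {t. M m * t \<in> laurent_span}"
    proof (rule T.V.span_minimal)
      show "M ` zexps N \<subseteq> {t. M m * t \<in> laurent_span}"
        using laurent_span_qeq[OF Q.M_mult M_in_laurent_span] zexps_add[OF m] by blast
      show "T.V.subspace {t. M m * t \<in> laurent_span}"
        unfolding T.V.subspace_def laurent_span_def
        by (auto simp: distrib_left T.V.span_zero intro: T.V.span_add T.V.span_scale)
    qed
    then show ?thesis using assms(2) unfolding laurent_span_def by blast
  qed
  have "T.V.span (M ` zexps N) \<subseteq> {s. s * t \<in> laurent_span}"
  proof (rule T.V.span_minimal)
    show "M ` zexps N \<subseteq> {s. s * t \<in> laurent_span}" using * by blast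
    show "T.V.subspace {s. s * t \<in> laurent_span}"
      unfolding T.V.subspace_def laurent_span_def
      by (auto simp: distrib_right T.V.span_zero intro: T.V.span_add T.V.span_scale)
  qed
  then show ?thesis using assms(1) unfolding laurent_span_def by blast
qed

lemma laurent_span_add: "s \<in> laurent_span \<Longrightarrow> t \<in> laurent_span \<Longrightarrow> s + t \<in> laurent_span"
  unfolding laurent_span_def by (rule T.V.span_add)

lemma one_in_laurent_span: "1 \<in> laurent_span"
  using M_in_laurent_span[of "\<lambda>_. 0"] by (simp add: Q.M_0 zexps_def)

lemma laurent_span_sc: "t \<in> laurent_span \<Longrightarrow> T.sc d t \<in> laurent_span"
  unfolding laurent_span_def by (rule T.V.span_scale)

lemma Y_in_laurent_span: "i \<in> {1..N} \<Longrightarrow> \<iota> (y i) \<in> laurent_span" "i \<in> {1..N} \<Longrightarrow> rinv (\<iota> (y i)) \<in> laurent_span"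
  using M_in_laurent_span[OF single_zexps, of i 1] M_in_laurent_span[OF single_zexps, of i "-1"]
  by (auto simp: Q.M_single ipow_def)

text \<open>Over the torus \<open>x l\<close> is the inverse of \<open>y p\<close> times
  \<open>y l + c l\<close>, and \<open>c l\<close> comes from the level below.\<close>

lemma \<iota>_in_laurent_span: "l \<le> N \<Longrightarrow> r \<in> R l \<Longrightarrow> \<iota> r \<in> laurent_span"
proof (induction l arbitrary: r)
  case 0
  then obtain d where "r = emb d" using R_0 by auto
  then have "\<iota> r = T.sc d 1" by (simp only: T.sc_def mult_1_right)
  then show ?case using laurent_span_sc[OF one_in_laurent_span] by (simp only:)
next
  case (Suc l)
  have i: "Suc l \<in> {1..N}" using Suc.prems by auto
  have cl: "\<iota> (c (Suc l)) \<in> laurent_span" using Suc.IH[of "c (Suc l)"] c_in[OF i] Suc.prems by simp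
  have xl: "\<iota> (x (Suc l)) \<in> laurent_span"
  proof (cases "pred_idx \<mu> (Suc l)")
    case None
    then show ?thesis using Y_in_laurent_span(1)[OF i] y_eq_x[OF i] by simp
  next
    case (Some p)
    then have p: "p \<in> {1..N}" using pred_in[OF i] by blast
    have "y (Suc l) + c (Suc l) = y p * x (Suc l)" using y_eq[of "Suc l"] u_eq[OF i Some] by simp
    then have "\<iota> (y p) * \<iota> (x (Suc l)) = \<iota> (y (Suc l)) + \<iota> (c (Suc l))" by (simp flip: \<iota>_mult \<iota>_add)
    then have "\<iota> (x (Suc l)) = rinv (\<iota> (y p)) * (\<iota> (y (Suc l)) + \<iota> (c (Suc l)))"
      using rinv_unit(1)[OF \<iota>_unit[OF p]] by (metis mult.assoc mult_1)
    then show ?thesis using Y_in_laurent_span p i cl laurent_span_add laurent_span_mult by metis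
  qed
  have "\<iota> r \<in> laurent_span" if "r \<in> subalg emb (x ` {1..Suc l})" for r
    using that
  proof induction
    case (scal d)
    have "\<iota> (emb d) = T.sc d 1" by (simp only: T.sc_def mult_1_right)
    then show ?case using laurent_span_sc[OF one_in_laurent_span] by (simp only:)
  next
    case (gen s)
    then obtain j where j: "j \<in> {1..Suc l}" "s = x j" by blast
    show ?case
    proof (cases "j = Suc l")
      case False
      then have "x j \<in> R l" using j by (intro x_in_R) auto
      then show ?thesis using Suc.IH Suc.prems j by auto
    qed (use xl j in simp)
  next
    case (add a b) then show ?case by (simp add: \<iota>_add laurent_span_add)
  next
    case (mult a b) then show ?case by (simp add: \<iota>_mult laurent_span_mult)
  next
    case (neg a)
    then have "T.sc (-1) (\<iota> a) \<in> laurent_span" by (intro laurent_span_sc)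
    then show ?case by (simp add: \<iota>_neg)
  qed
  then show ?case using Suc.prems unfolding Rsub_def by blast
qed

lemma T_eq_laurent_span: "t \<in> laurent_span"
proof -
  obtain r m where rm: "m \<in> nexps N" "t * \<iota> (omon y N m) = \<iota> r" using \<iota>_frac by blast
  have m: "(\<lambda>j. - int (m j)) \<in> zexps N" using rm(1) unfolding nexps_def zexps_def by simp
  have "M (\<lambda>j. int (m j)) * M (\<lambda>j. - int (m j)) \<approx> 1"
    using Q.M_mult[of "\<lambda>j. int (m j)" "\<lambda>j. - int (m j)"] by (simp add: Q.M_0)
  then have "t * (M (\<lambda>j. int (m j)) * M (\<lambda>j. - int (m j))) \<approx> t * 1"
    by (intro Q.qeq_mult Q.qeq_refl)
  then have "t * (M (\<lambda>j. int (m j)) * M (\<lambda>j. - int (m j))) \<approx> t" by simp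
  moreover have "\<iota> r * M (\<lambda>j. - int (m j)) = t * (M (\<lambda>j. int (m j)) * M (\<lambda>j. - int (m j)))"
    unfolding rm(2)[symmetric] \<iota>_omon by (rule mult.assoc)
  ultimately have "t \<approx> \<iota> r * M (\<lambda>j. - int (m j))" by (simp only: Q.qeq_sym)
  moreover have "\<iota> r * M (\<lambda>j. - int (m j)) \<in> laurent_span"
    using \<iota>_in_laurent_span[of N r] M_in_laurent_span[OF m] by (intro laurent_span_mult) (simp_all add: R_N)
  ultimately show ?thesis by (rule laurent_span_qeq)
qed

section \<open>Laurent polynomials in terms of their coefficients\<close>

definition comb :: "(nat \<Rightarrow> int) set \<Rightarrow> ((nat \<Rightarrow> int) \<Rightarrow> 'k) \<Rightarrow> 't" where
  "comb F d = (\<Sum>m\<in>F. T.sc (d m) (M m))"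

lemma T_comb:
  obtains F d where "finite F" "F \<subseteq> zexps N" "t = comb F d"
proof -
  have "t \<in> T.V.span (M ` zexps N)" using T_eq_laurent_span unfolding laurent_span_def .
  then obtain U r where U: "finite U" "U \<subseteq> M ` zexps N" "t = (\<Sum>a\<in>U. T.sc (r a) a)"
    unfolding T.V.span_explicit by auto
  then obtain F where F: "F \<subseteq> zexps N" "inj_on M F" "U = M ` F" by (auto simp: subset_image_inj)
  then have "finite F" using U(1) finite_imageD by blast
  moreover have "t = comb F (\<lambda>m. r (M m))" using U(3) F by (simp add: comb_def sum.reindex)
  ultimately show ?thesis using that F by blast
qed

lemma comb_extend:
  assumes "finite G" "F \<subseteq> G"
  shows "comb F d = comb G (\<lambda>m. if m \<in> F then d m else 0)"
proof -
  have "comb G (\<lambda>m. if m \<in> F then d m else 0) = (\<Sum>m\<in>F. T.sc (if m \<in> F then d m else 0) (M m))"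
    unfolding comb_def using assms by (intro sum.mono_neutral_right) auto
  then show ?thesis by (simp add: comb_def)
qed

lemma clear_denominators:
  assumes F: "finite F" "F \<subseteq> zexps N" and \<alpha>: "\<alpha> \<in> nexps N"
    and nonneg: "\<forall>m\<in>F. \<forall>j. 0 \<le> int (\<alpha> j) + m j"
  shows "\<exists>g k. inj_on g F \<and> g ` F \<subseteq> nexps N \<and> (\<forall>m\<in>F. \<forall>j. int (g m j) = int (\<alpha> j) + m j) \<and>
    (\<forall>d. MN \<alpha> * comb F d = \<iota> (\<Sum>m\<in>F. sc (d m * q powi k m) (omon y N (g m))))"
proof -
  define g where "g m = (\<lambda>j. nat (int (\<alpha> j) + m j))" for m
  have g: "int (g m j) = int (\<alpha> j) + m j" if "m \<in> F" for m j using nonneg that by (simp add: g_def)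
  have inj: "inj_on g F"
  proof (rule inj_onI, rule ext)
    fix m m' j assume "m \<in> F" "m' \<in> F" "g m = g m'"
    then show "m j = m' j" using g[of m j] g[of m' j] by simp
  qed
  have "g m \<in> nexps N" if "m \<in> F" for m
  proof -
    have "j \<in> {1..N}" if "g m j \<noteq> 0" for j
    proof (rule ccontr)
      assume "j \<notin> {1..N}"
      then have "\<alpha> j = 0" "m j = 0" using \<alpha> F(2) \<open>m \<in> F\<close> unfolding nexps_def zexps_def by blast+
      then show False using that by (simp add: g_def)
    qed
    then show ?thesis unfolding nexps_def by blast
  qed
  moreover have "\<exists>k. MN \<alpha> * M m = T.sc (q powi k) (\<iota> (omon y N (g m)))" if "m \<in> F" for m
    using Q.M_mult[of "\<lambda>j. int (\<alpha> j)" m] g[OF that] unfolding Q.qeq_def \<iota>_omon by simp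
  then obtain k where k: "\<And>m. m \<in> F \<Longrightarrow> MN \<alpha> * M m = T.sc (q powi k m) (\<iota> (omon y N (g m)))" by metis
  have "MN \<alpha> * comb F d = \<iota> (\<Sum>m\<in>F. sc (d m * q powi k m) (omon y N (g m)))" for d
    by (simp add: comb_def sum_distrib_left \<iota>_sum \<iota>_sc k)
  ultimately show ?thesis using inj g by blast
qed

lemma denominators_exist:
  assumes "finite F" "F \<subseteq> zexps N"
  shows "\<exists>\<alpha>\<in>nexps N. \<forall>m\<in>F. \<forall>j. 0 \<le> int (\<alpha> j) + m j"
proof (intro bexI ballI allI)
  let ?\<alpha> = "\<lambda>j. \<Sum>m\<in>F. nat \<bar>m j\<bar>"
  have "j \<in> {1..N}" if \<alpha>j: "?\<alpha> j \<noteq> 0" for j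
  proof (rule ccontr)
    assume "j \<notin> {1..N}"
    then have "m j = 0" if "m \<in> F" for m using that assms(2) unfolding zexps_def by blast
    then have "?\<alpha> j = 0" by (intro sum.neutral) simp
    then show False using \<alpha>j by simp
  qed
  then show "?\<alpha> \<in> nexps N" unfolding nexps_def by (intro CollectI allI impI)
  show "0 \<le> int (?\<alpha> j) + m j" if "m \<in> F" for m j
  proof -
    have "nat \<bar>m j\<bar> \<le> ?\<alpha> j" by (rule member_le_sum) (use that assms(1) in auto)
    then show ?thesis by linarith
  qed
qed

lemma y_indepD:
  assumes "y_indep l k h" "finite F" "F \<subseteq> nexps l" "\<forall>m\<in>F. m k = 0"
    "(\<Sum>m\<in>F. sc (d m) (omon y N m)) \<in> mults (R l) h" "m \<in> F"
  shows "d m = 0"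
  using assms unfolding y_indep_def by blast

text \<open>After clearing denominators a relation becomes one between monomials with nonnegative
  exponents in \<open>R\<close>, where \<open>y_independent\<close> applies.\<close>

lemma M_independent:
  assumes F: "finite F" "F \<subseteq> zexps N" and eq: "comb F d = 0" and "m \<in> F"
  shows "d m = 0"
proof -
  obtain \<alpha> where \<alpha>: "\<alpha> \<in> nexps N" "\<forall>m\<in>F. \<forall>j. 0 \<le> int (\<alpha> j) + m j"
    using denominators_exist[OF F] by blast
  obtain g k where g: "inj_on g F" "g ` F \<subseteq> nexps N"
    "\<And>d. MN \<alpha> * comb F d = \<iota> (\<Sum>m\<in>F. sc (d m * q powi k m) (omon y N (g m)))"
    using clear_denominators[OF F \<alpha>] by blast
  define \<psi> where "\<psi> = the_inv_into F g"
  have \<psi>: "\<psi> (g m) = m" if "m \<in> F" for m unfolding \<psi>_def by (rule the_inv_into_f_f[OF g(1) that])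
  have "(\<Sum>m\<in>F. sc (d m * q powi k m) (omon y N (g m))) = 0"
    using g(3)[of d] eq \<iota>_0 \<iota>_inj by (metis mult_zero_right)
  then have "(\<Sum>m\<in>g ` F. sc (d (\<psi> m) * q powi k (\<psi> m)) (omon y N m)) = 0"
    using \<psi> by (simp add: sum.reindex[OF g(1)])
  then have "(\<Sum>m\<in>g ` F. sc (d (\<psi> m) * q powi k (\<psi> m)) (omon y N m)) \<in> mults (R N) 0"
    using multsI[OF R_0_in, of 0] by simp
  moreover have "\<forall>m\<in>g ` F. m 0 = 0" using g(2) unfolding nexps_def by force
  ultimately have "d (\<psi> (g m)) * q powi k (\<psi> (g m)) = 0"
    using F(1) g(2) \<open>m \<in> F\<close>
    by (intro y_indepD[OF y_independent[OF order_refl], where F = "g ` F" and d = "\<lambda>m. d (\<psi> m) * q powi k (\<psi> m)"])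
      simp_all
  then show ?thesis using \<psi> \<open>m \<in> F\<close> q_nonzero by simp
qed

lemma comb_eq_iff:
  assumes F: "finite F" "F \<subseteq> zexps N" and eq: "comb F d = comb F d'" and m: "m \<in> F"
  shows "d m = d' m"
proof -
  have "comb F (\<lambda>m. d m - d' m) = 0"
    using eq by (simp add: comb_def T.V.scale_left_diff_distrib sum_subtractf)
  then show ?thesis using M_independent[OF F _ m] by fastforce
qed

lemma center_iff: "t \<in> center \<longleftrightarrow> (\<forall>i\<in>{1..N}. \<iota> (y i) * t = t * \<iota> (y i))"
proof
  assume t: "\<forall>i\<in>{1..N}. \<iota> (y i) * t = t * \<iota> (y i)"
  have ipow: "t * ipow (\<iota> (y i)) k = ipow (\<iota> (y i)) k * t" if i: "i \<in> {1..N}" for i k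
    using T.ipow_q_commute[OF \<iota>_unit[OF i], of 1 t k] t i by simp
  have "t * oprod l (\<lambda>j. ipow (\<iota> (y j)) (m j)) = oprod l (\<lambda>j. ipow (\<iota> (y j)) (m j)) * t" if "l \<le> N" for l m
    using that
  proof (induction l)
    case (Suc l)
    have "t * (oprod l (\<lambda>j. ipow (\<iota> (y j)) (m j)) * ipow (\<iota> (y (Suc l))) (m (Suc l)))
        = oprod l (\<lambda>j. ipow (\<iota> (y j)) (m j)) * (t * ipow (\<iota> (y (Suc l))) (m (Suc l)))"
      using Suc by (simp flip: mult.assoc)
    also have "\<dots> = oprod l (\<lambda>j. ipow (\<iota> (y j)) (m j)) * ipow (\<iota> (y (Suc l))) (m (Suc l)) * t"
      using Suc.prems by (subst ipow) (simp_all add: mult.assoc)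
    finally show ?case by simp
  qed simp
  then have M: "t * M m = M m * t" for m unfolding Q.M_def by blast
  have "t * s = s * t" for s
  proof -
    obtain F d where "s = comb F d" by (rule T_comb)
    then show ?thesis by (simp add: comb_def sum_distrib_left sum_distrib_right M)
  qed
  then show "t \<in> center" unfolding center_def by blast
qed (auto simp: center_def)

text \<open>The denominators stand on the left, to match the left cancellation in
  \<open>y_left_cancel\<close>.\<close>

definition L :: "nat \<Rightarrow> 't set" where
  "L k = {t. \<exists>\<alpha>\<in>nexps N. \<alpha> k = 0 \<and> MN \<alpha> * t \<in> range \<iota>}"

lemma range_subset_L: "t \<in> range \<iota> \<Longrightarrow> t \<in> L k"
  unfolding L_def by (auto simp: Q.M_0 nexps_def intro!: exI[of _ "\<lambda>_. 0"])

lemma L_enlarge: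
  assumes "MN \<alpha> * t \<in> range \<iota>"
  shows "MN (\<lambda>j. \<alpha>' j + \<alpha> j) * t \<in> range \<iota>"
proof -
  have "MN (\<lambda>j. \<alpha>' j + \<alpha> j) * t \<approx> (MN \<alpha>' * MN \<alpha>) * t"
    using Q.qeq_sym[OF Q.M_mult[of "\<lambda>j. int (\<alpha>' j)" "\<lambda>j. int (\<alpha> j)"]] by (intro Q.qeq_mult Q.qeq_refl) simp
  moreover have "(MN \<alpha>' * MN \<alpha>) * t \<in> range \<iota>"
    unfolding mult.assoc by (intro range_mult assms M_nonneg_in) simp
  ultimately show ?thesis by (rule range_qeq)
qed

lemma L_diff: "s \<in> L k \<Longrightarrow> t \<in> L k \<Longrightarrow> s - t \<in> L k"
proof -
  assume "s \<in> L k" "t \<in> L k"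
  then obtain \<alpha> \<beta> where "\<alpha> \<in> nexps N" "\<alpha> k = 0" "MN \<alpha> * s \<in> range \<iota>"
    and "\<beta> \<in> nexps N" "\<beta> k = 0" "MN \<beta> * t \<in> range \<iota>" unfolding L_def by blast
  then have "MN (\<lambda>j. \<beta> j + \<alpha> j) * s \<in> range \<iota>" "MN (\<lambda>j. \<beta> j + \<alpha> j) * t \<in> range \<iota>"
    "(\<lambda>j. \<beta> j + \<alpha> j) \<in> nexps N" "\<beta> k + \<alpha> k = 0"
    using L_enlarge[of \<alpha> s \<beta>] L_enlarge[of \<beta> t \<alpha>] nexps_add by (simp_all add: add.commute)
  then show ?thesis unfolding L_def
    by (intro CollectI bexI[of _ "\<lambda>j. \<beta> j + \<alpha> j"]) (simp_all add: right_diff_distrib range_diff)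
qed

lemma L_sc: "t \<in> L k \<Longrightarrow> T.sc d t \<in> L k"
  unfolding L_def by (auto intro: range_sc)

lemma L_0: "0 \<in> L k"
  using range_subset_L[of 0 k] \<iota>_0 by (metis rangeI)

lemma L_add: "s \<in> L k \<Longrightarrow> t \<in> L k \<Longrightarrow> s + t \<in> L k"
  using L_diff[of s k "0 - t"] L_diff[OF L_0, of t k] by simp

lemma L_sum: "(\<And>i. i \<in> F \<Longrightarrow> f i \<in> L k) \<Longrightarrow> sum f F \<in> L k"
  by (induction F rule: infinite_finite_induct) (auto intro: L_add L_0)

lemma L_right: "t \<in> L k \<Longrightarrow> t * \<iota> r \<in> L k"
proof -
  assume "t \<in> L k"
  then obtain \<alpha> where "\<alpha> \<in> nexps N" "\<alpha> k = 0" "MN \<alpha> * t \<in> range \<iota>" unfolding L_def by blast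
  moreover from this have "MN \<alpha> * t * \<iota> r \<in> range \<iota>" by (intro range_mult[of "MN \<alpha> * t"] rangeI)
  then have "MN \<alpha> * (t * \<iota> r) \<in> range \<iota>" by (simp only: mult.assoc)
  ultimately show ?thesis unfolding L_def by blast
qed

text \<open>Unlike multiplication on the right, multiplication on the left must pass the
  denominator; \<open>y i\<close> does so up to a power of \<open>q\<close>.\<close>

lemma L_left:
  assumes i: "i \<in> {1..N}" and t: "t \<in> L k"
  shows "\<iota> (y i) * t \<in> L k"
proof -
  obtain \<alpha> where \<alpha>: "\<alpha> \<in> nexps N" "\<alpha> k = 0" "MN \<alpha> * t \<in> range \<iota>" using t unfolding L_def by blast
  have "\<iota> (y i) * MN \<alpha> \<approx> MN \<alpha> * \<iota> (y i)"
    unfolding Q.qeq_def using Q.Y_M[OF i] by blast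
  then have "MN \<alpha> * \<iota> (y i) * t \<approx> \<iota> (y i) * MN \<alpha> * t" by (intro Q.qeq_mult[OF Q.qeq_sym Q.qeq_refl])
  moreover have "\<iota> (y i) * (MN \<alpha> * t) \<in> range \<iota>" by (rule range_mult[OF rangeI \<alpha>(3)])
  ultimately have "MN \<alpha> * (\<iota> (y i) * t) \<in> range \<iota>" using range_qeq by (simp only: mult.assoc)
  then show ?thesis unfolding L_def using \<alpha> by blast
qed

lemma L_cancel_left:
  assumes i: "i \<in> {1..N}" "i \<noteq> k" and t: "\<iota> (y i) ^ s * t \<in> L k"
  shows "t \<in> L k"
proof -
  obtain \<alpha> where \<alpha>: "\<alpha> \<in> nexps N" "\<alpha> k = 0" "MN \<alpha> * (\<iota> (y i) ^ s * t) \<in> range \<iota>"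
    using t unfolding L_def by blast
  let ?\<beta> = "\<lambda>j. \<alpha> j + (if j = i then s else 0)"
  have "MN (\<lambda>j. if j = i then s else 0) = \<iota> (y i) ^ s"
    using Q.M_single[OF i(1), of "int s"] by (simp add: ipow_nat if_distrib[of int] cong: if_cong)
  then have "MN \<alpha> * \<iota> (y i) ^ s \<approx> MN ?\<beta>"
    using Q.M_mult[of "\<lambda>j. int (\<alpha> j)" "\<lambda>j. int (if j = i then s else 0)"] by simp
  then have "MN ?\<beta> * t \<approx> MN \<alpha> * \<iota> (y i) ^ s * t" by (rule Q.qeq_mult[OF Q.qeq_sym Q.qeq_refl])
  then have "MN ?\<beta> * t \<in> range \<iota>" using range_qeq \<alpha>(3) by (simp add: mult.assoc)
  moreover have "?\<beta> \<in> nexps N" by (intro nexps_add \<alpha> single_nexps i)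
  ultimately show ?thesis unfolding L_def using \<alpha>(2) i(2)
    by (intro CollectI bexI[of _ ?\<beta>]) auto
qed

lemma M_in_L:
  assumes "m \<in> zexps N" "0 \<le> m k"
  shows "M m \<in> L k"
proof -
  let ?\<alpha> = "\<lambda>j. nat (- m j)"
  have "MN ?\<alpha> * M m \<approx> M (\<lambda>j. int (?\<alpha> j) + m j)" by (rule Q.M_mult)
  moreover have "M (\<lambda>j. int (?\<alpha> j) + m j) \<in> range \<iota>" by (rule M_nonneg_in) simp
  ultimately have "MN ?\<alpha> * M m \<in> range \<iota>" by (rule range_qeq)
  moreover have "?\<alpha> \<in> nexps N" using assms(1) unfolding zexps_def nexps_def by auto
  ultimately show ?thesis unfolding L_def using assms(2) by (intro CollectI bexI[of _ ?\<alpha>]) auto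
qed

text \<open>\<open>y_left_cancel\<close> strips the factors of the monomial one by one; the
  forbidden index \<open>k\<close> does not occur, as \<open>\<alpha> k = 0\<close>.\<close>

lemma M_left_cancel:
  assumes k: "k \<in> {1..N}" and "\<alpha> \<in> nexps N" "\<alpha> k = 0" and eq: "MN \<alpha> * \<iota> w = \<iota> (y k * v)"
  obtains s where "w = y k * s"
proof -
  have "\<exists>s. w = y k * s" if "\<exists>v. oprod l (\<lambda>j. y j ^ \<alpha> j) * w = y k * v" "l \<le> N" for l w
    using that
  proof (induction l arbitrary: w)
    case (Suc l)
    have Y: "\<exists>s. w = y k * s" if "\<exists>v. y i ^ d * w = y k * v" "i \<in> {1..N}" "i \<noteq> k" for w i d
      using that
    proof (induction d arbitrary: w)
      case (Suc d)
      then obtain v where "y i * (y i ^ d * w) = y k * v" by (auto simp: mult.assoc)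
      then have "\<exists>s. y i ^ d * w = y k * s" using y_left_cancel[OF Suc.prems(2) k Suc.prems(3)] by metis
      then show ?case using Suc by blast
    qed auto
    have "\<exists>v. oprod l (\<lambda>j. y j ^ \<alpha> j) * (y (Suc l) ^ \<alpha> (Suc l) * w) = y k * v"
      using Suc.prems(1) by (simp add: mult.assoc)
    then have *: "\<exists>s. y (Suc l) ^ \<alpha> (Suc l) * w = y k * s" using Suc by auto
    show ?case
    proof (cases "Suc l = k")
      case True then show ?thesis using * assms(3) by simp
    next
      case False then show ?thesis using Y[OF *] Suc.prems(2) by simp
    qed
  qed auto
  moreover have "\<iota> (omon y N \<alpha> * w) = \<iota> (y k * v)" using eq by (simp add: \<iota>_omon \<iota>_mult)
  then have "\<exists>v. oprod N (\<lambda>j. y j ^ \<alpha> j) * w = y k * v" unfolding \<iota>_inj omon_def by blast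
  ultimately show ?thesis using that by blast
qed

text \<open>A denominator containing \<open>y k\<close> can be shortened by \<open>y k\<close>.\<close>

lemma L_intersection:
  assumes "\<And>k. k \<in> {1..N} \<Longrightarrow> t \<in> L k"
  shows "t \<in> range \<iota>"
proof -
  have step: "t \<in> range \<iota>" if "\<alpha> \<in> nexps N" "MN \<alpha> * t \<in> range \<iota>" "(\<Sum>j\<in>{1..N}. \<alpha> j) = s" for \<alpha> s
    using that
  proof (induction s arbitrary: \<alpha>)
    case 0
    then have "MN \<alpha> = M (\<lambda>_. 0)" by (intro M_cong) simp
    then show ?case using 0 by (simp add: Q.M_0)
  next
    case (Suc s)
    then obtain k where k: "k \<in> {1..N}" "\<alpha> k > 0"
      by (metis (no_types, lifting) gr0I nat.distinct(1) sum.neutral)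
    obtain w where w: "MN \<alpha> * t = \<iota> w" using Suc.prems by blast
    obtain \<gamma> r where \<gamma>: "\<gamma> \<in> nexps N" "\<gamma> k = 0" "MN \<gamma> * t = \<iota> r"
      using assms[OF k(1)] unfolding L_def by blast
    let ?\<beta> = "\<alpha>(k := \<alpha> k - 1)"
    have \<beta>: "?\<beta> \<in> nexps N" using Suc.prems(1) k unfolding nexps_def by auto
    have split: "\<iota> (y k) * MN ?\<beta> \<approx> MN \<alpha>"
    proof -
      have "M (\<lambda>j. if j = k then 1 else 0) = \<iota> (y k)" using Q.M_single[OF k(1), of 1] by simp
      moreover have "(\<lambda>j. (if j = k then 1 else 0) + int (?\<beta> j)) = (\<lambda>j. int (\<alpha> j))" using k(2) by auto
      ultimately show ?thesis using Q.M_mult[of "\<lambda>j. if j = k then 1 else 0" "\<lambda>j. int (?\<beta> j)"] by simp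
    qed
    \<comment> \<open>Applying both denominators to \<open>t\<close> shows that the monomial of
      \<open>\<gamma>\<close> times \<open>w\<close> is a right multiple of \<open>y k\<close>. As
      \<open>\<gamma> k = 0\<close>, already \<open>w\<close> is one.\<close>
    have "MN \<gamma> * MN \<alpha> \<approx> MN \<alpha> * MN \<gamma>"
    proof -
      have "MN \<gamma> * MN \<alpha> \<approx> M (\<lambda>j. int (\<gamma> j) + int (\<alpha> j))" by (rule Q.M_mult)
      also have "\<dots> = M (\<lambda>j. int (\<alpha> j) + int (\<gamma> j))" by (simp add: add.commute)
      also have "\<dots> \<approx> MN \<alpha> * MN \<gamma>" by (rule Q.qeq_sym[OF Q.M_mult])
      finally show ?thesis .
    qed
    also have "MN \<alpha> * MN \<gamma> \<approx> \<iota> (y k) * MN ?\<beta> * MN \<gamma>"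
      by (intro Q.qeq_mult Q.qeq_refl Q.qeq_sym[OF split])
    finally have "MN \<gamma> * MN \<alpha> * t \<approx> \<iota> (y k) * MN ?\<beta> * MN \<gamma> * t" by (rule Q.qeq_mult[OF _ Q.qeq_refl])
    also have "\<dots> = \<iota> (y k * (omon y N ?\<beta> * r))" by (simp add: mult.assoc \<gamma>(3) \<iota>_mult \<iota>_omon)
    finally obtain e where "MN \<gamma> * \<iota> w = T.sc (q powi e) (\<iota> (y k * (omon y N ?\<beta> * r)))"
      unfolding Q.qeq_def by (auto simp: mult.assoc w)
    then have "MN \<gamma> * \<iota> w = \<iota> (y k * sc (q powi e) (omon y N ?\<beta> * r))" by (simp add: \<iota>_sc)
    then obtain v where v: "w = y k * v" using M_left_cancel[OF k(1) \<gamma>(1,2)] by blast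
    have "\<iota> (y k) * MN ?\<beta> * t \<approx> \<iota> (y k) * \<iota> v"
      using Q.qeq_mult[OF split Q.qeq_refl, of t] w v by (simp add: \<iota>_mult)
    then obtain e where "\<iota> (y k) * (MN ?\<beta> * t) = \<iota> (y k) * T.sc (q powi e) (\<iota> v)"
      unfolding Q.qeq_def by (auto simp: mult.assoc)
    then have "MN ?\<beta> * t = T.sc (q powi e) (\<iota> v)" by (rule unit_cancel_left[OF \<iota>_unit[OF k(1)]])
    then have "MN ?\<beta> * t \<in> range \<iota>" by (metis \<iota>_sc rangeI)
    moreover have "(\<Sum>j\<in>{1..N}. ?\<beta> j) = s"
    proof -
      have "(\<Sum>j\<in>{1..N}. \<alpha> j) = \<alpha> k + (\<Sum>j\<in>{1..N} - {k}. \<alpha> j)"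
        "(\<Sum>j\<in>{1..N}. ?\<beta> j) = (\<alpha> k - 1) + (\<Sum>j\<in>{1..N} - {k}. \<alpha> j)"
        using k(1) by (simp_all add: sum.remove[of _ k])
      then show ?thesis using Suc.prems(3) k(2) by linarith
    qed
    ultimately show ?case using Suc.IH \<beta> by blast
  qed
  have "1 \<in> {1..N}" using ore unfolding iterated_ore_def by simp
  then obtain \<alpha> where "\<alpha> \<in> nexps N" "MN \<alpha> * t \<in> range \<iota>" using assms unfolding L_def by blast
  then show ?thesis using step by blast
qed

end

section \<open>Decomposition of derivations\<close>

context torus_tower
begin

lemma q_powi_eq_1: "q powi k = 1 \<longleftrightarrow> k = 0"
proof
  assume "q powi k = 1"
  then have "q ^ nat \<bar>k\<bar> = 1" by (cases "0 \<le> k") (simp_all add: power_int_def power_inverse)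
  moreover have "nat \<bar>k\<bar> > 0 \<Longrightarrow> q ^ nat \<bar>k\<bar> \<noteq> 1" using q_not_root unfolding not_root_of_unity_def by blast
  ultimately show "k = 0" by (cases "k = 0") simp_all
qed simp

lemma pow_commute: "\<iota> (y i) * t = T.sc e (t * \<iota> (y i)) \<Longrightarrow> \<iota> (y i) ^ s * t = T.sc (e ^ s) (t * \<iota> (y i) ^ s)"
proof (induction s)
  case (Suc s)
  have "\<iota> (y i) ^ Suc s * t = \<iota> (y i) * (\<iota> (y i) ^ s * t)" by (simp add: mult.assoc)
  also have "\<dots> = T.sc (e ^ s) ((\<iota> (y i) * t) * \<iota> (y i) ^ s)"
    by (simp only: Suc.IH[OF Suc.prems] T.sc_mult_right mult.assoc)
  also have "\<dots> = T.sc (e ^ Suc s) (t * \<iota> (y i) ^ Suc s)"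
    unfolding Suc.prems by (simp add: mult.assoc mult.commute)
  finally show ?case .
qed simp

lemma Y_comb:
  assumes "i \<in> {1..N}"
  shows "\<iota> (y i) * comb F d = comb F (\<lambda>m. d m * q powi b i m) * \<iota> (y i)"
  by (simp add: comb_def sum_distrib_left sum_distrib_right Q.Y_M[OF assms])

lemma scaled_eigenvector:
  assumes "i \<in> {1..N}"
  shows "\<iota> (y i) * T.sc e (M m * \<iota> (y i)) = T.sc (q powi b i m) (T.sc e (M m * \<iota> (y i)) * \<iota> (y i))"
proof -
  have "\<iota> (y i) * T.sc e (M m * \<iota> (y i)) = T.sc e ((\<iota> (y i) * M m) * \<iota> (y i))"
    by (simp only: T.sc_mult_right mult.assoc)
  also have "\<dots> = T.sc e (T.sc (q powi b i m) (M m * \<iota> (y i) * \<iota> (y i)))"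
    by (simp only: Q.Y_M[OF assms] T.sc_mult_left)
  also have "\<dots> = T.sc (q powi b i m) (T.sc e (M m * \<iota> (y i)) * \<iota> (y i))"
    unfolding T.sc_mult_left by (rule T.V.scale_left_commute)
  finally show ?thesis .
qed

lemma comb_diff: "comb F d - comb F d' = comb F (\<lambda>m. d m - d' m)"
  by (simp add: comb_def T.V.scale_left_diff_distrib sum_subtractf)

lemma comb_add: "comb F d + comb F d' = comb F (\<lambda>m. d m + d' m)"
  by (simp add: comb_def T.V.scale_left_distrib sum.distrib)

lemma comb_sc: "T.sc e (comb F d) = comb F (\<lambda>m. e * d m)"
  by (simp add: comb_def T.V.scale_sum_right)

lemma comb_cong: "(\<And>m. m \<in> F \<Longrightarrow> d m = d' m) \<Longrightarrow> comb F d = comb F d'"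
  by (simp add: comb_def)

lemma comb_group:
  assumes "finite F"
  shows "comb F d = (\<Sum>\<beta>\<in>f ` F. comb {m \<in> F. f m = \<beta>} d)"
  unfolding comb_def by (rule sum.image_gen[OF assms])

text \<open>In the commutator with \<open>y i\<close> the class \<open>\<beta>\<close> is scaled by
  \<open>q powi \<beta> - 1\<close>, which is nonzero, and multiplied by \<open>y i\<close>.
  \<open>Q.eigencomponent_in\<close> isolates it up to a right power of \<open>y i\<close>; this
  power moves to the left at the cost of a scalar and is absorbed in the denominator since
  \<open>i \<noteq> k\<close>.\<close>

lemma comb_class_in_L:
  assumes i: "i \<in> {1..N}" "i \<noteq> k" and F: "finite F"
    and comm: "\<iota> (y i) * comb F d - comb F d * \<iota> (y i) \<in> L k" and "\<beta> \<noteq> 0"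
  shows "comb {m \<in> F. b i m = \<beta>} d \<in> L k"
proof -
  let ?f = "\<lambda>m. T.sc (d m * (q powi b i m - 1)) (M m * \<iota> (y i))"
  have "\<iota> (y i) * comb F d - comb F d * \<iota> (y i) = comb F (\<lambda>m. d m * (q powi b i m - 1)) * \<iota> (y i)"
    unfolding Y_comb[OF i(1)] left_diff_distrib[symmetric] comb_diff by (simp add: algebra_simps)
  then have sum_in: "sum ?f F \<in> L k" using comm by (simp add: comb_def sum_distrib_right)
  have f: "\<iota> (y i) * ?f m = T.sc (q powi b i m) (?f m * \<iota> (y i))" for m
    by (rule scaled_eigenvector[OF i(1)])
  obtain s where "sum ?f {m \<in> F. b i m = \<beta>} * \<iota> (y i) ^ s \<in> L k"
    using Q.eigencomponent_in[of "L k" i "b i ` F" F "b i" \<beta> ?f, OF L_diff L_sc L_left[OF i(1)] L_right q_not_root]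
      F f sum_in by blast
  moreover have "sum ?f {m \<in> F. b i m = \<beta>} = T.sc (q powi \<beta> - 1) (comb {m \<in> F. b i m = \<beta>} d * \<iota> (y i))"
    by (simp add: comb_def sum_distrib_right T.V.scale_sum_right mult.commute)
  ultimately have in_L: "T.sc (q powi \<beta> - 1) (comb {m \<in> F. b i m = \<beta>} d * \<iota> (y i) ^ Suc s) \<in> L k"
    by (simp add: mult.assoc)
  have "q powi \<beta> - 1 \<noteq> 0" using q_powi_eq_1 \<open>\<beta> \<noteq> 0\<close> by simp
  then have *: "comb {m \<in> F. b i m = \<beta>} d * \<iota> (y i) ^ Suc s \<in> L k"
    using L_sc[OF in_L, of "1 / (q powi \<beta> - 1)"] by simp
  have "\<iota> (y i) * comb {m \<in> F. b i m = \<beta>} d = T.sc (q powi \<beta>) (comb {m \<in> F. b i m = \<beta>} d * \<iota> (y i))"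
  proof -
    have "comb {m \<in> F. b i m = \<beta>} (\<lambda>m. d m * q powi b i m) = comb {m \<in> F. b i m = \<beta>} (\<lambda>m. q powi \<beta> * d m)"
      by (intro comb_cong) simp
    then show ?thesis unfolding Y_comb[OF i(1)] by (simp flip: comb_sc)
  qed
  then have "\<iota> (y i) ^ Suc s * comb {m \<in> F. b i m = \<beta>} d \<in> L k"
    by (simp only: pow_commute[of i _ "q powi \<beta>"] L_sc[OF *])
  then show ?thesis by (rule L_cancel_left[OF i])
qed

lemma noncentral_comb_in_L:
  assumes k: "k \<in> {1..N}" and F: "finite F" "F \<subseteq> zexps N"
    and noncentral: "\<And>m. m \<in> F \<Longrightarrow> \<exists>j\<in>{1..N}. b j m \<noteq> 0"
    and comm: "\<And>i. i \<in> {1..N} \<Longrightarrow> i \<noteq> k \<Longrightarrow> \<iota> (y i) * comb F d - comb F d * \<iota> (y i) \<in> L k"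
  shows "comb F d \<in> L k"
proof -
  \<comment> \<open>The part still to be treated once the indices in \<open>I\<close> have been
    used: the monomials commuting with all \<open>y i\<close>, \<open>i \<in> I\<close>. All others
    have been shown to contribute an element of \<open>L k\<close>.\<close>
  define G where "G I = {m \<in> F. \<forall>i\<in>I. b i m = 0}" for I
  have fin: "finite (G I)" for I using F by (simp add: G_def)
  have "comb F d - comb (G I) d \<in> L k" if "finite I" "I \<subseteq> {1..N} - {k}" for I
    using that
  proof (induction I rule: finite_induct)
    case empty then show ?case using L_0 by (simp add: G_def)
  next
    case (insert i I)
    then have i: "i \<in> {1..N}" "i \<noteq> k" and IH: "comb F d - comb (G I) d \<in> L k" by auto
    let ?t = "comb F d" and ?t' = "comb (G I) d"
    have "\<iota> (y i) * (?t - ?t') - (?t - ?t') * \<iota> (y i) \<in> L k"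
      by (intro L_diff L_left[OF i(1)] L_right IH)
    then have "(\<iota> (y i) * ?t - ?t * \<iota> (y i)) - (\<iota> (y i) * (?t - ?t') - (?t - ?t') * \<iota> (y i)) \<in> L k"
      by (rule L_diff[OF comm[OF i]])
    \<comment> \<open>The hypothesis on commutators passes to the remaining part, because the
      removed part lies in \<open>L k\<close>, which is stable under \<open>y i\<close> on both
      sides.\<close>
    then have comm': "\<iota> (y i) * ?t' - ?t' * \<iota> (y i) \<in> L k" by (simp add: algebra_simps)
    let ?S = "{m \<in> G I. b i m \<noteq> 0}"
    have "comb ?S d \<in> L k"
    proof -
      have "comb {m \<in> ?S. b i m = \<beta>} d \<in> L k" if "\<beta> \<in> b i ` ?S" for \<beta>
      proof -
        have "\<beta> \<noteq> 0" using that by auto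
        moreover from this have "{m \<in> ?S. b i m = \<beta>} = {m \<in> G I. b i m = \<beta>}" by auto
        ultimately show ?thesis using comb_class_in_L[OF i fin comm'] by simp
      qed
      then show ?thesis using fin by (subst comb_group[of _ _ "b i"]) (auto intro!: L_sum)
    qed
    moreover have "?t' = comb ?S d + comb (G (insert i I)) d"
    proof -
      have "G I = ?S \<union> G (insert i I)" "?S \<inter> G (insert i I) = {}" by (auto simp: G_def)
      then show ?thesis unfolding comb_def using fin
        by (metis (no_types, lifting) finite_Un sum.union_disjoint)
    qed
    ultimately have "comb F d - ?t' + comb ?S d \<in> L k" using IH by (intro L_add)
    then show ?case using \<open>?t' = _\<close> by (simp add: algebra_simps)
  qed
  then have *: "comb F d - comb (G ({1..N} - {k})) d \<in> L k" by simp
  have "M m \<in> L k" if m: "m \<in> G ({1..N} - {k})" for m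
  proof -
    have zero: "b i m = 0" if "i \<in> {1..N} - {k}" for i using m that by (simp add: G_def)
    have mF: "m \<in> F" using m by (simp add: G_def)
    have "b k m \<noteq> 0" using noncentral[OF mF] zero by blast
    moreover have "m k * b k m = 0"
      using Q.b_skew[of m] zero k by (simp add: sum.remove[of _ k])
    ultimately show ?thesis using M_in_L F(2) mF by auto
  qed
  then have "comb (G ({1..N} - {k})) d \<in> L k" unfolding comb_def by (intro L_sum L_sc)
  then have "(comb F d - comb (G ({1..N} - {k})) d) + comb (G ({1..N} - {k})) d \<in> L k"
    by (intro L_add *)
  then show ?thesis by simp
qed

lemma kderivD:
  assumes "kderiv emb D"
  shows "D (r + s) = D r + D s" "D (sc e r) = sc e (D r)" "D (r * s) = D r * s + r * D s"
  using assms unfolding kderiv_def sc_def by blast+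

text \<open>This is the Osborn--Passman decomposition on the torus; its inner part lies in \<open>R\<close> by
  \<open>L_intersection\<close>.\<close>

lemma derivation_split:
  assumes D: "kderiv emb D"
  shows "\<exists>r z. (\<forall>i\<in>{1..N}. z i \<in> center \<and> \<iota> (D (y i) - ad r (y i)) = z i * \<iota> (y i)) \<and>
    (\<forall>i\<in>{1..N}. \<forall>k\<in>{1..N}. k \<noteq> i \<longrightarrow> z i \<in> L k)"
proof -
  have "\<exists>F d. finite F \<and> F \<subseteq> zexps N \<and> \<iota> (D (y i)) * rinv (\<iota> (y i)) = comb F d" for i
    using T_comb[of "\<iota> (D (y i)) * rinv (\<iota> (y i))"] by metis
  then obtain Fi di where Fi: "\<And>i. finite (Fi i)" "\<And>i. Fi i \<subseteq> zexps N"
    "\<And>i. \<iota> (D (y i)) * rinv (\<iota> (y i)) = comb (Fi i) (di i)" by metis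
  \<comment> \<open>A common finite support for all \<open>i\<close>; padding with zeros makes the
    coefficients for different \<open>i\<close> comparable at one exponent.\<close>
  define F where "F = (\<Union>i\<in>{1..N}. Fi i)"
  define e where "e i m = (if m \<in> Fi i then di i m else 0)" for i m
  have F: "finite F" "F \<subseteq> zexps N" using Fi by (auto simp: F_def)
  have De: "\<iota> (D (y i)) = comb F (e i) * \<iota> (y i)" if i: "i \<in> {1..N}" for i
  proof -
    have "Fi i \<subseteq> F" using i by (auto simp: F_def)
    then have "comb (Fi i) (di i) = comb F (e i)" unfolding e_def by (rule comb_extend[OF F(1)])
    moreover have "\<iota> (D (y i)) = \<iota> (D (y i)) * rinv (\<iota> (y i)) * \<iota> (y i)"
      using rinv_unit[OF \<iota>_unit[OF i]] by (simp add: mult.assoc)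
    ultimately show ?thesis using Fi(3) by simp
  qed
  \<comment> \<open>The cocycle condition, obtained by applying \<open>D\<close> to the relation
    \<open>y i * y j = sc (q powi B i j) (y j * y i)\<close> and comparing coefficients. Only the
    values of \<open>D\<close> on the \<open>y i\<close> are used, so \<open>D\<close> need not be
    extended to the torus.\<close>
  have rel: "(q powi b i m - 1) * e j m = (q powi b j m - 1) * e i m"
    if i: "i \<in> {1..N}" and j: "j \<in> {1..N}" and m: "m \<in> F" for i j m
  proof -
    have Dyy: "\<iota> (D (y i * y j)) = comb F (\<lambda>m. e i m + e j m * q powi b i m) * (\<iota> (y i) * \<iota> (y j))"
      if i: "i \<in> {1..N}" and j: "j \<in> {1..N}" for i j
    proof -
      have "\<iota> (D (y i * y j)) = comb F (e i) * (\<iota> (y i) * \<iota> (y j)) + \<iota> (y i) * comb F (e j) * \<iota> (y j)"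
        by (simp add: kderivD[OF D] \<iota>_add \<iota>_mult De[OF i] De[OF j] mult.assoc)
      also have "\<dots> = (comb F (e i) + comb F (\<lambda>m. e j m * q powi b i m)) * (\<iota> (y i) * \<iota> (y j))"
        unfolding Y_comb[OF i] by (simp add: distrib_right mult.assoc)
      finally show ?thesis unfolding comb_add .
    qed
    have "D (y i * y j) = sc (q powi B i j) (D (y j * y i))"
      unfolding y_q_commute[OF i j] by (rule kderivD(2)[OF D])
    then have "comb F (\<lambda>m. e i m + e j m * q powi b i m) * (\<iota> (y i) * \<iota> (y j))
        = comb F (\<lambda>m. e j m + e i m * q powi b j m) * T.sc (q powi B i j) (\<iota> (y j) * \<iota> (y i))"
      unfolding Dyy[OF i j, symmetric] by (simp add: \<iota>_sc Dyy[OF j i])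
    also have "T.sc (q powi B i j) (\<iota> (y j) * \<iota> (y i)) = \<iota> (y i) * \<iota> (y j)"
      using Q.q_commute[OF i j] by simp
    finally have "comb F (\<lambda>m. e i m + e j m * q powi b i m) = comb F (\<lambda>m. e j m + e i m * q powi b j m)"
      by (rule unit_cancel_right[OF is_unit_mult[OF \<iota>_unit[OF i] \<iota>_unit[OF j]]])
    from comb_eq_iff[OF F this m] show ?thesis by (simp add: algebra_simps)
  qed
  define F1 where "F1 = {m \<in> F. \<exists>j\<in>{1..N}. b j m \<noteq> 0}"
  define F0 where "F0 = {m \<in> F. \<forall>j\<in>{1..N}. b j m = 0}"
  have F_split: "F = F1 \<union> F0" "F1 \<inter> F0 = {}" "finite F1" "finite F0" "F1 \<subseteq> zexps N" "F0 \<subseteq> zexps N"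
    using F by (auto simp: F1_def F0_def)
  have comb_split: "comb F d = comb F1 d + comb F0 d" for d
    unfolding comb_def F_split(1) using F_split by (intro sum.union_disjoint)
  define j0 where "j0 m = (SOME j. j \<in> {1..N} \<and> b j m \<noteq> 0)" for m
  have j0: "j0 m \<in> {1..N}" "b (j0 m) m \<noteq> 0" if "m \<in> F1" for m
  proof -
    have "\<exists>j. j \<in> {1..N} \<and> b j m \<noteq> 0" using that by (auto simp: F1_def)
    from someI_ex[OF this] show "j0 m \<in> {1..N}" "b (j0 m) m \<noteq> 0" unfolding j0_def by auto
  qed
  \<comment> \<open>The coefficient of \<open>M m\<close> in \<open>t\<close> that makes
    \<open>[t, y i]\<close> match \<open>D (y i)\<close>. By \<open>rel\<close>, every index with
    \<open>b j m \<noteq> 0\<close> gives the same quotient.\<close>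
  define \<tau> where "\<tau> m = e (j0 m) m / (1 - q powi b (j0 m) m)" for m
  have \<tau>: "\<tau> m * (1 - q powi b i m) = e i m" if "m \<in> F1" "i \<in> {1..N}" for m i
  proof -
    have "1 - q powi b (j0 m) m \<noteq> 0" using j0(2)[OF that(1)] q_powi_eq_1 by simp
    moreover have "(q powi b (j0 m) m - 1) * e i m = (q powi b i m - 1) * e (j0 m) m"
      using rel[OF j0(1)[OF that(1)] that(2)] that(1) by (simp add: F1_def)
    then have "e (j0 m) m * (1 - q powi b i m) = e i m * (1 - q powi b (j0 m) m)"
      by (simp add: algebra_simps)
    ultimately show ?thesis unfolding \<tau>_def by (simp add: field_simps)
  qed
  define t where "t = comb F1 \<tau>"
  define z where "z i = comb F0 (e i)" for i
  have z_center: "z i \<in> center" for i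
  proof -
    have "\<iota> (y j) * z i = z i * \<iota> (y j)" if "j \<in> {1..N}" for j
    proof -
      have "comb F0 (\<lambda>m. e i m * q powi b j m) = comb F0 (e i)"
        using that by (intro comb_cong) (simp add: F0_def)
      then show ?thesis unfolding z_def Y_comb[OF that] by simp
    qed
    then show ?thesis unfolding center_iff by blast
  qed
  have D_eq: "\<iota> (D (y i)) = (t * \<iota> (y i) - \<iota> (y i) * t) + z i * \<iota> (y i)" if i: "i \<in> {1..N}" for i
  proof -
    have "t * \<iota> (y i) - \<iota> (y i) * t = comb F1 (\<lambda>m. \<tau> m - \<tau> m * q powi b i m) * \<iota> (y i)"
      unfolding t_def Y_comb[OF i] left_diff_distrib[symmetric] comb_diff ..
    also have "comb F1 (\<lambda>m. \<tau> m - \<tau> m * q powi b i m) = comb F1 (e i)"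
      using \<tau> i by (intro comb_cong) (simp add: algebra_simps)
    finally show ?thesis unfolding De[OF i] comb_split z_def by (simp add: distrib_right)
  qed
  \<comment> \<open>In the expansion of the regular element \<open>D (y i)\<close>, the class
    commuting with \<open>y i\<close> is exactly \<open>z i * y i\<close>: a noncentral
    \<open>m\<close> with \<open>b i m = 0\<close> has coefficient \<open>e i m = 0\<close> by the
    formula for \<open>\<tau>\<close>. So the only denominators of \<open>z i\<close> are powers of
    \<open>y i\<close>.\<close>
  have z_pole: "\<exists>s. z i * \<iota> (y i) * \<iota> (y i) ^ s \<in> range \<iota>" if i: "i \<in> {1..N}" for i
  proof -
    let ?f = "\<lambda>m. T.sc (e i m) (M m * \<iota> (y i))"
    have f: "\<iota> (y i) * ?f m = T.sc (q powi b i m) (?f m * \<iota> (y i))" for m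
      by (rule scaled_eigenvector[OF i])
    have "sum ?f F = \<iota> (D (y i))" unfolding De[OF i] by (simp add: comb_def sum_distrib_right)
    then have "sum ?f F \<in> range \<iota>" by simp
    then obtain s where s: "sum ?f {m \<in> F. b i m = 0} * \<iota> (y i) ^ s \<in> range \<iota>"
      using Q.eigencomponent_in[of "range \<iota>" i "b i ` F" F "b i" 0 ?f, OF range_diff range_sc range_mult[OF rangeI]
          range_mult[OF _ rangeI] q_not_root] F(1) f by blast
    have "sum ?f {m \<in> F. b i m = 0} = sum ?f F0"
    proof (rule sum.mono_neutral_right)
      show "F0 \<subseteq> {m \<in> F. b i m = 0}" using i by (auto simp: F0_def)
      show "\<forall>m\<in>{m \<in> F. b i m = 0} - F0. ?f m = 0"
      proof
        fix m assume "m \<in> {m \<in> F. b i m = 0} - F0"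
        then have "m \<in> F1" "b i m = 0" by (auto simp: F0_def F1_def)
        then have "e i m = 0" using \<tau>[OF _ i, of m] by simp
        then show "?f m = 0" by simp
      qed
    qed (use F in simp)
    also have "\<dots> = z i * \<iota> (y i)" by (simp add: z_def comb_def sum_distrib_right)
    finally show ?thesis using s by auto
  qed
  have zy: "\<iota> (y i) ^ s * z i = z i * \<iota> (y i) ^ s" for i s
    using pow_commute[of i "z i" 1 s] z_center[of i] by (simp add: center_def)
  have z_L: "z i \<in> L k" if i: "i \<in> {1..N}" and "k \<noteq> i" for i k
  proof -
    obtain s where "z i * \<iota> (y i) * \<iota> (y i) ^ s \<in> range \<iota>" using z_pole[OF i] by blast
    then have "z i * \<iota> (y i) ^ Suc s \<in> range \<iota>" by (simp add: mult.assoc)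
    then have "\<iota> (y i) ^ Suc s * z i \<in> L k" unfolding zy by (rule range_subset_L)
    then show ?thesis using L_cancel_left[OF i not_sym[OF \<open>k \<noteq> i\<close>]] by blast
  qed
  have "t \<in> L k" if k: "k \<in> {1..N}" for k
    unfolding t_def
  proof (rule noncentral_comb_in_L[OF k F_split(3,5)])
    show "\<exists>j\<in>{1..N}. b j m \<noteq> 0" if "m \<in> F1" for m using that by (simp add: F1_def)
    fix i assume i: "i \<in> {1..N}" "i \<noteq> k"
    \<comment> \<open>By \<open>D_eq\<close> this is the commutator of \<open>y i\<close> with
      \<open>t\<close>.\<close>
    have "z i * \<iota> (y i) - \<iota> (D (y i)) \<in> L k"
      by (rule L_diff[OF L_right[OF z_L[OF i(1) not_sym[OF i(2)]]] range_subset_L[OF rangeI]])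
    then show "\<iota> (y i) * comb F1 \<tau> - comb F1 \<tau> * \<iota> (y i) \<in> L k"
      unfolding D_eq[OF i(1)] t_def by (simp add: algebra_simps)
  qed
  then obtain r where r: "t = \<iota> r" using L_intersection by blast
  have "\<iota> (D (y i) - ad r (y i)) = z i * \<iota> (y i)" if "i \<in> {1..N}" for i
    using D_eq[OF that] unfolding r ad_def by (simp add: \<iota>_diff \<iota>_mult)
  then show ?thesis using z_center z_L by blast
qed

section \<open>Exponents of regular and central elements under Hypothesis (H)\<close>

lemma omon_div:
  assumes k: "k \<in> {1..N}" and "0 < m k"
  shows "\<exists>v. omon y N m = y k * v"
proof -
  let ?m = "m(k := m k - 1)"
  have "M (\<lambda>j. if j = k then 1 else 0) = \<iota> (y k)" using Q.M_single[OF k, of 1] by simp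
  moreover have "(\<lambda>j. (if j = k then 1 else 0) + int (?m j)) = (\<lambda>j. int (m j))" using assms(2) by auto
  ultimately have "\<iota> (y k) * MN ?m \<approx> MN m"
    using Q.M_mult[of "\<lambda>j. if j = k then 1 else 0" "\<lambda>j. int (?m j)"] by simp
  then have "MN m \<approx> \<iota> (y k) * MN ?m" by (rule Q.qeq_sym)
  then obtain e where "\<iota> (omon y N m) = T.sc (q powi e) (\<iota> (y k) * \<iota> (omon y N ?m))"
    unfolding Q.qeq_def \<iota>_omon by blast
  then have "\<iota> (omon y N m) = \<iota> (y k * sc (q powi e) (omon y N ?m))" by (simp add: \<iota>_mult \<iota>_sc)
  then show ?thesis unfolding \<iota>_inj by blast
qed

text \<open>If the lowest exponent \<open>lo\<close> at \<open>k\<close> were negative, multiplying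
  by \<open>y k ^ (- lo)\<close> and by denominators without \<open>y k\<close> would give a right
  multiple of \<open>y k\<close>. The terms above \<open>lo\<close> are such multiples too, so the
  terms at \<open>lo\<close>, which no longer involve \<open>y k\<close>, sum to one, against
  \<open>y_monomials_not_multiple\<close>.\<close>

lemma L_exponents:
  assumes k: "k \<in> s_infty N \<mu>" and F: "finite F" "F \<subseteq> zexps N" and in_L: "comb F d \<in> L k"
    and m: "m \<in> F" "d m \<noteq> 0"
  shows "0 \<le> m k"
proof (rule ccontr)
  assume neg: "\<not> 0 \<le> m k"
  have kN: "k \<in> {1..N}" using k by (simp add: s_infty_def)
  \<comment> \<open>Zero coefficients are discarded so that \<open>lo\<close> is attained at a
    genuine term, whose coefficient yields the contradiction.\<close>
  define G where "G = {m \<in> F. d m \<noteq> 0}"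
  have G: "finite G" "G \<subseteq> zexps N" "m \<in> G" using F m by (auto simp: G_def)
  have comb_G: "comb F d = comb G d" unfolding comb_def
    using F(1) by (intro sum.mono_neutral_right) (auto simp: G_def)
  define lo where "lo = Min ((\<lambda>m. m k) ` G)"
  have lo_le: "lo \<le> m' k" if "m' \<in> G" for m' unfolding lo_def using G(1) that by (intro Min_le) auto
  have "lo \<in> (\<lambda>m. m k) ` G" unfolding lo_def using G by (intro Min_in) auto
  then obtain m0 where m0: "m0 \<in> G" "m0 k = lo" by blast
  have "lo < 0" using lo_le[OF G(3)] neg by simp
  obtain \<alpha> where \<alpha>: "\<alpha> \<in> nexps N" "\<alpha> k = 0" "MN \<alpha> * comb G d \<in> range \<iota>"
    using in_L unfolding comb_G L_def by blast
  obtain \<alpha>0 where \<alpha>0: "\<alpha>0 \<in> nexps N" "\<forall>m\<in>G. \<forall>j. 0 \<le> int (\<alpha>0 j) + m j"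
    using denominators_exist[OF G(1,2)] by blast
  \<comment> \<open>Clears the negative exponents away from \<open>k\<close> and leaves those at
    \<open>k\<close> untouched, since the entry of \<open>\<alpha>0\<close> at \<open>k\<close> is
    erased and \<open>\<alpha> k = 0\<close>.\<close>
  let ?\<beta> = "\<lambda>j. (\<alpha>0(k := 0)) j + \<alpha> j"
  have "\<alpha>0(k := 0) \<in> nexps N" using \<alpha>0(1) unfolding nexps_def by simp
  then have \<beta>: "?\<beta> \<in> nexps N" using \<alpha>(1) by (rule nexps_add)
  obtain w where w: "MN ?\<beta> * comb G d = \<iota> w" using L_enlarge[OF \<alpha>(3), of "\<alpha>0(k := 0)"] by blast
  define s where "s = nat (- lo)"
  have s: "0 < s" "int s = - lo" using \<open>lo < 0\<close> by (auto simp: s_def)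
  let ?\<gamma> = "\<lambda>j. (if j = k then s else 0) + ?\<beta> j"
  have \<gamma>: "?\<gamma> \<in> nexps N" by (rule nexps_add[OF single_nexps[OF kN] \<beta>])
  have \<gamma>_nonneg: "\<forall>m\<in>G. \<forall>j. 0 \<le> int (?\<gamma> j) + m j"
  proof (intro ballI allI)
    fix m j assume "m \<in> G"
    then have "lo \<le> m k" "0 \<le> int (\<alpha>0 j) + m j" using lo_le \<alpha>0(2) by auto
    then show "0 \<le> int (?\<gamma> j) + m j" using s \<alpha>(2) by (cases "j = k") auto
  qed
  obtain g \<kappa> where g: "inj_on g G" "g ` G \<subseteq> nexps N" "\<forall>m\<in>G. \<forall>j. int (g m j) = int (?\<gamma> j) + m j"
    "\<forall>d. MN ?\<gamma> * comb G d = \<iota> (\<Sum>m\<in>G. sc (d m * q powi \<kappa> m) (omon y N (g m)))"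
    using clear_denominators[OF G(1,2) \<gamma> \<gamma>_nonneg] by blast
  have gk: "int (g m' k) = m' k - lo" if "m' \<in> G" for m'
  proof -
    have "int (?\<gamma> k) = - lo" using s \<alpha>(2) by simp
    then show ?thesis using g(3)[THEN bspec, OF that, THEN spec, of k] by (simp only:)
  qed
  let ?h = "\<lambda>m. sc (d m * q powi \<kappa> m) (omon y N (g m))"
  have "MN ?\<gamma> * comb G d \<approx> \<iota> (y k) ^ s * \<iota> w"
  proof -
    have "MN (\<lambda>j. if j = k then s else 0) = \<iota> (y k) ^ s"
      using Q.M_single[OF kN, of "int s"] by (simp add: ipow_nat if_distrib[of int] cong: if_cong)
    then have "\<iota> (y k) ^ s * MN ?\<beta> \<approx> MN ?\<gamma>"
      using Q.M_mult[of "\<lambda>j. int (if j = k then s else 0)" "\<lambda>j. int (?\<beta> j)"] by simp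
    then have "MN ?\<gamma> * comb G d \<approx> \<iota> (y k) ^ s * MN ?\<beta> * comb G d"
      by (intro Q.qeq_mult[OF Q.qeq_sym Q.qeq_refl])
    then show ?thesis by (simp only: mult.assoc w)
  qed
  then obtain e where "\<iota> (sum ?h G) = T.sc (q powi e) (\<iota> (y k) ^ s * \<iota> w)"
    unfolding Q.qeq_def using g(4) by auto
  moreover obtain s' where "s = Suc s'" using s(1) gr0_implies_Suc by blast
  ultimately have "\<iota> (sum ?h G) = \<iota> (y k * sc (q powi e) (y k ^ s' * w))"
    by (simp add: \<iota>_mult \<iota>_sc \<iota>_power mult.assoc)
  then have total: "sum ?h G = y k * sc (q powi e) (y k ^ s' * w)" unfolding \<iota>_inj .
  let ?A = "{m \<in> G. m k = lo}" and ?C = "{m \<in> G. m k \<noteq> lo}"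
  have "\<exists>v. ?h m' = y k * v" if "m' \<in> ?C" for m'
  proof -
    have "0 < g m' k" using gk[of m'] lo_le[of m'] that by fastforce
    then obtain v where "omon y N (g m') = y k * v" using omon_div[OF kN] by blast
    then have "?h m' = y k * sc (d m' * q powi \<kappa> m') v" by simp
    then show ?thesis by blast
  qed
  then have "\<exists>v. \<forall>m'\<in>?C. ?h m' = y k * v m'" by (intro bchoice ballI)
  then obtain v where v: "\<forall>m'\<in>?C. ?h m' = y k * v m'" by blast
  have "G = ?A \<union> ?C" "?A \<inter> ?C = {}" by auto
  moreover have "finite ?A" "finite ?C" using G(1) by simp_all
  ultimately have "sum ?h G = sum ?h ?A + sum ?h ?C" by (metis (no_types, lifting) sum.union_disjoint)
  moreover have "sum ?h ?C = y k * sum v ?C"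
    unfolding sum_distrib_left by (rule sum.cong[OF refl v[rule_format]])
  ultimately have A: "sum ?h ?A = y k * (sc (q powi e) (y k ^ s' * w) - sum v ?C)"
    using total by (simp add: algebra_simps)
  have injA: "inj_on g ?A" by (rule inj_on_subset[OF g(1)]) auto
  define \<psi> where "\<psi> = the_inv_into G g"
  have \<psi>: "\<psi> (g m') = m'" if "m' \<in> G" for m' unfolding \<psi>_def by (rule the_inv_into_f_f[OF g(1) that])
  have "(\<Sum>m\<in>g ` ?A. sc (d (\<psi> m) * q powi \<kappa> (\<psi> m)) (omon y N m)) = sum ?h ?A"
    unfolding sum.reindex[OF injA] comp_def by (intro sum.cong) (auto simp: \<psi>)
  then have "(\<Sum>m\<in>g ` ?A. sc (d (\<psi> m) * q powi \<kappa> (\<psi> m)) (omon y N m))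
      = y k * (sc (q powi e) (y k ^ s' * w) - sum v ?C)" using A by simp
  moreover have "m' k = 0" if "m' \<in> g ` ?A" for m' using that gk by fastforce
  moreover have "finite (g ` ?A)" "g ` ?A \<subseteq> nexps N" "g m0 \<in> g ` ?A" using G(1) g(2) m0 by auto
  ultimately have "d (\<psi> (g m0)) * q powi \<kappa> (\<psi> (g m0)) = 0"
    by (intro y_monomials_not_multiple[OF k, where F = "g ` ?A" and d = "\<lambda>m. d (\<psi> m) * q powi \<kappa> (\<psi> m)"])
  then show False using \<psi>[OF m0(1)] m0(1) q_powi_nonzero by (simp add: G_def)
qed

text \<open>If \<open>i\<close> has a successor, central monomials do not involve
  \<open>y i\<close>, so \<open>z\<close> is regular along \<open>y i\<close> as well. Otherwise
  only the exponent at \<open>i\<close> can be negative in a term of \<open>z\<close>. Some central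
  generator then has a negative power in that term; (H2) places a negative exponent at its index in
  \<open>C\<close>, which must be \<open>i\<close>, and (H3) rules out any further index in its
  support. The generator is thus \<open>y i\<close> itself.\<close>

lemma central_regular_or_y_central:
  assumes H: "hypothesis_H emb N \<mu> y \<iota>" and i: "i \<in> {1..N}" and z: "z \<in> center"
    and z_L: "\<And>k. k \<in> {1..N} \<Longrightarrow> k \<noteq> i \<Longrightarrow> z \<in> L k"
  shows "z \<in> range \<iota> \<or> \<iota> (y i) \<in> center"
proof -
  obtain l :: nat and e :: "nat \<Rightarrow> nat \<Rightarrow> int" and cc :: "nat \<Rightarrow> nat" where
    e: "\<forall>r\<in>{1..l}. e r \<in> zexps N \<and> supp (e r) \<subseteq> s_infty N \<mu>" and
    cen: "center = kspan (\<lambda>d. \<iota> (emb d)) ((\<lambda>\<alpha>. oprod l (\<lambda>r. ipow (lmon N y \<iota> (e r)) (\<alpha> r))) ` zexps l)" and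
    cc: "inj_on cc {1..l}" "cc ` {1..l} \<subseteq> s_infty N \<mu>" and
    gen: "\<forall>r\<in>{1..l}. lmon N y \<iota> (e r) \<in> \<iota> ` subalg emb (y ` {1..N}) \<and>
       (\<forall>j\<in>{1..l}. e r (cc j) = (if r = j then 1 else 0)) \<and>
       (2 \<le> card (supp (e r)) \<longrightarrow> \<not> (supp (e r) - {cc r} \<subseteq> (\<Union>j\<in>{1..l} - {r}. supp (e j))))"
    using H unfolding hypothesis_H_def comp_def by (elim exE conjE) (rule that; assumption)
  let ?Z = "\<lambda>\<alpha>. oprod l (\<lambda>r. ipow (M (e r)) (\<alpha> r))"
  define mm where "mm \<alpha> = (\<lambda>j. \<Sum>r\<in>{1..l}. \<alpha> r * e r j)" for \<alpha> :: "nat \<Rightarrow> int"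
  have cen': "center = kspan (\<lambda>d. \<iota> (emb d)) (?Z ` zexps l)" using cen by (simp only: lmon_eq_M)
  have "\<exists>\<kappa>. ?Z \<alpha> = T.sc (q powi \<kappa>) (M (mm \<alpha>))" for \<alpha>
    using Q.oprod_ipow_M[of l e \<alpha>] unfolding Q.qeq_def mm_def by blast
  then obtain \<kappa> where \<kappa>: "\<And>\<alpha>. ?Z \<alpha> = T.sc (q powi \<kappa> \<alpha>) (M (mm \<alpha>))" by metis
  \<comment> \<open>By (H2) the exponent at \<open>cc r\<close> reads off \<open>\<alpha> r\<close>;
    this makes \<open>mm\<close> injective and later locates a negative exponent.\<close>
  have mm_cc: "mm \<alpha> (cc r) = \<alpha> r" if "r \<in> {1..l}" for \<alpha> r
  proof -
    have "mm \<alpha> (cc r) = (\<Sum>j\<in>{1..l}. \<alpha> j * (if j = r then 1 else 0))"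
      unfolding mm_def using gen that by (intro sum.cong) auto
    then show ?thesis using that by (simp add: if_distrib sum.delta cong: if_cong)
  qed
  have mm_supp: "j \<in> s_infty N \<mu>" if "mm \<alpha> j \<noteq> 0" for \<alpha> j
  proof (rule ccontr)
    assume "j \<notin> s_infty N \<mu>"
    then have "e r j = 0" if "r \<in> {1..l}" for r using e that unfolding supp_def by blast
    then have "mm \<alpha> j = 0" unfolding mm_def by (intro sum.neutral) simp
    then show False using that by simp
  qed
  have mm_zexps: "mm \<alpha> \<in> zexps N" for \<alpha>
    using mm_supp unfolding zexps_def s_infty_def by blast
  obtain U cf where U: "finite U" "U \<subseteq> ?Z ` zexps l" "z = (\<Sum>s\<in>U. \<iota> (emb (cf s)) * s)"
    using z unfolding cen' kspan_def by blast
  then obtain G where G: "G \<subseteq> zexps l" "inj_on ?Z G" "U = ?Z ` G" by (auto simp: subset_image_inj)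
  have finG: "finite G" using U(1) G finite_imageD by blast
  have inj: "inj_on mm G"
  proof (rule inj_onI, rule ext)
    fix \<alpha> \<beta> r assume \<alpha>\<beta>: "\<alpha> \<in> G" "\<beta> \<in> G" "mm \<alpha> = mm \<beta>"
    show "\<alpha> r = \<beta> r"
    proof (cases "r \<in> {1..l}")
      case True then show ?thesis using mm_cc \<alpha>\<beta> by metis
    next
      case False then show ?thesis using \<alpha>\<beta> G(1) unfolding zexps_def by (metis (mono_tags, lifting) mem_Collect_eq subsetD)
    qed
  qed
  define \<psi> where "\<psi> = the_inv_into G mm"
  have \<psi>: "\<psi> (mm \<alpha>) = \<alpha>" if "\<alpha> \<in> G" for \<alpha> unfolding \<psi>_def by (rule the_inv_into_f_f[OF inj that])
  define d where "d m = cf (?Z (\<psi> m)) * q powi \<kappa> (\<psi> m)" for m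
  have "z = (\<Sum>\<alpha>\<in>G. T.sc (cf (?Z \<alpha>)) (?Z \<alpha>))"
    unfolding U(3) G(3) sum.reindex[OF G(2)] by (simp add: T.sc_def)
  also have "\<dots> = (\<Sum>\<alpha>\<in>G. T.sc (d (mm \<alpha>)) (M (mm \<alpha>)))"
    by (intro sum.cong refl) (simp add: d_def \<psi> \<kappa>)
  also have "\<dots> = comb (mm ` G) d" unfolding comb_def sum.reindex[OF inj] by simp
  finally have z_comb: "z = comb (mm ` G) d" .
  have mmG: "finite (mm ` G)" "mm ` G \<subseteq> zexps N" using finG mm_zexps by auto
  show ?thesis
  proof (cases "i \<in> s_infty N \<mu>")
    case False
    then have "mm \<alpha> i = 0" for \<alpha> using mm_supp by blast
    then have "z \<in> L i" unfolding z_comb comb_def using mm_zexps by (intro L_sum L_sc M_in_L) auto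
    then have "z \<in> range \<iota>" using z_L by (intro L_intersection) blast
    then show ?thesis ..
  next
    case True
    have pos: "0 \<le> mm \<alpha> k" if "\<alpha> \<in> G" "d (mm \<alpha>) \<noteq> 0" "k \<noteq> i" for \<alpha> k
    proof (cases "k \<in> s_infty N \<mu>")
      case True
      then have "k \<in> {1..N}" by (simp add: s_infty_def)
      then have "comb (mm ` G) d \<in> L k" using z_L[of k] that(3) z_comb by simp
      then show ?thesis using L_exponents[OF True mmG] that by blast
    next
      case False then show ?thesis using mm_supp[of \<alpha> k] by force
    qed
    show ?thesis
    proof (cases "\<forall>\<alpha>\<in>G. d (mm \<alpha>) \<noteq> 0 \<longrightarrow> 0 \<le> mm \<alpha> i")
      case True
      have "T.sc (d m) (M m) \<in> range \<iota>" if "m \<in> mm ` G" for m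
      proof (cases "d m = 0")
        case True then show ?thesis using \<iota>_0 by (metis T.V.scale_zero_left rangeI)
      next
        case False
        then have "0 \<le> m j" for j using that pos \<open>\<forall>\<alpha>\<in>G. _\<close> by (cases "j = i") auto
        then show ?thesis by (intro range_sc M_nonneg_in)
      qed
      then have "z \<in> range \<iota>" unfolding z_comb comb_def by (intro range_sum)
      then show ?thesis ..
    next
      case False
      then obtain \<alpha> where \<alpha>: "\<alpha> \<in> G" "d (mm \<alpha>) \<noteq> 0" "mm \<alpha> i < 0" by auto
      \<comment> \<open>(H1) makes the generator regular, so \<open>L_exponents\<close> applies at
        every index without successor; elsewhere the exponent is 0.\<close>
      have e_nonneg: "0 \<le> e r j" if r: "r \<in> {1..l}" for r j
      proof (cases "j \<in> s_infty N \<mu>")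
        case True
        have "M (e r) \<in> range \<iota>" using gen r unfolding lmon_eq_M by blast
        then have "comb {e r} (\<lambda>_. 1) \<in> L j" unfolding comb_def by (simp add: range_subset_L)
        then show ?thesis using L_exponents[OF True, of "{e r}" "\<lambda>_. 1" "e r"] e r by simp
      next
        case False then show ?thesis using e r unfolding supp_def by force
      qed
      have "\<exists>r\<in>{1..l}. \<alpha> r < 0"
      proof (rule ccontr)
        assume "\<not> ?thesis"
        then have "0 \<le> \<alpha> r" if "r \<in> {1..l}" for r using that not_le by blast
        then have "0 \<le> mm \<alpha> i" unfolding mm_def using e_nonneg by (intro sum_nonneg mult_nonneg_nonneg)
        then show False using \<alpha>(3) by simp
      qed
      then obtain r where r: "r \<in> {1..l}" "\<alpha> r < 0" by blast
      then have "mm \<alpha> (cc r) < 0" using mm_cc by simp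
      then have i_cc: "i = cc r" using pos[OF \<alpha>(1,2), of "cc r"] by force
      have "e r \<in> zexps N" using e r(1) by blast
      then have "supp (e r) \<subseteq> {1..N}" unfolding supp_def zexps_def by blast
      then have fin: "finite (supp (e r))" by (rule finite_subset) simp
      have i_supp: "e r i = 1" using gen r i_cc by simp
      \<comment> \<open>Otherwise (H3) supplies an index \<open>j \<noteq> i\<close> in the support
        of generator \<open>r\<close> alone. There the exponent is
        \<open>\<alpha> r * e r j < 0\<close>, against \<open>pos\<close>.\<close>
      have "\<not> 2 \<le> card (supp (e r))"
      proof
        assume "2 \<le> card (supp (e r))"
        then have "\<not> (supp (e r) - {cc r} \<subseteq> (\<Union>j\<in>{1..l} - {r}. supp (e j)))"
          using gen[THEN bspec, OF r(1)] by (elim conjE impE)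
        then obtain j where "j \<in> supp (e r) - {cc r}" "j \<notin> (\<Union>j\<in>{1..l} - {r}. supp (e j))"
          using subsetI by metis
        then have j: "j \<in> supp (e r)" "j \<noteq> i" "\<And>r'. r' \<in> {1..l} - {r} \<Longrightarrow> j \<notin> supp (e r')"
          unfolding i_cc by simp_all
        have "mm \<alpha> j = \<alpha> r * e r j"
          unfolding mm_def using r(1) j(3) by (subst sum.remove[OF _ r(1)]) (auto simp: supp_def intro!: sum.neutral)
        moreover have "0 < e r j" using e_nonneg[OF r(1), of j] j(1) by (simp add: supp_def)
        ultimately have "mm \<alpha> j < 0" using r(2) by (simp add: mult_neg_pos)
        then show False using pos[OF \<alpha>(1,2) j(2)] by simp
      qed
      then have "card (supp (e r)) \<le> 1" by simp
      moreover have "i \<in> supp (e r)" using i_supp by (simp add: supp_def)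
      ultimately have "supp (e r) = {i}" using card_le_Suc0_iff_eq[OF fin] by auto
      then have "e r = (\<lambda>j. if j = i then 1 else 0)" using i_supp unfolding supp_def by fastforce
      then have "M (e r) = \<iota> (y i)" using Q.M_single[OF i, of 1] by simp
      moreover have "M (e r) \<in> center"
      proof -
        let ?\<delta> = "\<lambda>j. if j = r then 1 else (0::int)"
        have "?Z ?\<delta> = oprod l (\<lambda>j. if j = r then M (e r) else 1)" by (intro oprod_cong) auto
        then have Z: "?Z ?\<delta> = M (e r)" using Q.oprod_single[OF r(1)] by simp
        have "?\<delta> \<in> zexps l" by (rule single_zexps[OF r(1)])
        then have "?Z ?\<delta> \<in> ?Z ` zexps l" by (rule imageI)
        then have "M (e r) \<in> ?Z ` zexps l" by (simp only: Z)
        then show ?thesis unfolding cen' kspan_def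
          by (intro CollectI exI[of _ "{M (e r)}"] exI[of _ "\<lambda>_. 1"]) (simp add: emb_1 \<iota>_1)
      qed
      ultimately show ?thesis by simp
    qed
  qed
qed

end

section \<open>Weights\<close>

lemma sum_fun_apply: "(\<Sum>j\<in>S. f j) i = (\<Sum>j\<in>S. (f j i :: 'a::comm_monoid_add))"
  by (induction S rule: infinite_finite_induct) auto

lemma square_system_inverse:
  fixes A :: "nat \<Rightarrow> nat \<Rightarrow> 'k::field"
  assumes fin: "finite I" "finite J" and card: "card I = card J"
    and inj: "\<And>\<beta>. (\<And>i. i \<in> I \<Longrightarrow> (\<Sum>j\<in>J. A i j * \<beta> j) = 0) \<Longrightarrow> (\<forall>j\<in>J. \<beta> j = 0)"
  obtains C where "\<And>i i'. i \<in> I \<Longrightarrow> i' \<in> I \<Longrightarrow> (\<Sum>j\<in>J. A i j * C j i') = (if i = i' then 1 else 0)"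
    and "\<And>j j'. j \<in> J \<Longrightarrow> j' \<in> J \<Longrightarrow> (\<Sum>i\<in>I. C j i * A i j') = (if j = j' then 1 else 0)"
proof -
  interpret FV: vector_space "\<lambda>(c::'k) (f::nat \<Rightarrow> 'k) i. c * f i"
    by unfold_locales (auto simp: algebra_simps)
  define col where "col j = (\<lambda>i. if i \<in> I then A i j else 0)" for j
  define E where "E = (\<lambda>i::nat. (\<lambda>i'. if i' = i then 1 else 0 :: 'k)) ` I"
  have zero: "\<forall>j\<in>J. \<beta> j = 0" if "(\<Sum>j\<in>J. (\<lambda>i. \<beta> j * col j i)) = 0" for \<beta>
  proof (rule inj)
    fix i assume "i \<in> I"
    then show "(\<Sum>j\<in>J. A i j * \<beta> j) = 0"
      using fun_cong[OF that, of i] by (simp add: sum_fun_apply col_def mult.commute)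
  qed
  have inj_col: "inj_on col J"
  proof (rule inj_onI, rule ccontr)
    fix j j' assume j: "j \<in> J" "j' \<in> J" "col j = col j'" "j \<noteq> j'"
    let ?\<beta> = "\<lambda>l. if l = j then 1 else if l = j' then - 1 else (0::'k)"
    have "(\<Sum>l\<in>J. ?\<beta> l * col l i) = 0" for i
    proof -
      have "(\<Sum>l\<in>J. ?\<beta> l * col l i) = (\<Sum>l\<in>{j, j'}. ?\<beta> l * col l i)"
        using fin j by (intro sum.mono_neutral_right) auto
      then show ?thesis using j(3,4) by simp
    qed
    then have "(\<Sum>l\<in>J. (\<lambda>i. ?\<beta> l * col l i)) = 0" by (intro ext) (simp add: sum_fun_apply)
    from zero[OF this] show False using j(1) by force
  qed
  have indep: "\<not> FV.dependent (col ` J)"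
  proof
    assume "FV.dependent (col ` J)"
    then obtain g where g: "\<exists>v\<in>col ` J. g v \<noteq> 0" "(\<Sum>v\<in>col ` J. (\<lambda>i. g v * v i)) = 0"
      using FV.dependent_finite[of "col ` J"] fin by auto
    have "(\<Sum>j\<in>J. (\<lambda>i. g (col j) * col j i)) = 0" using g(2) by (simp add: sum.reindex[OF inj_col])
    from zero[OF this] show False using g(1) by auto
  qed
  have col_E: "col j \<in> FV.span E" for j
  proof -
    have "col j = (\<Sum>i\<in>I. (\<lambda>i'. A i j * (if i' = i then 1 else 0)))"
      using fin by (intro ext) (simp add: sum_fun_apply col_def if_distrib sum.delta' cong: if_cong)
    also have "\<dots> \<in> FV.span E"
      by (intro FV.span_sum FV.span_scale FV.span_base) (auto simp: E_def)
    finally show ?thesis .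
  qed
  \<comment> \<open>Dimension count: a vector outside the span of the columns would give
    \<open>card J + 1\<close> independent vectors in a space spanned by at most
    \<open>card I = card J\<close> vectors.\<close>
  have "e \<in> FV.span (col ` J)" if "e \<in> E" for e
  proof (rule ccontr)
    assume not: "e \<notin> FV.span (col ` J)"
    then have "\<not> FV.dependent (insert e (col ` J))" using indep by (simp add: FV.independent_insertI)
    moreover have "insert e (col ` J) \<subseteq> FV.span E" using col_E that FV.span_base by auto
    ultimately have "card (insert e (col ` J)) \<le> card E"
      using FV.independent_span_bound[of E] fin by (simp add: E_def)
    moreover have "card E \<le> card I" unfolding E_def by (rule card_image_le[OF fin(1)])
    moreover have "e \<notin> col ` J" using not FV.span_base by blast
    then have "card (insert e (col ` J)) = Suc (card J)" using fin by (simp add: card_image[OF inj_col])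
    ultimately show False using card by simp
  qed
  then have "\<exists>g. (\<lambda>i'. if i' = i then 1 else 0) = (\<Sum>j\<in>J. (\<lambda>i'. g j * col j i'))" if "i \<in> I" for i
  proof -
    have "(\<lambda>i'. if i' = i then 1 else 0) \<in> FV.span (col ` J)"
      using \<open>\<And>e. e \<in> E \<Longrightarrow> _\<close> that by (simp add: E_def)
    then obtain h where "(\<lambda>i'. if i' = i then 1 else 0) = (\<Sum>v\<in>col ` J. (\<lambda>i'. h v * v i'))"
      using FV.span_finite[of "col ` J"] fin by auto
    then show ?thesis by (intro exI[of _ "\<lambda>j. h (col j)"]) (simp add: sum.reindex[OF inj_col])
  qed
  then obtain g where g: "\<And>i. i \<in> I \<Longrightarrow> (\<lambda>i'. if i' = i then 1 else 0) = (\<Sum>j\<in>J. (\<lambda>i'. g i j * col j i'))"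
    by metis
  have left: "(\<Sum>j\<in>J. A i j * g i' j) = (if i = i' then 1 else 0)" if "i \<in> I" "i' \<in> I" for i i'
    using fun_cong[OF g[OF that(2)], of i] that by (simp add: sum_fun_apply col_def mult.commute)
  have right: "(\<Sum>i\<in>I. g i j * A i j') = (if j = j' then 1 else 0)" if j: "j \<in> J" "j' \<in> J" for j j'
  proof -
    \<comment> \<open>Column \<open>j'\<close> of the product of the candidate inverse with
      \<open>A\<close>, minus the identity. \<open>A\<close> annihilates it by \<open>left\<close>,
      so \<open>inj\<close> makes it zero.\<close>
    let ?\<beta> = "\<lambda>j. (\<Sum>i\<in>I. g i j * A i j') - (if j = j' then 1 else 0)"
    have "(\<Sum>j\<in>J. A i j * ?\<beta> j) = 0" if i: "i \<in> I" for i
    proof -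
      have "(\<Sum>j\<in>J. A i j * (\<Sum>i'\<in>I. g i' j * A i' j')) = (\<Sum>i'\<in>I. (\<Sum>j\<in>J. A i j * g i' j) * A i' j')"
      proof -
        have "(\<Sum>j\<in>J. A i j * (\<Sum>i'\<in>I. g i' j * A i' j')) = (\<Sum>j\<in>J. \<Sum>i'\<in>I. A i j * g i' j * A i' j')"
          by (simp add: sum_distrib_left mult.assoc)
        also have "\<dots> = (\<Sum>i'\<in>I. \<Sum>j\<in>J. A i j * g i' j * A i' j')" by (rule sum.swap)
        finally show ?thesis by (simp add: sum_distrib_right)
      qed
      also have "\<dots> = (\<Sum>i'\<in>I. if i = i' then A i' j' else 0)"
        using left[OF i] by (intro sum.cong) auto
      also have "\<dots> = A i j'" using i fin by (simp add: sum.delta)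
      finally have "(\<Sum>j\<in>J. A i j * (\<Sum>i'\<in>I. g i' j * A i' j')) = A i j'" .
      moreover have "(\<Sum>j\<in>J. A i j * (if j = j' then 1 else 0)) = A i j'"
        using that j fin by (simp add: if_distrib sum.delta' cong: if_cong)
      ultimately show ?thesis by (simp add: right_diff_distrib sum_subtractf)
    qed
    then have "\<forall>j\<in>J. ?\<beta> j = 0" by (rule inj)
    then show ?thesis using j by auto
  qed
  show ?thesis by (rule that[of "\<lambda>j i. g i j"]) (use left right in auto)
qed

text \<open>The field is a rational vector space; apply a rational linear functional that is nonzero at \<open>\<beta> l0\<close> and
  clear denominators.\<close>

lemma integer_annihilator:
  fixes \<beta> :: "nat \<Rightarrow> 'k::field_char_0" and w :: "'i \<Rightarrow> nat \<Rightarrow> int"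
  assumes "l0 < n" "\<beta> l0 \<noteq> 0" and ann: "\<And>i. i \<in> I \<Longrightarrow> (\<Sum>l<n. of_int (w i l) * \<beta> l) = 0"
  obtains \<nu> :: "nat \<Rightarrow> int" where "\<nu> l0 \<noteq> 0" "\<And>i. i \<in> I \<Longrightarrow> (\<Sum>l<n. w i l * \<nu> l) = 0"
proof -
  interpret P: vector_space_pair "\<lambda>(r::rat) (s::'k). of_rat r * s" "(*) :: rat \<Rightarrow> rat \<Rightarrow> rat"
    by unfold_locales (auto simp: algebra_simps of_rat_add of_rat_mult)
  have "\<not> P.vs1.dependent {\<beta> l0}" using assms(2) by simp
  then obtain g where lin: "Vector_Spaces.linear (\<lambda>(r::rat) (s::'k). of_rat r * s) (*) g"
    and g: "\<forall>s\<in>{\<beta> l0}. g s = 1"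
    using P.linear_independent_extend[of "{\<beta> l0}" "\<lambda>_. 1"] by blast
  interpret g: Vector_Spaces.linear "\<lambda>(r::rat) (s::'k). of_rat r * s" "(*)" g by (rule lin)
  have g_int: "g (of_int k * s) = of_int k * g s" for k s
    using g.scale[of "of_int k" s] by simp
  have g_ann: "(\<Sum>l<n. of_int (w i l) * g (\<beta> l)) = 0" if "i \<in> I" for i
    using ann[OF that] g.sum[of "\<lambda>l. of_int (w i l) * \<beta> l" "{..<n}"] by (simp add: g_int)
  have "\<exists>d>0. \<forall>l<m. \<exists>k::int. of_int d * g (\<beta> l) = of_int k" for m
  proof (induction m)
    case 0 then show ?case by (intro exI[of _ 1]) simp
  next
    case (Suc m)
    then obtain d where d: "d > 0" "\<forall>l<m. \<exists>k::int. of_int d * g (\<beta> l) = of_int k" by blast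
    obtain p' q' where pq: "quotient_of (g (\<beta> m)) = (p', q')" by fastforce
    then have q': "q' > 0" "g (\<beta> m) = of_int p' / of_int q'"
      using quotient_of_denom_pos quotient_of_div by blast+
    have "\<exists>k::int. of_int (d * q') * g (\<beta> l) = of_int k" if "l < Suc m" for l
    proof (cases "l = m")
      case True
      have "of_int (d * q') * g (\<beta> m) = of_int (d * p')" using q' by simp
      then show ?thesis using True by blast
    next
      case False
      then obtain k where "of_int d * g (\<beta> l) = of_int k" using d(2) \<open>l < Suc m\<close> less_SucE by blast
      then have "of_int (d * q') * g (\<beta> l) = of_int (k * q')"
        by (simp add: mult.assoc mult.commute[of "of_int q'"] mult.left_commute)
      then show ?thesis by blast
    qed
    then show ?case using d(1) q'(1) by (intro exI[of _ "d * q'"]) auto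
  qed
  then obtain d where d: "d > 0" "\<forall>l<n. \<exists>k::int. of_int d * g (\<beta> l) = of_int k" by blast
  then obtain \<nu> :: "nat \<Rightarrow> int" where \<nu>: "\<And>l. l < n \<Longrightarrow> of_int d * g (\<beta> l) = of_int (\<nu> l)" by metis
  have "(of_int (\<nu> l0) :: rat) = of_int d" using \<nu>[OF assms(1)] g by simp
  then have "\<nu> l0 \<noteq> 0" using d(1) by simp
  moreover have "(\<Sum>l<n. w i l * \<nu> l) = 0" if "i \<in> I" for i
  proof -
    have "(of_int (\<Sum>l<n. w i l * \<nu> l) :: rat) = (\<Sum>l<n. of_int d * (of_int (w i l) * g (\<beta> l)))"
      using \<nu> by (auto simp flip: \<nu> intro!: sum.cong)
    also have "\<dots> = 0" unfolding sum_distrib_left[symmetric] g_ann[OF that] by simp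
    finally show ?thesis using of_int_eq_0_iff by blast
  qed
  ultimately show ?thesis using that by blast
qed

text \<open>In characteristic 0 the scalar 2 has infinite order, so points of the torus with powers
  of 2 as coordinates can test characters.\<close>

lemma two_powi_eq_1: "(2::'k::field_char_0) powi k = 1 \<longleftrightarrow> k = 0"
proof
  assume "(2::'k) powi k = 1"
  then have "(2::'k) ^ nat \<bar>k\<bar> = 1" by (cases "0 \<le> k") (simp_all add: power_int_def power_inverse power_one_over)
  then have "of_nat (2 ^ nat \<bar>k\<bar>) = (of_nat 1 :: 'k)" by simp
  then have "(2::nat) ^ nat \<bar>k\<bar> = 1" unfolding of_nat_eq_iff .
  then show "k = 0" by simp
qed simp

lemma chi_add:
  assumes "h \<in> Htor n"
  shows "chi n h (\<lambda>l. w l + w' l) = chi n h w * chi n h w'"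
  using assms unfolding chi_def Htor_def by (simp add: power_int_add flip: prod.distrib)

lemma Qset_add: "w \<in> Qset n \<Longrightarrow> w' \<in> Qset n \<Longrightarrow> (\<lambda>l. w l + w' l) \<in> Qset n"
  by (simp add: Qset_def)

lemma chi_inj:
  assumes w: "w \<in> Qset n" "w' \<in> Qset n"
    and eq: "\<And>h. h \<in> Htor n \<Longrightarrow> chi n h w = (chi n h w' :: 'k::field_char_0)"
  shows "w = w'"
proof
  fix l
  show "w l = w' l"
  proof (cases "l < n")
    case True
    let ?h = "\<lambda>i. if i = l then 2 else (1::'k)"
    have "?h \<in> Htor n" using True by (simp add: Htor_def)
    moreover have "chi n ?h v = 2 powi v l" for v
    proof -
      have "chi n ?h v = (\<Prod>i<n. if i = l then 2 powi v l else 1)" unfolding chi_def by (intro prod.cong) auto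
      then show ?thesis using True by (simp add: prod.delta')
    qed
    ultimately have "(2::'k) powi w l = 2 powi w' l" using eq by metis
    then have "(2::'k) powi (w l - w' l) = 1" by (simp add: power_int_diff)
    then show ?thesis unfolding two_powi_eq_1 by simp
  next
    case False then show ?thesis using w by (simp add: Qset_def)
  qed
qed

section \<open>Homogeneous elements and their weights\<close>

context gy_tower
begin

lemma act_aut:
  assumes "h \<in> Htor n"
  shows "act h (r + s) = act h r + act h s" "act h (r * s) = act h r * act h s" "act h (emb d) = emb d"
  using torus assms unfolding rational_torus_action_def kalg_aut_def by blast+

lemma act_sc: "h \<in> Htor n \<Longrightarrow> act h (sc d r) = sc d (act h r)"
  by (simp add: sc_def act_aut)

lemma act_0: "h \<in> Htor n \<Longrightarrow> act h 0 = 0"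
  using act_aut(3)[of h 0] by (simp add: emb_0)

lemma act_diff: "h \<in> Htor n \<Longrightarrow> act h (r - s) = act h r - act h s"
  using act_aut(1)[of h "r - s" s] by simp

lemma act_sum: "h \<in> Htor n \<Longrightarrow> act h (sum f F) = (\<Sum>i\<in>F. act h (f i))"
  by (induction F rule: infinite_finite_induct) (auto simp: act_0 act_aut)

lemma homog_act: "homog emb n act w r \<longleftrightarrow> w \<in> Qset n \<and> (\<forall>h\<in>Htor n. act h r = sc (chi n h w) r)"
  by (simp add: homog_def sc_def)

lemma homog_unique:
  assumes "homog emb n act w r" "homog emb n act w' r" "r \<noteq> 0"
  shows "w = w'"
proof (rule chi_inj[where 'k = 'k])
  show "chi n h w = chi n h w'" if "h \<in> Htor n" for h :: "nat \<Rightarrow> 'k"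
  proof -
    have "act h r = sc (chi n h w) r" "act h r = sc (chi n h w') r"
      using assms(1,2) that unfolding homog_act by blast+
    then show ?thesis using assms(3) by simp
  qed
qed (use assms in \<open>auto simp: homog_act\<close>)

lemma homog_mult:
  assumes "homog emb n act w r" "homog emb n act w' s"
  shows "homog emb n act (\<lambda>l. w l + w' l) (r * s)"
  using assms unfolding homog_act by (auto simp: act_aut chi_add Qset_add mult.commute)

lemma homog_1: "homog emb n act (\<lambda>_. 0) 1"
  unfolding homog_act using act_aut(3)[of _ 1] by (auto simp: emb_1 chi_def Qset_def)

definition wt_x :: "nat \<Rightarrow> nat \<Rightarrow> int" where "wt_x i = (SOME w. homog emb n act w (x i))"
definition wt_y :: "nat \<Rightarrow> nat \<Rightarrow> int" where "wt_y i = (SOME w. homog emb n act w (y i))"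
definition wt_mono :: "nat \<Rightarrow> (nat \<Rightarrow> nat) \<Rightarrow> nat \<Rightarrow> int" where
  "wt_mono k e = (\<lambda>l. \<Sum>j\<in>{1..k}. int (e j) * wt_x j l)"

lemma homog_x: "i \<in> {1..N} \<Longrightarrow> homog emb n act (wt_x i) (x i)"
  using x_homog[of i] unfolding wt_x_def is_homog_def by (rule someI_ex)

lemma homog_y: "i \<in> {1..N} \<Longrightarrow> homog emb n act (wt_y i) (y i)"
  using y_homog[of i] unfolding wt_y_def is_homog_def by (rule someI_ex)

text \<open>The predicate is abstract because one induction serves three purposes: homogeneity of
  monomials, vanishing of a functional on their weights, and the formula for a derivation on them.
  Generators are required only where the exponent is nonzero, which covers monomials in the earlier
  variables alone.\<close>

lemma graded_monomial:
  assumes one: "P (\<lambda>_. 0) 1"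
    and mult: "\<And>w r w' s. P w r \<Longrightarrow> P w' s \<Longrightarrow> P (\<lambda>l. w l + w' l) (r * s)"
    and gens: "\<And>j. j \<in> {1..k} \<Longrightarrow> e j \<noteq> 0 \<Longrightarrow> P (wt_x j) (x j)"
  shows "P (wt_mono k e) (oprod k (\<lambda>j. x j ^ e j))"
  using gens
proof (induction k)
  case 0 then show ?case using one by (simp add: wt_mono_def)
next
  case (Suc k)
  have gen: "P (wt_x (Suc k)) (x (Suc k))" if "e (Suc k) \<noteq> 0" using Suc.prems that by simp
  have "P (\<lambda>l. int d * wt_x (Suc k) l) (x (Suc k) ^ d)" if "d \<le> e (Suc k)" for d
    using that
  proof (induction d)
    case 0 then show ?case using one by simp
  next
    case (Suc d)
    then have "P (\<lambda>l. int d * wt_x (Suc k) l + wt_x (Suc k) l) (x (Suc k) ^ d * x (Suc k))"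
      using gen by (intro mult) auto
    then show ?case by (simp add: algebra_simps power_commutes)
  qed
  then have "P (\<lambda>l. wt_mono k e l + int (e (Suc k)) * wt_x (Suc k) l) (oprod k (\<lambda>j. x j ^ e j) * x (Suc k) ^ e (Suc k))"
    using Suc by (intro mult) auto
  then show ?case by (simp add: wt_mono_def add.commute)
qed

lemma graded_omon:
  assumes "P (\<lambda>_. 0) 1"
    and "\<And>w r w' s. P w r \<Longrightarrow> P w' s \<Longrightarrow> P (\<lambda>l. w l + w' l) (r * s)"
    and "\<And>j. j \<in> {1..N} \<Longrightarrow> e j \<noteq> 0 \<Longrightarrow> P (wt_x j) (x j)"
  shows "P (wt_mono N e) (omon x N e)"
  unfolding omon_def by (rule graded_monomial[of P, OF assms])

lemma homog_omon: "homog emb n act (wt_mono N e) (omon x N e)"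
  by (rule graded_omon[of "homog emb n act"]) (auto intro: homog_1 homog_mult homog_x)

text \<open>Comparing the action of \<open>h\<close> on each monomial with its action on the whole
  sum gives equal character values wherever the coefficient is nonzero, by independence of the
  monomials; characters are separated by points of the torus.\<close>

lemma homog_component_weight:
  assumes F: "finite F" "F \<subseteq> nexps N" and hom: "homog emb n act w (mono_comb F d)"
    and e: "e \<in> F" "d e \<noteq> 0"
  shows "wt_mono N e = w"
proof (rule chi_inj[where 'k = 'k])
  fix h :: "nat \<Rightarrow> 'k" assume h: "h \<in> Htor n"
  have "act h (mono_comb F d) = mono_comb F (\<lambda>e. d e * chi n h (wt_mono N e))"
    using homog_omon h unfolding homog_act mono_comb_def by (simp add: act_sum act_sc)
  moreover have "act h (mono_comb F d) = mono_comb F (\<lambda>e. d e * chi n h w)"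
    using hom h unfolding homog_act by (simp add: mono_comb_def V.scale_sum_right mult.commute)
  ultimately have "mono_comb F (\<lambda>e. d e * chi n h (wt_mono N e) - d e * chi n h w) = 0"
    by (simp add: mono_comb_def V.scale_left_diff_distrib sum_subtractf)
  from mono_comb_eq_0[OF F this e(1)] show "chi n h (wt_mono N e) = chi n h w" using e(2) by simp
qed (use hom homog_omon in \<open>auto simp: homog_act\<close>)

lemma wt_y_None: "i \<in> {1..N} \<Longrightarrow> pred_idx \<mu> i = None \<Longrightarrow> wt_y i = wt_x i"
  using homog_unique[OF homog_y, of i "wt_x i"] homog_x[of i] y_eq_x[of i] y_nonzero[of i] by simp

lemma act_R: "h \<in> Htor n \<Longrightarrow> l \<le> N \<Longrightarrow> r \<in> R l \<Longrightarrow> act h r \<in> R l"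
proof -
  assume h: "h \<in> Htor n" and l: "l \<le> N" and "r \<in> R l"
  from this(3) show ?thesis unfolding Rsub_def
  proof induction
    case (scal d) then show ?case using act_aut(3)[OF h] by (simp add: subalg.scal)
  next
    case (gen s)
    then obtain j where j: "j \<in> {1..l}" "s = x j" by blast
    then have "j \<in> {1..N}" using l by auto
    then have "act h s = sc (chi n h (wt_x j)) s" using homog_x[of j] h j(2) by (simp add: homog_act)
    then show ?case using gen subalg_sc subalg.gen by metis
  next
    case (add r s) then show ?case by (simp add: act_aut(1)[OF h] subalg.add)
  next
    case (mult r s) then show ?case by (simp add: act_aut(2)[OF h] subalg.mult)
  next
    case (neg r)
    have "act h (- r) = - act h r" using act_diff[OF h, of 0 r] act_0[OF h] by simp
    then show ?case using neg by (simp add: subalg.neg)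
  qed
qed

text \<open>The products \<open>y p * x i\<close> and the elements \<open>y i\<close> are both
  scaled by the torus, and their difference \<open>c i\<close> stays in \<open>R (i - 1)\<close>
  under it. Comparing coefficients of \<open>x i\<close> equates the two characters, and comparing
  the rest shows that \<open>c i\<close> has the same weight.\<close>

lemma wt_y_Some:
  assumes i: "i \<in> {1..N}" and p: "pred_idx \<mu> i = Some p"
  shows "wt_y i = (\<lambda>l. wt_y p l + wt_x i l)" "homog emb n act (wt_y i) (c i)"
proof -
  have pN: "p \<in> {1..N}" using pred_in[OF i p] by blast
  have yp: "y p \<noteq> 0" using y_nonzero[OF pN] .
  have *: "chi n h (\<lambda>l. wt_y p l + wt_x i l) = chi n h (wt_y i) \<and> act h (c i) = sc (chi n h (wt_y i)) (c i)"
    if h: "h \<in> Htor n" for h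
  proof -
    let ?\<omega> = "chi n h (wt_y i)" and ?\<rho> = "chi n h (\<lambda>l. wt_y p l + wt_x i l)"
    have yx: "act h (y p * x i) = sc ?\<rho> (y p * x i)"
      using homog_mult[OF homog_y[OF pN] homog_x[OF i]] h unfolding homog_act by blast
    have "c i = y p * x i - y i" by (simp add: c_def u_eq[OF i p])
    then have "act h (c i) = sc ?\<rho> (y p * x i) - sc ?\<omega> (y i)"
      using homog_y[OF i] h yx by (simp add: act_diff homog_act)
    then have "sc ?\<rho> (y p) * x i ^ 1 + - act h (c i) = sc ?\<omega> (y p) * x i ^ 1 + - sc ?\<omega> (c i)"
      by (simp add: y_eq[of i] u_eq[OF i p] V.scale_right_diff_distrib)
    moreover have "i - 1 \<le> N" using i by auto
    then have "- act h (c i) \<in> Fil i 1" "- sc ?\<omega> (c i) \<in> Fil i 1"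
      unfolding Fil_1 using act_R[OF h _ c_in[OF i]] by (auto intro!: R_neg R_sc c_in[OF i, simplified])
    ultimately have "sc ?\<rho> (y p) = sc ?\<omega> (y p) \<and> - act h (c i) = - sc ?\<omega> (c i)"
      by (intro Fil_unique[OF i R_sc[OF p_in(3)[OF i p]] R_sc[OF p_in(3)[OF i p]]])
    then show ?thesis using yp V.scale_right_imp_eq by auto
  qed
  show "wt_y i = (\<lambda>l. wt_y p l + wt_x i l)"
    using * homog_y[OF i] homog_mult[OF homog_y[OF pN] homog_x[OF i]]
    by (intro chi_inj[where 'k = 'k]) (auto simp: homog_act)
  show "homog emb n act (wt_y i) (c i)" using * homog_y[OF i] by (simp add: homog_act)
qed

section \<open>Weights of the generators without predecessor\<close>

definition weight_functional :: "(nat \<Rightarrow> 'k) \<Rightarrow> (nat \<Rightarrow> int) \<Rightarrow> 'k" where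
  "weight_functional \<beta> w = (\<Sum>l<n. of_int (w l) * \<beta> l)"

lemma weight_functional_add: "weight_functional \<beta> (\<lambda>l. w l + w' l) = weight_functional \<beta> w + weight_functional \<beta> w'"
  by (simp add: weight_functional_def distrib_right sum.distrib)

definition initial_idx :: "nat set" where "initial_idx = {i \<in> {1..N}. pred_idx \<mu> i = None}"

text \<open>For \<open>i\<close> with predecessor \<open>p\<close>, the remainder \<open>c i\<close>
  is nonzero, has the weight of \<open>y i\<close>, and involves only generators before
  \<open>x i\<close>. So the weight of \<open>y i\<close> is a sum of earlier weights, and that of
  \<open>x i\<close> is its difference with the weight of \<open>y p\<close>.\<close>

lemma weight_functional_vanishes:
  assumes "\<And>i. i \<in> initial_idx \<Longrightarrow> weight_functional \<beta> (wt_x i) = 0"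
  shows "i \<in> {1..N} \<Longrightarrow> weight_functional \<beta> (wt_x i) = 0 \<and> weight_functional \<beta> (wt_y i) = 0"
proof (induction i rule: less_induct)
  case (less i)
  show ?case
  proof (cases "pred_idx \<mu> i")
    case None
    then show ?thesis using assms[of i] less.prems wt_y_None by (simp add: initial_idx_def)
  next
    case (Some p)
    have p: "p \<in> {1..N}" "p < i" using pred_in[OF less.prems Some] by auto
    have c0: "c i \<noteq> 0" using c_not_mult[OF less.prems Some] multsI[OF R_0_in, of "y p" "i - 1"] by auto
    obtain F d where F: "finite F" "F \<subseteq> nexps (i - 1)" "c i = mono_comb F d"
      using R_mono_comb[of "i - 1" "c i"] c_in[OF less.prems] less.prems by (meson atLeastAtMost_iff diff_le_self le_trans)
    have "\<exists>e\<in>F. d e \<noteq> 0"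
    proof (rule ccontr)
      assume "\<not> ?thesis"
      then have "mono_comb F d = 0" unfolding mono_comb_def by (intro sum.neutral) simp
      then show False using c0 F(3) by simp
    qed
    then obtain e where e: "e \<in> F" "d e \<noteq> 0" by blast
    have "i - 1 \<le> N" using less.prems by auto
    then have "F \<subseteq> nexps N" using F(2) nexps_mono by blast
    then have "wt_mono N e = wt_y i" using homog_component_weight[of F "wt_y i" d e] wt_y_Some(2)[OF less.prems Some] F e by simp
    moreover have "weight_functional \<beta> (wt_mono N e) = 0"
    proof (rule graded_monomial[of "\<lambda>w r. weight_functional \<beta> w = 0" N e])
      fix j assume j: "j \<in> {1..N}" "e j \<noteq> 0"
      then have "j \<in> {1..i - 1}" using F(2) e(1) unfolding nexps_def by blast
      then have "j < i" by auto
      then show "weight_functional \<beta> (wt_x j) = 0" using less.IH j(1) by blast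
    qed (simp_all add: weight_functional_add, simp add: weight_functional_def)
    ultimately have "weight_functional \<beta> (wt_y i) = 0" by simp
    then show ?thesis using wt_y_Some(1)[OF less.prems Some] weight_functional_add less.IH[OF p(2,1)] by simp
  qed
qed

lemma act_id:
  assumes h: "h \<in> Htor n" and fixed: "\<And>i. i \<in> {1..N} \<Longrightarrow> act h (x i) = x i"
  shows "act h = id"
proof
  fix r :: 'r
  have "r \<in> subalg emb (x ` {1..N})" using R_N by (simp add: Rsub_def)
  then have "act h r = r"
  proof induction
    case (neg r)
    have "act h (- r) = - act h r" using act_diff[OF h, of 0 r] act_0[OF h] by simp
    then show ?case using neg by simp
  qed (auto simp: act_aut[OF h] fixed)
  then show "act h r = id r" by simp
qed

text \<open>A functional that is nonzero at \<open>l\<close> and kills the initial weights kills all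
  weights. \<open>integer_annihilator\<close> replaces it by an integral one, \<open>\<nu>\<close>;
  the torus element with coordinates \<open>2 powi \<nu> l\<close> then fixes every generator
  without being the identity, against faithfulness.\<close>

lemma weight_functional_separates:
  assumes "\<And>i. i \<in> initial_idx \<Longrightarrow> weight_functional \<beta> (wt_x i) = 0" and "l < n"
  shows "\<beta> l = 0"
proof (rule ccontr)
  assume "\<beta> l \<noteq> 0"
  have "(\<Sum>l<n. of_int (wt_x i l) * \<beta> l) = 0" if "i \<in> {1..N}" for i
    using weight_functional_vanishes[OF assms(1) that] by (simp add: weight_functional_def)
  then obtain \<nu> :: "nat \<Rightarrow> int" where \<nu>: "\<nu> l \<noteq> 0" "\<And>i. i \<in> {1..N} \<Longrightarrow> (\<Sum>l<n. wt_x i l * \<nu> l) = 0"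
    using integer_annihilator[of l n \<beta> "{1..N}" wt_x] \<open>l < n\<close> \<open>\<beta> l \<noteq> 0\<close> by metis
  let ?h = "\<lambda>l. if l < n then 2 powi \<nu> l else (1::'k)"
  have h: "?h \<in> Htor n" by (simp add: Htor_def)
  have "act ?h (x i) = x i" if i: "i \<in> {1..N}" for i
  proof -
    have two: "(\<Prod>l\<in>S. (2::'k) powi f l) = 2 powi (\<Sum>l\<in>S. f l)" if "finite S" for S and f :: "nat \<Rightarrow> int"
      using that by (induction S rule: finite_induct) (simp_all add: power_int_add)
    have "chi n ?h (wt_x i) = (\<Prod>l<n. 2 powi (wt_x i l * \<nu> l))"
      unfolding chi_def by (intro prod.cong) (simp_all add: power_int_mult mult.commute)
    also have "\<dots> = 1" using two[of "{..<n}"] \<nu>(2)[OF i] by simp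
    finally show ?thesis using homog_x[OF i] h unfolding homog_act by simp
  qed
  then have "act ?h = id" by (rule act_id[OF h])
  then have "?h = (\<lambda>i. 1)" by (rule faithful[OF h])
  then have "(2::'k) powi \<nu> l = 1" using \<open>l < n\<close> by (metis (mono_tags))
  then show False using two_powi_eq_1 \<nu>(1) by blast
qed

text \<open>Indices without predecessor are the first occurrences of the values of
  \<open>\<mu>\<close>, one for each value.\<close>

lemma card_initial_idx: "card initial_idx = n"
proof -
  have "bij_betw \<mu> initial_idx {1..n}"
  proof (rule bij_betw_imageI)
    show "inj_on \<mu> initial_idx"
    proof (rule inj_onI)
      fix i j assume "i \<in> initial_idx" "j \<in> initial_idx" "\<mu> i = \<mu> j"
      then show "i = j"
        using pred_idx_NoneD[of \<mu> i j] pred_idx_NoneD[of \<mu> j i] unfolding initial_idx_def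
        by (cases i j rule: linorder_cases) auto
    qed
    show "\<mu> ` initial_idx = {1..n}"
    proof
      show "\<mu> ` initial_idx \<subseteq> {1..n}" using \<mu>_image by (auto simp: initial_idx_def)
      show "{1..n} \<subseteq> \<mu> ` initial_idx"
      proof
        fix t assume "t \<in> {1..n}"
        then have "\<exists>i. i \<in> {1..N} \<and> \<mu> i = t" using \<mu>_image by (metis imageE)
        define i where "i = (LEAST i. i \<in> {1..N} \<and> \<mu> i = t)"
        have i: "i \<in> {1..N} \<and> \<mu> i = t" unfolding i_def by (rule LeastI_ex) fact
        have "pred_idx \<mu> i = None"
        proof (rule ccontr)
          assume "pred_idx \<mu> i \<noteq> None"
          then obtain p where "pred_idx \<mu> i = Some p" by blast
          then have "p < i" "p \<in> {1..N} \<and> \<mu> p = t" using pred_idx_SomeD[of \<mu> i p] i by auto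
          then show False unfolding i_def using not_less_Least by blast
        qed
        then show "t \<in> \<mu> ` initial_idx" using i unfolding initial_idx_def by blast
      qed
    qed
  qed
  then show ?thesis using bij_betw_same_card by fastforce
qed

lemma finite_initial_idx: "finite initial_idx"
  by (simp add: initial_idx_def)

text \<open>Invertibility over K is enough, since homomorphisms into the center take values in a
  K-vector space. The first relation constructs such a homomorphism with prescribed values on the
  initial weights, the second shows that these values determine it.\<close>

lemma weight_matrix_inverse:
  obtains C :: "nat \<Rightarrow> nat \<Rightarrow> 'k" where
    "\<And>i i'. i \<in> initial_idx \<Longrightarrow> i' \<in> initial_idx \<Longrightarrow> (\<Sum>l<n. of_int (wt_x i l) * C l i') = (if i = i' then 1 else 0)"
    and "\<And>l l'. l < n \<Longrightarrow> l' < n \<Longrightarrow> (\<Sum>i\<in>initial_idx. C l i * of_int (wt_x i l')) = (if l = l' then 1 else 0)"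
proof -
  have "\<forall>l\<in>{..<n}. \<beta> l = 0" if "\<And>i. i \<in> initial_idx \<Longrightarrow> (\<Sum>l\<in>{..<n}. of_int (wt_x i l) * \<beta> l) = 0" for \<beta> :: "nat \<Rightarrow> 'k"
    using weight_functional_separates[of \<beta>] that unfolding weight_functional_def by blast
  then obtain C :: "nat \<Rightarrow> nat \<Rightarrow> 'k" where
    C1: "\<And>i i'. i \<in> initial_idx \<Longrightarrow> i' \<in> initial_idx \<Longrightarrow> (\<Sum>l\<in>{..<n}. of_int (wt_x i l) * C l i') = (if i = i' then 1 else 0)" and
    C2: "\<And>l l'. l \<in> {..<n} \<Longrightarrow> l' \<in> {..<n} \<Longrightarrow> (\<Sum>i\<in>initial_idx. C l i * of_int (wt_x i l')) = (if l = l' then 1 else 0)"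
    using square_system_inverse[OF finite_initial_idx finite_lessThan, of n "\<lambda>i l. of_int (wt_x i l)"] card_initial_idx by auto
  show ?thesis by (rule that[OF C1 C2]) simp_all
qed

lemma additive_weight_function:
  fixes \<omega> :: "(nat \<Rightarrow> int) \<Rightarrow> 'r"
  assumes add: "\<And>w w'. w \<in> Qset n \<Longrightarrow> w' \<in> Qset n \<Longrightarrow> \<omega> (\<lambda>l. w l + w' l) = \<omega> w + \<omega> w'"
    and w: "w \<in> Qset n"
  shows "\<omega> w = (\<Sum>l<n. sc (of_int (w l)) (\<omega> (\<lambda>i. if i = l then 1 else 0)))"
proof -
  have unit: "(\<lambda>i. if i = l then k else 0) \<in> Qset n" if "l < n" for l k using that by (simp add: Qset_def)
  have zero: "\<omega> (\<lambda>_. 0) = 0" using add[of "\<lambda>_. 0" "\<lambda>_. 0"] by (simp add: Qset_def)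
  have scale: "\<omega> (\<lambda>i. if i = l then k else 0) = sc (of_int k) (\<omega> (\<lambda>i. if i = l then 1 else 0))" if l: "l < n" for l k
  proof (induction k rule: int_induct[of _ 0])
    case base show ?case using zero by simp
  next
    case (step1 k)
    have "(\<lambda>i. if i = l then k + 1 else 0) = (\<lambda>i. (if i = l then k else 0) + (if i = l then 1 else 0))" by auto
    then show ?case using add[OF unit[OF l] unit[OF l], of k 1] step1 by (simp add: V.scale_left_distrib)
  next
    case (step2 k)
    have "(\<lambda>i. if i = l then k else 0) = (\<lambda>i. (if i = l then k - 1 else 0) + (if i = l then 1 else 0))" by auto
    then have "\<omega> (\<lambda>i. if i = l then k else 0) = \<omega> (\<lambda>i. if i = l then k - 1 else 0) + \<omega> (\<lambda>i. if i = l then 1 else 0)"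
      using add[OF unit[OF l] unit[OF l], of "k - 1" 1] by simp
    then show ?case using step2(2) by (simp add: V.scale_left_diff_distrib)
  qed
  have partial: "\<omega> (\<lambda>i. if i < m then w i else 0) = (\<Sum>l<m. sc (of_int (w l)) (\<omega> (\<lambda>i. if i = l then 1 else 0)))" if "m \<le> n" for m
    using that
  proof (induction m)
    case 0 then show ?case using zero by simp
  next
    case (Suc m)
    have "(\<lambda>i. if i < Suc m then w i else 0) = (\<lambda>i. (if i < m then w i else 0) + (if i = m then w m else 0))" by auto
    moreover have "(\<lambda>i. if i < m then w i else 0) \<in> Qset n" using Suc.prems by (simp add: Qset_def)
    ultimately have "\<omega> (\<lambda>i. if i < Suc m then w i else 0) = \<omega> (\<lambda>i. if i < m then w i else 0) + \<omega> (\<lambda>i. if i = m then w m else 0)"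
      using add unit[of m "w m"] Suc.prems by simp
    then show ?case using Suc scale[of m "w m"] by simp
  qed
  have "(\<lambda>i. if i < n then w i else 0) = w" using w by (auto simp: Qset_def)
  then show ?thesis using partial[OF order_refl] by simp
qed

end

section \<open>Derivations of the quantum nilpotent algebra\<close>

lemma center_mult:
  fixes z z' :: "'a::ring_1"
  assumes "z \<in> center" "z' \<in> center"
  shows "z * z' \<in> center"
proof -
  have z: "z * r = r * z" "z' * r = r * z'" for r using assms by (simp_all add: center_def)
  have "z * z' * r = r * (z * z')" for r
  proof -
    have "z * z' * r = z * (r * z')" unfolding mult.assoc z(2)[of r] ..
    also have "\<dots> = r * z * z'" unfolding mult.assoc[symmetric] z(1)[of r] ..
    finally show ?thesis by (simp only: mult.assoc)
  qed
  then show ?thesis by (simp add: center_def)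
qed

context torus_tower
begin

lemma center_sc: "z \<in> center \<Longrightarrow> sc d z \<in> center"
  by (simp add: center_def)

lemma center_sum: "(\<And>i. i \<in> F \<Longrightarrow> f i \<in> center) \<Longrightarrow> sum f F \<in> (center :: 'r set)"
  by (simp add: center_def sum_distrib_left sum_distrib_right)

lemma center_R_iff: "z \<in> center \<longleftrightarrow> \<iota> z \<in> center"
proof
  assume "z \<in> center"
  then have "y i * z = z * y i" for i by (simp add: center_def)
  then show "\<iota> z \<in> center" unfolding center_iff by (simp flip: \<iota>_mult)
next
  assume "\<iota> z \<in> center"
  then have "\<iota> (z * r) = \<iota> (r * z)" for r unfolding \<iota>_mult by (simp add: center_def)
  then show "z \<in> center" by (simp add: center_def \<iota>_inj)
qed

lemma homog_expansion:
  assumes "l \<le> N" "r \<in> R l" "homog emb n act w r"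
  obtains F d where "finite F" "F \<subseteq> nexps l" "r = mono_comb F d" "\<And>e. e \<in> F \<Longrightarrow> d e \<noteq> 0 \<Longrightarrow> wt_mono N e = w"
proof -
  obtain F d where F: "finite F" "F \<subseteq> nexps l" "r = mono_comb F d"
    using R_mono_comb[OF assms(1,2)] by blast
  have "F \<subseteq> nexps N" using F(2) nexps_mono[OF assms(1)] by blast
  then have "wt_mono N e = w" if "e \<in> F" "d e \<noteq> 0" for e
    using homog_component_weight[of F w d e] F assms(3) that by simp
  then show ?thesis using that F by blast
qed

text \<open>A homogeneous element of \<open>R l\<close> is a combination of ordered monomials of the
  same weight in \<open>x 1, ..., x l\<close>; on these the formula follows from the Leibniz rule
  because the values of \<open>\<eta>\<close> are central. The bound \<open>l\<close> makes this
  available before all generators have been treated.\<close>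

lemma derivation_on_homog:
  assumes \<theta>: "kderiv emb \<theta>" and \<eta>: "weight_hom n \<eta>"
    and gens: "\<And>j. j \<in> {1..l} \<Longrightarrow> \<theta> (x j) = \<eta> (wt_x j) * x j"
    and l: "l \<le> N" and r: "r \<in> R l" "homog emb n act w r"
  shows "\<theta> r = \<eta> w * r"
proof -
  have add: "\<eta> (\<lambda>i. w i + w' i) = \<eta> w + \<eta> w'" and cen: "\<eta> w \<in> center"
    if "w \<in> Qset n" "w' \<in> Qset n" for w w'
    using \<eta> that unfolding weight_hom_def by blast+
  have zero: "\<eta> (\<lambda>_. 0) = 0" using add[of "\<lambda>_. 0" "\<lambda>_. 0"] by (simp add: Qset_def)
  obtain F d where F: "finite F" "F \<subseteq> nexps l" "r = mono_comb F d"
    and wF: "\<And>e. e \<in> F \<Longrightarrow> d e \<noteq> 0 \<Longrightarrow> wt_mono N e = w"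
    using homog_expansion[OF l r] by blast
  have mono: "\<theta> (omon x N e) = \<eta> (wt_mono N e) * omon x N e" if e: "e \<in> F" for e
  proof -
    have "wt_mono N e \<in> Qset n \<and> \<theta> (omon x N e) = \<eta> (wt_mono N e) * omon x N e"
    proof (rule graded_omon[of "\<lambda>w r. w \<in> Qset n \<and> \<theta> r = \<eta> w * r"])
      have "\<theta> 1 = \<theta> 1 + \<theta> 1" using kderivD(3)[OF \<theta>, of 1 1] by simp
      then show "(\<lambda>_. 0) \<in> Qset n \<and> \<theta> 1 = \<eta> (\<lambda>_. 0) * 1" using zero by (simp add: Qset_def)
    next
      fix w r w' s
      assume *: "w \<in> Qset n \<and> \<theta> r = \<eta> w * r" "w' \<in> Qset n \<and> \<theta> s = \<eta> w' * s"
      then have "r * \<eta> w' = \<eta> w' * r" using cen[of w'] by (auto simp: center_def)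
      then have "r * (\<eta> w' * s) = \<eta> w' * (r * s)" by (simp flip: mult.assoc)
      then show "(\<lambda>l. w l + w' l) \<in> Qset n \<and> \<theta> (r * s) = \<eta> (\<lambda>l. w l + w' l) * (r * s)"
        using * by (simp add: Qset_add add kderivD(3)[OF \<theta>] distrib_right mult.assoc)
    next
      fix j assume j: "j \<in> {1..N}" "e j \<noteq> 0"
      have "j \<in> {1..l}" using F(2) e j(2) unfolding nexps_def by blast
      then show "wt_x j \<in> Qset n \<and> \<theta> (x j) = \<eta> (wt_x j) * x j" using gens homog_x[OF j(1)] by (simp add: homog_act)
    qed
    then show ?thesis by blast
  qed
  have \<theta>0: "\<theta> 0 = 0" using kderivD(1)[OF \<theta>, of 0 0] by simp
  have sum: "\<theta> (sum f G) = (\<Sum>i\<in>G. \<theta> (f i))" for f :: "(nat \<Rightarrow> nat) \<Rightarrow> 'r" and G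
    by (induction G rule: infinite_finite_induct) (auto simp: \<theta>0 kderivD(1)[OF \<theta>])
  have "\<theta> r = (\<Sum>e\<in>F. sc (d e) (\<theta> (omon x N e)))"
    unfolding F(3) mono_comb_def sum kderivD(2)[OF \<theta>] ..
  also have "\<dots> = (\<Sum>e\<in>F. \<eta> w * sc (d e) (omon x N e))"
  proof (intro sum.cong refl)
    fix e assume e: "e \<in> F"
    show "sc (d e) (\<theta> (omon x N e)) = \<eta> w * sc (d e) (omon x N e)"
      using mono[OF e] wF[OF e] by (cases "d e = 0") simp_all
  qed
  finally show ?thesis unfolding F(3) mono_comb_def sum_distrib_left .
qed

lemma kderiv_diff_ad:
  assumes "kderiv emb D"
  shows "kderiv emb (\<lambda>s. D s - ad r s)"
  unfolding kderiv_def
proof (intro conjI allI)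
  show "D (emb d * s) - ad r (emb d * s) = emb d * (D s - ad r s)" for d s
    using kderivD(2)[OF assms, of d s] by (simp add: ad_def V.scale_right_diff_distrib flip: sc_def)
qed (simp_all add: ad_def kderivD(1,3)[OF assms] algebra_simps)

lemma derivation_exists:
  assumes D: "kderiv emb D" and H: "hypothesis_H emb N \<mu> y \<iota>"
    and noncentral: "\<And>i. i \<in> {1..N} \<Longrightarrow> x i \<notin> center"
  obtains r \<eta> where "weight_hom n \<eta>" "ad_plus_theta emb n act D r \<eta>"
proof -
  obtain r z where z_center: "\<And>i. i \<in> {1..N} \<Longrightarrow> z i \<in> center"
    and z: "\<And>i. i \<in> {1..N} \<Longrightarrow> \<iota> (D (y i) - ad r (y i)) = z i * \<iota> (y i)"
    and z_L: "\<And>i k. i \<in> {1..N} \<Longrightarrow> k \<in> {1..N} \<Longrightarrow> k \<noteq> i \<Longrightarrow> z i \<in> L k"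
    using derivation_split[OF D] by blast
  define \<theta> where "\<theta> s = D s - ad r s" for s
  have \<theta>: "kderiv emb \<theta>" unfolding \<theta>_def by (rule kderiv_diff_ad[OF D])
  have z_cases: "z i \<in> range \<iota> \<or> \<iota> (y i) \<in> center" if "i \<in> {1..N}" for i
    using central_regular_or_y_central[OF H that z_center[OF that]] z_L[OF that] by blast
  have "\<exists>s. z i = \<iota> s" if "i \<in> initial_idx" for i
  proof -
    have i: "i \<in> {1..N}" "pred_idx \<mu> i = None" using that by (auto simp: initial_idx_def)
    have "\<iota> (y i) \<notin> center" using noncentral[OF i(1)] y_eq_x[OF i] center_R_iff by simp
    then show ?thesis using z_cases[OF i(1)] by blast
  qed
  then obtain \<zeta> where \<zeta>: "\<And>i. i \<in> initial_idx \<Longrightarrow> z i = \<iota> (\<zeta> i)" by metis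
  have \<zeta>_center: "\<zeta> i \<in> center" if "i \<in> initial_idx" for i
    using z_center[of i] \<zeta>[OF that] that center_R_iff by (simp add: initial_idx_def)
  obtain C :: "nat \<Rightarrow> nat \<Rightarrow> 'k" where
    C: "\<And>i i'. i \<in> initial_idx \<Longrightarrow> i' \<in> initial_idx \<Longrightarrow> (\<Sum>l<n. of_int (wt_x i l) * C l i') = (if i = i' then 1 else 0)"
    using weight_matrix_inverse by metis
  \<comment> \<open>Column \<open>j\<close> of \<open>C\<close> is the coordinate functional of
    \<open>wt_x j\<close> with respect to the initial weights, so \<open>\<eta>\<close> sends
    \<open>wt_x j\<close> to \<open>\<zeta> j\<close>.\<close>
  define \<eta> where "\<eta> w = (\<Sum>j\<in>initial_idx. sc (weight_functional (\<lambda>l. C l j) w) (\<zeta> j))" for w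
  have \<eta>_add: "\<eta> (\<lambda>l. w l + w' l) = \<eta> w + \<eta> w'" for w w'
    by (simp add: \<eta>_def weight_functional_add V.scale_left_distrib sum.distrib)
  have \<eta>_center: "\<eta> w \<in> center" for w unfolding \<eta>_def by (intro center_sum center_sc \<zeta>_center)
  have \<eta>: "weight_hom n \<eta>" unfolding weight_hom_def using \<eta>_add \<eta>_center by blast
  have \<eta>_W: "\<eta> (wt_x i) = \<zeta> i" if i: "i \<in> initial_idx" for i
  proof -
    have "\<eta> (wt_x i) = (\<Sum>j\<in>initial_idx. if i = j then \<zeta> j else 0)"
      unfolding \<eta>_def weight_functional_def using C[OF i] by (intro sum.cong) auto
    then show ?thesis using i finite_initial_idx by simp
  qed
  have main: "i \<in> {1..N} \<Longrightarrow> \<theta> (x i) = \<eta> (wt_x i) * x i" for i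
  proof (induction i rule: less_induct)
    case (less i)
    note i = less.prems
    show ?case
    proof (cases "pred_idx \<mu> i")
      case None
      then have "i \<in> initial_idx" using i by (simp add: initial_idx_def)
      then have "\<iota> (\<theta> (x i)) = \<iota> (\<eta> (wt_x i) * x i)"
        using z[OF i] \<zeta> \<eta>_W y_eq_x[OF i None] by (simp add: \<theta>_def \<iota>_mult)
      then show ?thesis unfolding \<iota>_inj .
    next
      case (Some p)
      have pN: "p \<in> {1..N}" using pred_in[OF i Some] by blast
      have iN: "i - 1 \<le> N" using i by auto
      have gens: "\<theta> (x j) = \<eta> (wt_x j) * x j" if "j \<in> {1..i - 1}" for j
      proof -
        have "j < i" "j \<in> {1..N}" using that i by auto
        then show ?thesis by (rule less.IH)
      qed
      have c: "\<theta> (c i) = \<eta> (wt_y i) * c i"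
        by (rule derivation_on_homog[OF \<theta> \<eta> gens iN c_in[OF i] wt_y_Some(2)[OF i Some]])
      have yp: "\<theta> (y p) = \<eta> (wt_y p) * y p"
        by (rule derivation_on_homog[OF \<theta> \<eta> gens iN p_in(3)[OF i Some] homog_y[OF pN]])
      have Vi: "\<eta> (wt_y i) = \<eta> (wt_y p) + \<eta> (wt_x i)" unfolding wt_y_Some(1)[OF i Some] by (rule \<eta>_add)
      have W_comm: "\<eta> (wt_x i) * y p = y p * \<eta> (wt_x i)" using \<eta>_center[of "wt_x i"] by (simp add: center_def)
      \<comment> \<open>The defect at the new generator. As the formula holds for \<open>y p\<close>
        and for \<open>c i\<close>, the defect at \<open>y i\<close> is \<open>y p * ?v\<close>; in
        the torus it is also a central element times \<open>y i\<close>.\<close>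
      let ?v = "\<theta> (x i) - \<eta> (wt_x i) * x i"
      have ycx: "y i + c i = y p * x i" by (simp add: c_def u_eq[OF i Some])
      have "\<theta> (y i + c i) = \<theta> (y p) * x i + y p * \<theta> (x i)" unfolding ycx by (rule kderivD(3)[OF \<theta>])
      then have "\<theta> (y i) = \<eta> (wt_y p) * (y p * x i) + y p * \<theta> (x i) - \<eta> (wt_y i) * c i"
        by (simp add: kderivD(1)[OF \<theta>] c yp mult.assoc algebra_simps)
      then have "\<theta> (y i) - \<eta> (wt_y i) * y i = \<eta> (wt_y p) * (y p * x i) + y p * \<theta> (x i) - \<eta> (wt_y i) * (y i + c i)"
        by (simp add: distrib_left)
      also have "\<dots> = y p * \<theta> (x i) - (\<eta> (wt_x i) * y p) * x i"
        unfolding Vi ycx by (simp add: distrib_right mult.assoc)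
      also have "\<dots> = y p * ?v" unfolding W_comm by (simp add: right_diff_distrib mult.assoc)
      finally have yv: "\<theta> (y i) - \<eta> (wt_y i) * y i = y p * ?v" .
      have zy: "(z i - \<iota> (\<eta> (wt_y i))) * \<iota> (y i) = \<iota> (y p * ?v)"
        using z[OF i] unfolding yv[symmetric] by (simp add: \<theta>_def \<iota>_diff \<iota>_mult left_diff_distrib)
      have z''_center: "z i - \<iota> (\<eta> (wt_y i)) \<in> center"
        using z_center[OF i] \<eta>_center[of "wt_y i"] center_R_iff[of "\<eta> (wt_y i)"]
        by (simp add: center_def left_diff_distrib right_diff_distrib)
      have "y p * ?v = 0"
        using z_cases[OF i]
      \<comment> \<open>In both cases a central element divisible by \<open>y p\<close> has to
        vanish: the factor \<open>\<xi>\<close> if \<open>z i\<close> is regular, and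
        \<open>y p * ?v\<close> itself if \<open>y i\<close> is central, where \<open>z i\<close>
        may have a pole along \<open>y i\<close>.\<close>
      proof
        assume "z i \<in> range \<iota>"
        then obtain \<xi> where \<xi>: "z i - \<iota> (\<eta> (wt_y i)) = \<iota> \<xi>" by (auto simp flip: \<iota>_diff)
        then have \<xi>_center: "\<xi> \<in> center" using z''_center center_R_iff by simp
        have "\<iota> (\<xi> * y i) = \<iota> (y p * ?v)" using zy \<xi> by (simp add: \<iota>_mult)
        then have \<xi>y: "\<xi> * y i = y p * ?v" unfolding \<iota>_inj .
        then have "y i * \<xi> = y p * ?v" using \<xi>_center by (simp add: center_def)
        moreover have "i \<noteq> p" using pred_in[OF i Some] by simp
        ultimately obtain s where "\<xi> = y p * s" using y_left_cancel[OF i pN] by blast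
        moreover have "x i * \<xi> = \<xi> * x i" using \<xi>_center by (simp add: center_def)
        ultimately have "\<xi> = 0" using commuting_multiple_eq_0[OF i Some] by blast
        then show ?thesis using \<xi>y by simp
      next
        assume y_center: "\<iota> (y i) \<in> center"
        have "(z i - \<iota> (\<eta> (wt_y i))) * \<iota> (y i) \<in> center"
          using z''_center y_center by (rule center_mult)
        then have "y p * ?v \<in> center" unfolding zy center_R_iff[symmetric] .
        then have "x i * (y p * ?v) = (y p * ?v) * x i" by (simp add: center_def)
        then show ?thesis by (rule commuting_multiple_eq_0[OF i Some _ refl])
      qed
      then have "?v = 0" using domain y_nonzero[OF pN] by blast
      then show ?thesis by simp
    qed
  qed
  have "D s = ad r s + \<eta> w * s" if "homog emb n act w s" for w s
  proof -
    have "\<theta> s = \<eta> w * s"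
      by (rule derivation_on_homog[OF \<theta> \<eta> main order_refl _ that]) (simp_all only: R_N UNIV_I)
    then show ?thesis by (simp add: \<theta>_def algebra_simps)
  qed
  then have "ad_plus_theta emb n act D r \<eta>" unfolding ad_plus_theta_def by blast
  then show ?thesis using that \<eta> by blast
qed

text \<open>The difference of two representations gives
  \<open>ad (r' - r) (y i) = \<omega> (wt_y i) * y i\<close> with a central factor. A central
  element of the form \<open>[s, y i]\<close> times the inverse of \<open>y i\<close> is zero, as
  conjugation by \<open>y i\<close> is diagonal on Laurent monomials. So \<open>\<omega>\<close>
  vanishes on the weights of the \<open>y i\<close>, hence on those of the \<open>x i\<close>, and
  everywhere; and \<open>r' - r\<close> commutes with all \<open>y i\<close>.\<close>

lemma derivation_unique:
  assumes \<eta>: "weight_hom n \<eta>" "ad_plus_theta emb n act D r \<eta>"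
    and \<eta>': "weight_hom n \<eta>'" "ad_plus_theta emb n act D r' \<eta>'"
  shows "ad r' = ad r" "w \<in> Qset n \<Longrightarrow> \<eta>' w = \<eta> w"
proof -
  define \<omega> where "\<omega> w = \<eta> w - \<eta>' w" for w
  have VQ: "wt_y i \<in> Qset n" if "i \<in> {1..N}" for i using homog_y[OF that] by (simp add: homog_act)
  have WQ: "wt_x i \<in> Qset n" if "i \<in> {1..N}" for i using homog_x[OF that] by (simp add: homog_act)
  have \<omega>_center: "\<omega> w \<in> center" if "w \<in> Qset n" for w
    using \<eta>(1) \<eta>'(1) that unfolding weight_hom_def \<omega>_def center_def
    by (simp add: left_diff_distrib right_diff_distrib)
  have \<omega>_add: "\<omega> (\<lambda>l. w l + w' l) = \<omega> w + \<omega> w'" if "w \<in> Qset n" "w' \<in> Qset n" for w w'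
    using \<eta>(1) \<eta>'(1) that unfolding weight_hom_def \<omega>_def by simp
  obtain F d where F: "finite F" "F \<subseteq> zexps N" "\<iota> (r' - r) = comb F d" by (rule T_comb)
  have key: "ad (r' - r) (y i) = \<omega> (wt_y i) * y i" if i: "i \<in> {1..N}" for i
  proof -
    have "ad r (y i) + \<eta> (wt_y i) * y i = ad r' (y i) + \<eta>' (wt_y i) * y i"
      using \<eta>(2) \<eta>'(2) homog_y[OF i] unfolding ad_plus_theta_def by metis
    then show ?thesis unfolding ad_def \<omega>_def by (simp add: algebra_simps)
  qed
  have V0: "\<omega> (wt_y i) = 0" if i: "i \<in> {1..N}" for i
  proof -
    let ?d = "\<lambda>m. d m - d m * q powi b i m"
    have "\<iota> (\<omega> (wt_y i)) * \<iota> (y i) = comb F d * \<iota> (y i) - \<iota> (y i) * comb F d"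
      using arg_cong[OF key[OF i], of \<iota>] F(3) by (simp add: ad_def \<iota>_diff \<iota>_mult)
    also have "\<dots> = comb F ?d * \<iota> (y i)"
      unfolding Y_comb[OF i] left_diff_distrib[symmetric] comb_diff ..
    finally have \<omega>_comb: "\<iota> (\<omega> (wt_y i)) = comb F ?d" by (rule unit_cancel_right[OF \<iota>_unit[OF i]])
    have "\<iota> (\<omega> (wt_y i)) \<in> center" using \<omega>_center[OF VQ[OF i]] center_R_iff by blast
    then have "comb F ?d * \<iota> (y i) = \<iota> (y i) * comb F ?d" unfolding \<omega>_comb by (simp add: center_def)
    then have "comb F ?d = comb F (\<lambda>m. ?d m * q powi b i m)"
      unfolding Y_comb[OF i] by (rule unit_cancel_right[OF \<iota>_unit[OF i]])
    have "?d m = 0" if "m \<in> F" for m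
    proof -
      have "?d m = ?d m * q powi b i m" by (rule comb_eq_iff[OF F(1,2) \<open>comb F ?d = _\<close> that])
      \<comment> \<open>One factor \<open>1 - q powi b i m\<close> comes from the commutator with
        \<open>y i\<close>, the other from its being central.\<close>
      then have "d m * (1 - q powi b i m) * (1 - q powi b i m) = 0" by (simp add: algebra_simps)
      then have "d m = 0 \<or> q powi b i m = 1" by simp
      then show ?thesis by auto
    qed
    then have "comb F ?d = 0" unfolding comb_def by (intro sum.neutral) simp
    then show ?thesis using \<omega>_comb \<iota>_0 \<iota>_inj by metis
  qed
  have "\<iota> (r' - r) \<in> center"
    unfolding center_iff
  proof
    fix i assume i: "i \<in> {1..N}"
    have "(r' - r) * y i = y i * (r' - r)" using key[OF i] V0[OF i] by (simp add: ad_def)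
    then show "\<iota> (y i) * \<iota> (r' - r) = \<iota> (r' - r) * \<iota> (y i)" by (simp flip: \<iota>_mult)
  qed
  then have "(r' - r) \<in> center" using center_R_iff by blast
  then show "ad r' = ad r" unfolding center_def ad_def by (auto simp: algebra_simps)
  have W0: "\<omega> (wt_x i) = 0" if i: "i \<in> {1..N}" for i
  proof (cases "pred_idx \<mu> i")
    case None then show ?thesis using V0[OF i] wt_y_None[OF i] by simp
  next
    case (Some p)
    then have p: "p \<in> {1..N}" using pred_in[OF i] by blast
    show ?thesis using \<omega>_add[OF VQ[OF p] WQ[OF i]] V0[OF i] V0[OF p] wt_y_Some(1)[OF i Some] by simp
  qed
  obtain C :: "nat \<Rightarrow> nat \<Rightarrow> 'k" where
    C: "\<And>l l'. l < n \<Longrightarrow> l' < n \<Longrightarrow> (\<Sum>i\<in>initial_idx. C l i * of_int (wt_x i l')) = (if l = l' then 1 else 0)"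
    using weight_matrix_inverse by metis
  let ?\<epsilon> = "\<lambda>l. \<omega> (\<lambda>i. if i = l then 1 else 0)"
  have unit0: "?\<epsilon> l = 0" if l: "l < n" for l
  proof -
    have "0 = (\<Sum>i\<in>initial_idx. sc (C l i) (\<omega> (wt_x i)))" using W0 by (simp add: initial_idx_def)
    also have "\<dots> = (\<Sum>i\<in>initial_idx. \<Sum>l'<n. sc (C l i * of_int (wt_x i l')) (?\<epsilon> l'))"
      using WQ by (intro sum.cong refl) (auto simp: initial_idx_def additive_weight_function[of \<omega>, OF \<omega>_add] V.scale_sum_right)
    also have "\<dots> = (\<Sum>l'<n. sc (\<Sum>i\<in>initial_idx. C l i * of_int (wt_x i l')) (?\<epsilon> l'))"
      by (subst sum.swap) (simp add: V.scale_sum_left)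
    also have "\<dots> = (\<Sum>l'<n. if l = l' then ?\<epsilon> l' else 0)"
      using C[OF l] by (intro sum.cong) auto
    also have "\<dots> = ?\<epsilon> l" using l by simp
    finally show ?thesis by simp
  qed
  show "\<eta>' w = \<eta> w" if "w \<in> Qset n"
  proof -
    have "\<omega> w = (\<Sum>l<n. sc (of_int (w l)) (?\<epsilon> l))"
      using additive_weight_function[of \<omega>] \<omega>_add that by blast
    also have "\<dots> = (\<Sum>l<n. sc (of_int (w l)) 0)"
      using unit0 by (intro sum.cong refl arg_cong2[where f = sc]) blast
    finally show ?thesis by (simp add: \<omega>_def)
  qed
qed

end

theorem theorem5p8:
  fixes emb :: "'k::field_char_0 \<Rightarrow> 'r::ring_1"
    and N n :: nat
    and x :: "nat \<Rightarrow> 'r"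
    and \<sigma> \<delta> :: "nat \<Rightarrow> 'r \<Rightarrow> 'r"
    and act :: "(nat \<Rightarrow> 'k) \<Rightarrow> 'r \<Rightarrow> 'r"
    and \<mu> :: "nat \<Rightarrow> nat"
    and y :: "nat \<Rightarrow> 'r"
    and \<iota> :: "'r \<Rightarrow> 't::ring_1"
  assumes QNA: "uniparameter_QNA emb N x \<sigma> \<delta> n act"
    and GY: "GY_elements emb N x n act \<mu> y"
    and Tq: "quantum_torus_loc N y \<iota>"
    and noncentral: "\<forall>i\<in>{1..N}. x i \<notin> center"
    and H: "hypothesis_H emb N \<mu> y \<iota>"
    and D: "kderiv emb D"
  shows "\<exists>a \<eta>. weight_hom n \<eta> \<and> ad_plus_theta emb n act D a \<eta> \<and>
           (\<forall>a' \<eta>'. weight_hom n \<eta>' \<and> ad_plus_theta emb n act D a' \<eta>' \<longrightarrow>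
               ad a' = ad a \<and> (\<forall>w\<in>Qset n. \<eta>' w = \<eta> w))"
proof -
  have ore: "iterated_ore emb N x \<sigma> \<delta>" and torus: "rational_torus_action emb n act"
    and max: "maximal_torus_action emb N x n act" and hom: "\<forall>i\<in>{1..N}. is_homog emb n act (x i)"
    and elts: "\<forall>k\<in>{1..N}. \<exists>h\<in>Htor n. \<exists>qk. not_root_of_unity qk \<and>
        (\<forall>a\<in>Rsub emb x (k - 1). act h a = (if k = 1 then a else \<sigma> k a)) \<and> act h (x k) = emb qk * x k"
    and uni: "\<exists>q (a::nat \<Rightarrow> nat \<Rightarrow> int). not_root_of_unity q \<and>
        (\<forall>i\<in>{1..N}. \<forall>j\<in>{1..N}. a i j = - a j i) \<and>
        (\<forall>k\<in>{2..N}. \<forall>j\<in>{1..<k}. \<sigma> k (x j) = emb (q powi a k j) * x j)"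
    using QNA unfolding uniparameter_QNA_def by blast+
  obtain q0 :: 'k and a0 :: "nat \<Rightarrow> nat \<Rightarrow> int" where q0: "not_root_of_unity q0"
    "\<forall>k\<in>{2..N}. \<forall>j\<in>{1..<k}. \<sigma> k (x j) = emb (q0 powi a0 k j) * x j" using uni by blast
  interpret O: ore_tower emb N x \<sigma> \<delta>
    by unfold_locales (use ore in \<open>auto simp: iterated_ore_def\<close>)
  \<comment> \<open>\<open>not_root_of_unity 0\<close> holds; if \<open>q0 = 0\<close> then injectivity of \<open>\<sigma>\<close> forces all exponents to be \<open>0\<close>.\<close>
  obtain q :: 'k and a :: "nat \<Rightarrow> nat \<Rightarrow> int" where q: "q \<noteq> 0" "not_root_of_unity q"
    "\<forall>k\<in>{2..N}. \<forall>j\<in>{1..<k}. \<sigma> k (x j) = emb (q powi a k j) * x j"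
  proof (cases "q0 = 0")
    case False then show ?thesis using that q0 by blast
  next
    case True
    have "\<sigma> k (x j) = emb (2 powi 0) * x j" if k: "k \<in> {2..N}" and j: "j \<in> {1..<k}" for k j
    proof -
      have kN: "k \<in> {1..N}" and jN: "j \<in> {1..N}" and xj: "x j \<in> O.R (k - 1)"
        using k j by (auto intro!: O.x_in_R)
      have "x j \<noteq> 0"
      proof
        assume "x j = 0"
        then have "1 * x j ^ 1 \<in> O.Fil j 1" using O.Fil_0_in[of j 1] by simp
        then have "(1::'r) = 0" using O.Fil_top_eq_0[OF jN O.R_1_in] by blast
        then show False using O.emb_eq_0_iff[of 1] by (simp add: O.emb_1)
      qed
      have "O.sg k (x j) \<noteq> 0" using O.sg_eq_0[OF kN xj] \<open>x j \<noteq> 0\<close> by blast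
      then have "emb (q0 powi a0 k j) * x j \<noteq> 0" using q0(2) k j by (simp add: O.sg_def)
      then have "a0 k j = 0" using True O.emb_0 by (cases "a0 k j = 0") simp_all
      then show ?thesis using q0(2) k j by simp
    qed
    moreover have "not_root_of_unity (2::'k)"
      unfolding not_root_of_unity_def
    proof (intro allI impI)
      fix m :: nat assume "0 < m"
      then show "(2::'k) ^ m \<noteq> 1" using two_powi_eq_1[of "int m", where 'k = 'k] by simp
    qed
    ultimately show ?thesis by (intro that[of 2 "\<lambda>_ _. 0"]) auto
  qed
  interpret torus_tower emb N x \<sigma> \<delta> n act \<mu> y q a \<iota>
  proof
    show "h = (\<lambda>i. 1)" if "h \<in> Htor n" "act h = id" for h
      using max that unfolding maximal_torus_action_def by blast
    show "is_homog emb n act (x i)" if "i \<in> {1..N}" for i using hom that by blast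
    show "\<sigma> k (x j) = emb (q powi a k j) * x j" if "k \<in> {2..N}" "j \<in> {1..<k}" for k j using q(3) that by blast
    show "\<exists>h\<in>Htor n. \<exists>qk. not_root_of_unity qk \<and>
        (\<forall>b\<in>Rsub emb x (k - 1). act h b = (if k = 1 then b else \<sigma> k b)) \<and> act h (x k) = emb qk * x k"
      if "k \<in> {1..N}" for k using elts that by blast
  qed (fact torus q(1,2) GY Tq)+
  obtain r \<eta> where \<eta>: "weight_hom n \<eta>" "ad_plus_theta emb n act D r \<eta>"
    using derivation_exists[OF D H] noncentral by blast
  show ?thesis
    using \<eta> derivation_unique[OF \<eta>] by blast
qed

end
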